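(* Let $(S_n)_{n\ge 0}$ be an ERWG process whose memory matrix $B$ is diagonalisable over $\mathbb{C}$. If $\eta<\frac12$ then $$\frac{S_n}{\sqrt n}\xrightarrow{d}\mathcal{N}_k(0,\Sigma^{(1)}),\qquad \Sigma^{(1)}=\int_0^\infty e^{(B-\frac12I)'t}e^{(B-\frac12I)t}\,dt,$$ and if $\eta=\frac12$ then $$\frac{S_n}{\sqrt{n\log n}}\xrightarrow{d}\mathcal{N}_k(0,\Sigma^{(2)}),\qquad \Sigma^{(2)}=\lim_{n\to\infty}\frac1{\log n}\int_0^{\log n}e^{(B-\frac12I)'t}e^{(B-\frac12I)t}\,dt.$$ In particular, if $B$ is symmetric, and $T$ is an orthogonal matrix with $T'BT=\mathrm{diag}(\lambda_1,\dots,\lambda_k)$, then $\Sigma^{(1)}=(I-2B)^{-1}$ when $\eta<\frac12$, and $\Sigma^{(2)}=\sum_{j=1}^k\mathbf{1}_{\{\lambda_j=\frac12\}}Te_j'e_jT'$ when $\eta=\frac12$.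
   Context: ERWG model. Let $k\ge1$, $V=\{1,\dots,k\}$, and let $(V,\overrightarrow{E})$, $\overrightarrow{E}\subseteq V\times V$, be a directed graph (self-loops allowed) in which every vertex $j$ has in-degree $d_j^{\rm in}=|\{i:(i,j)\in\overrightarrow{E}\}|\ge1$. Let $p_v,q_v\in[0,1]$ for $v\in V$. $\mathrm{Rad}(p)$ is the law on $\{-1,1\}$ giving mass $p$ to $1$. Let $\{\sigma^{(v)},\xi_n^{(v)},D_n^{(v)},u_n^{(v)}: n\ge1,v\in V\}$ be independent with $\sigma^{(v)}\sim\mathrm{Rad}(q_v)$, $\xi_n^{(v)}\sim\mathrm{Rad}(p_v)$, $D_n^{(v)}\sim\mathrm{Unif}\{1,\dots,n\}$, $u_n^{(v)}\sim\mathrm{Unif}\{v':(v',v)\in\overrightarrow{E}\}$. Define $X_1^{(v)}=\sigma^{(v)}$ and, for $n\ge1$, $X_{n+1}^{(v)}=\xi_n^{(v)}X^{(u_n^{(v)})}_{D_n^{(v)}}$; set $X_n=(X_n^{(1)},\dots,X_n^{(k)})$, $S_0=0$, $S_n=\sum_{j=1}^nX_j$. The process $(S_n)$ is called the ERWG process. Its memory matrix is the $k\times k$ matrix $B$ with $B_{i,j}=\frac{2p_j-1}{d_j^{\rm in}}\mathbf{1}_{\{(i,j)\in\overrightarrow{E}\}}$. Let $\lambda_1,\dots,\lambda_k$ be the eigenvalues of $B$ (with multiplicity) and $\eta=\max_j\Re(\lambda_j)$. All vectors are row vectors, $e_j$ are the canonical basis row vectors, $A'$ is the transpose of $A$, $I$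 the identity, $\xrightarrow{d}$ is weak convergence. *)

theory Defs
  imports "HOL-Probability.Probability"
begin

subsection \<open>Linear algebra\<close>

definition diagonalisable :: "'a::semiring_1^'n^'n \<Rightarrow> bool" where
  "diagonalisable A \<longleftrightarrow>
    (\<exists>P D :: 'a^'n^'n. invertible P \<and> (\<forall>i j. i \<noteq> j \<longrightarrow> D $ i $ j = 0) \<and> A = P ** D ** matrix_inv P)"

(* The family lam, indexed by the same finite type as the rows, lists the roots of the
   characteristic polynomial with algebraic multiplicity, in an arbitrary order. *)
definition lists_eigenvalues :: "complex^'n^'n \<Rightarrow> ('n \<Rightarrow> complex) \<Rightarrow> bool" where
  "lists_eigenvalues A lam \<longleftrightarrow> (\<forall>z. det (mat z - A) = (\<Prod>j\<in>UNIV. z - lam j))"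

abbreviation complex_matrix :: "real^'n^'m \<Rightarrow> complex^'n^'m" where
  "complex_matrix \<equiv> map_matrix complex_of_real"

(* The library's componentwise product on vectors makes its own power and exp unsuitable. *)
definition matrix_power :: "real^'n^'n \<Rightarrow> nat \<Rightarrow> real^'n^'n" where
  "matrix_power A n = (((**) A) ^^ n) (mat 1)"

definition matrix_exp :: "real^'n^'n \<Rightarrow> real^'n^'n" where
  "matrix_exp A = (\<Sum>n. (1 / fact n) *\<^sub>R matrix_power A n)"


subsection \<open>Weak convergence and multivariate normal laws\<close>

definition weakly_converges ::
    "(nat \<Rightarrow> 'a::topological_space measure) \<Rightarrow> 'a measure \<Rightarrow> bool" where
  "weakly_converges \<mu> \<nu> \<longleftrightarrow>
    (\<forall>f :: 'a \<Rightarrow> real. continuous_on UNIV f \<and> bounded (range f) \<longrightarrow>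
      (\<lambda>n. \<integral>x. f x \<partial>\<mu> n) \<longlonglongrightarrow> (\<integral>x. f x \<partial>\<nu>))"

definition std_normal_vec :: "(real^'n) measure" where
  "std_normal_vec = density lborel (\<lambda>z. ennreal (\<Prod>i\<in>UNIV. std_normal_density (z $ i)))"

(* N is the law of m + A Z with Z standard normal and A A' = C.  The covariance C may be
   singular, and the law does not depend on the choice of A. *)
definition is_normal_vec :: "(real^'n) measure \<Rightarrow> real^'n \<Rightarrow> real^'n^'n \<Rightarrow> bool" where
  "is_normal_vec N m C \<longleftrightarrow>
    (\<exists>A :: real^'n^'n. A ** transpose A = C \<and>
       N = distr std_normal_vec borel (\<lambda>z. m + A *v z))"


subsection \<open>The ERWG process\<close>

definition Rad :: "real \<Rightarrow> int pmf" where
  "Rad p = map_pmf (\<lambda>b. if b then 1 else -1) (bernoulli_pmf p)"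

definition in_nbrs :: "('v \<times> 'v) set \<Rightarrow> 'v \<Rightarrow> 'v set" where
  "in_nbrs E v = {v'. (v', v) \<in> E}"

definition in_deg :: "('v \<times> 'v) set \<Rightarrow> 'v \<Rightarrow> nat" where
  "in_deg E v = card (in_nbrs E v)"

definition has_law :: "'w measure \<Rightarrow> ('w \<Rightarrow> 'b) \<Rightarrow> 'b pmf \<Rightarrow> bool" where
  "has_law M Y P \<longleftrightarrow>
    Y \<in> M \<rightarrow>\<^sub>M count_space UNIV \<and> distr M (count_space UNIV) Y = measure_pmf P"

(* The driving variables take values in different types, so their joint independence is
   stated as independence of the sigma-algebras they generate, indexed by this datatype. *)
datatype 'v driver = Init 'v | Sign nat 'v | Time nat 'v | Nbr nat 'v

fun driver_events ::
    "'w measure \<Rightarrow> ('v \<Rightarrow> 'w \<Rightarrow> int) \<Rightarrow> (nat \<Rightarrow> 'v \<Rightarrow> 'w \<Rightarrow> int) \<Rightarrow> (nat \<Rightarrow> 'v \<Rightarrow> 'w \<Rightarrow> nat) \<Rightarrow>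
     (nat \<Rightarrow> 'v \<Rightarrow> 'w \<Rightarrow> 'v) \<Rightarrow> 'v driver \<Rightarrow> 'w set set" where
  "driver_events M \<sigma> \<xi> D u (Init v) = {\<sigma> v -` A \<inter> space M | A. True}"
| "driver_events M \<sigma> \<xi> D u (Sign n v) = {\<xi> n v -` A \<inter> space M | A. True}"
| "driver_events M \<sigma> \<xi> D u (Time n v) = {D n v -` A \<inter> space M | A. True}"
| "driver_events M \<sigma> \<xi> D u (Nbr n v) = {u n v -` A \<inter> space M | A. True}"

locale ERWG = prob_space M
  for M :: "'w measure" +
  fixes E :: "('v::finite \<times> 'v) set"
    and p q :: "'v \<Rightarrow> real"
    and \<sigma> :: "'v \<Rightarrow> 'w \<Rightarrow> int"
    and \<xi> :: "nat \<Rightarrow> 'v \<Rightarrow> 'w \<Rightarrow> int"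
    and D :: "nat \<Rightarrow> 'v \<Rightarrow> 'w \<Rightarrow> nat"
    and u :: "nat \<Rightarrow> 'v \<Rightarrow> 'w \<Rightarrow> 'v"
  assumes in_deg_ge_1: "\<And>v. in_deg E v \<ge> 1"
    and p_range: "\<And>v. p v \<in> {0..1}"
    and q_range: "\<And>v. q v \<in> {0..1}"
    and law_\<sigma>: "\<And>v. has_law M (\<sigma> v) (Rad (q v))"
    and law_\<xi>: "\<And>n v. n \<ge> 1 \<Longrightarrow> has_law M (\<xi> n v) (Rad (p v))"
    and law_D: "\<And>n v. n \<ge> 1 \<Longrightarrow> has_law M (D n v) (pmf_of_set {1..n})"
    and law_u: "\<And>n v. n \<ge> 1 \<Longrightarrow> has_law M (u n v) (pmf_of_set (in_nbrs E v))"
    and indep: "indep_sets (driver_events M \<sigma> \<xi> D u)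
      (range Init \<union> (\<Union>n\<in>{1..}. range (Sign n) \<union> range (Time n) \<union> range (Nbr n)))"

(* Value of X_n^(v) at the outcome w.  Since D_n is uniform on {1..n}, the junk value 0
   (at time 0, or when D_n > n) enters only on a null set. *)
fun erwg_X ::
    "('v \<Rightarrow> 'w \<Rightarrow> int) \<Rightarrow> (nat \<Rightarrow> 'v \<Rightarrow> 'w \<Rightarrow> int) \<Rightarrow> (nat \<Rightarrow> 'v \<Rightarrow> 'w \<Rightarrow> nat) \<Rightarrow>
     (nat \<Rightarrow> 'v \<Rightarrow> 'w \<Rightarrow> 'v) \<Rightarrow> 'w \<Rightarrow> nat \<Rightarrow> 'v \<Rightarrow> int" where
  "erwg_X \<sigma> \<xi> D u w 0 v = 0"
| "erwg_X \<sigma> \<xi> D u w (Suc 0) v = \<sigma> v w"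
| "erwg_X \<sigma> \<xi> D u w (Suc (Suc m)) v =
    (let n = Suc m in
     if D n v w \<le> n then \<xi> n v w * erwg_X \<sigma> \<xi> D u w (D n v w) (u n v w) else 0)"

definition erwg_S ::
    "('v \<Rightarrow> 'w \<Rightarrow> int) \<Rightarrow> (nat \<Rightarrow> 'v \<Rightarrow> 'w \<Rightarrow> int) \<Rightarrow> (nat \<Rightarrow> 'v \<Rightarrow> 'w \<Rightarrow> nat) \<Rightarrow>
     (nat \<Rightarrow> 'v \<Rightarrow> 'w \<Rightarrow> 'v) \<Rightarrow> nat \<Rightarrow> 'w \<Rightarrow> real^'v" where
  "erwg_S \<sigma> \<xi> D u n w = (\<Sum>j=1..n. \<chi> v. real_of_int (erwg_X \<sigma> \<xi> D u w j v))"

definition memory_matrix :: "('v \<times> 'v) set \<Rightarrow> ('v \<Rightarrow> real) \<Rightarrow> real^'v^'v" where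
  "memory_matrix E p =
    (\<chi> i j. if (i, j) \<in> E then (2 * p j - 1) / real (in_deg E j) else 0)"


subsection \<open>The limiting covariance matrices\<close>

definition cov_integrand :: "real^'n^'n \<Rightarrow> real \<Rightarrow> real^'n^'n" where
  "cov_integrand B t =
    matrix_exp (t *\<^sub>R transpose (B - mat (1/2))) ** matrix_exp (t *\<^sub>R (B - mat (1/2)))"

definition Sigma1 :: "real^'n^'n \<Rightarrow> real^'n^'n" where
  "Sigma1 B = integral {0..} (cov_integrand B)"

definition Sigma2_seq :: "real^'n^'n \<Rightarrow> nat \<Rightarrow> real^'n^'n" where
  "Sigma2_seq B n = (1 / ln (real n)) *\<^sub>R integral {0..ln (real n)} (cov_integrand B)"

definition Sigma2 :: "real^'n^'n \<Rightarrow> real^'n^'n" where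
  "Sigma2 B = lim (Sigma2_seq B)"

end

theory Submission
  imports Defs "HOL-Real_Asymp.Real_Asymp"
begin

text \<open>
  Given the history, the components of \<open>X (n+1)\<close> are independent signs with means \<open>(S n B) / n\<close>, so
  \<open>S n\<close> is a Markov chain. Writing \<open>\<phi> n t\<close> for the characteristic function of \<open>S n\<close>, one step gives
  \<open>\<phi> (n+1) t = exp (- |t|^2 / 2) * \<phi> n ((I + B/n) t)\<close> up to an error of order
  \<open>|t|^3 + |t|^2 E |S n|^2 / n^2\<close>. Unrolling, \<open>\<phi> n t\<close> is close to \<open>exp (- W n t / 2)\<close>, where \<open>W n t\<close> is
  the sum of the squared norms of the vectors obtained by transporting \<open>t\<close> back from time \<open>n\<close>.
  The same quadratic form dominates the second moments of \<open>S n\<close>, which controls the error.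

  In coordinates with respect to eigenvectors of \<open>B\<close>, the form \<open>W n\<close> satisfies
  \<open>c (n+1) = (1 + cnj d a / n) * (1 + d b / n) * c n + g\<close> entrywise. With \<open>s = cnj d a + d b\<close>,
  \<open>c n / n\<close> tends to \<open>g / (1 - s)\<close> if \<open>Re s < 1\<close>, and \<open>c n / (n ln n)\<close> tends to \<open>g\<close> or \<open>0\<close> according to
  whether \<open>s = 1\<close> if \<open>Re s \<le> 1\<close>. The covariance integrals have the same entries because
  the integrand is a combination of the exponentials \<open>exp (t * (s - 1))\<close>.
\<close>

subsection \<open>Weak convergence from characteristic functions\<close>

text \<open>Transporting \<open>t\<close> from time \<open>n\<close> back to time \<open>k\<close>
  applies the product of \<open>I + B/j\<close> over \<open>k <= j < n\<close>, which behaves like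
  the power \<open>(n/k)^B\<close>. With \<open>k = n exp (-r)\<close>, the mean
  \<open>W n t / n\<close> looks like a Riemann sum for the integral of
  \<open>|exp ((B - I/2) r) t|^2\<close>, the half coming from the Jacobian \<open>exp (-r)\<close>;
  this is the origin of the covariance, and at \<eta> = 1/2 the range of \<open>r\<close> is cut at
  \<open>ln n\<close>. The Riemann sum is not made rigorous: both sides are reduced to the same
  coefficients with respect to eigenvectors, which need not be orthogonal. The obstacle is that the
  conditional covariance of a step is random: a sign with conditional mean \<open>m\<close> has
  variance \<open>1 - m^2\<close>. Replacing it by 1 costs about \<open>|t|^2 m^2\<close> at each
  step. It suffices that the mean of \<open>m^2\<close> tends to 0, because after normalisation the
  squared norms of the transported vectors have a bounded sum while each of them becomes uniformly
  small, so the errors average out. Since each step multiplies by a Gaussian factor of modulus at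
  most 1, unrolling does not amplify the errors already made.\<close>

inductive trig_poly :: "('a::euclidean_space \<Rightarrow> real) \<Rightarrow> bool" where
  cos: "trig_poly (\<lambda>x. cos (t \<bullet> x))"
| sin: "trig_poly (\<lambda>x. sin (t \<bullet> x))"
| add: "trig_poly f \<Longrightarrow> trig_poly g \<Longrightarrow> trig_poly (\<lambda>x. f x + g x)"
| scale: "trig_poly f \<Longrightarrow> trig_poly (\<lambda>x. c * f x)"

lemma trig_poly_const: "trig_poly (\<lambda>x. c)"
  using trig_poly.scale[OF trig_poly.cos[of 0], of c] by simp

lemma trig_poly_continuous: "trig_poly f \<Longrightarrow> continuous_on UNIV f"
  by (induction rule: trig_poly.induct) (intro continuous_intros; assumption)+

lemma trig_poly_bounded: "trig_poly f \<Longrightarrow> \<exists>K. \<forall>x. \<bar>f x\<bar> \<le> K"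
proof (induction rule: trig_poly.induct)
  case (add f g)
  then obtain K L where "\<forall>x. \<bar>f x\<bar> \<le> K" "\<forall>x. \<bar>g x\<bar> \<le> L" by blast
  then have "\<forall>x. \<bar>f x + g x\<bar> \<le> K + L"
    by (metis abs_triangle_ineq add_mono order_trans)
  then show ?case by blast
next
  case (scale f c)
  then obtain K where "\<forall>x. \<bar>f x\<bar> \<le> K" by blast
  then have "\<forall>x. \<bar>c * f x\<bar> \<le> \<bar>c\<bar> * K"
    by (simp add: abs_mult mult_left_mono)
  then show ?case by blast
qed (use abs_cos_le_one abs_sin_le_one in blast)+

lemma trig_poly_mult_cos_sin:
  assumes "trig_poly g"
  shows "trig_poly (\<lambda>x. cos (t \<bullet> x) * g x) \<and> trig_poly (\<lambda>x. sin (t \<bullet> x) * g x)"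
  using assms
proof (induction rule: trig_poly.induct)
  case (cos s)
  have "(\<lambda>x. cos (t \<bullet> x) * cos (s \<bullet> x)) =
      (\<lambda>x. (1/2) * cos ((t - s) \<bullet> x) + (1/2) * cos ((t + s) \<bullet> x))"
    "(\<lambda>x. sin (t \<bullet> x) * cos (s \<bullet> x)) =
      (\<lambda>x. (1/2) * sin ((t + s) \<bullet> x) + (1/2) * sin ((t - s) \<bullet> x))"
    by (simp_all add: fun_eq_iff cos_times_cos sin_times_cos inner_add_left inner_diff_left
        add_divide_distrib)
  then show ?case
    by (simp only:) (intro conjI trig_poly.intros)
next
  case (sin s)
  have "(\<lambda>x. cos (t \<bullet> x) * sin (s \<bullet> x)) =
      (\<lambda>x. (1/2) * sin ((t + s) \<bullet> x) + (-1/2) * sin ((t - s) \<bullet> x))"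
    "(\<lambda>x. sin (t \<bullet> x) * sin (s \<bullet> x)) =
      (\<lambda>x. (1/2) * cos ((t - s) \<bullet> x) + (-1/2) * cos ((t + s) \<bullet> x))"
    by (simp_all add: fun_eq_iff cos_times_sin sin_times_sin inner_add_left inner_diff_left
        diff_divide_distrib)
  then show ?case
    by (simp only:) (intro conjI trig_poly.intros)
next
  case (add f g)
  then show ?case by (auto simp: distrib_left intro: trig_poly.add)
next
  case (scale f c)
  then show ?case
    using trig_poly.scale[of "\<lambda>x. cos (t \<bullet> x) * f x" c]
      trig_poly.scale[of "\<lambda>x. sin (t \<bullet> x) * f x" c]
    by (simp add: mult.left_commute)
qed

text \<open>Products are not a constructor of \<open>trig_poly\<close>, so that inductions over it
  need linearity only. Closure under products, which Stone-Weierstrass asks for, is recovered here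
  from the product-to-sum formulas.\<close>

lemma trig_poly_mult:
  assumes "trig_poly f" "trig_poly g"
  shows "trig_poly (\<lambda>x. f x * g x)"
  using assms
proof (induction rule: trig_poly.induct)
  case (add f h)
  then show ?case by (simp add: distrib_right trig_poly.add)
next
  case (scale f c)
  then show ?case using trig_poly.scale[of "\<lambda>x. f x * g x" c] by (simp add: mult.assoc)
qed (use trig_poly_mult_cos_sin in blast)+

lemma trig_poly_compose_polynomial:
  fixes q :: "real \<Rightarrow> real"
  assumes "real_polynomial_function q" "trig_poly f"
  shows "trig_poly (\<lambda>x. q (f x))"
  using assms(1)
proof (induction rule: real_polynomial_function.induct)
  case (linear h)
  then obtain c where "h = (\<lambda>x. x * c)" using real_bounded_linear by blast
  then show ?case using trig_poly.scale[OF assms(2), of c] by (simp add: mult.commute)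
qed (auto intro: trig_poly_const trig_poly.add trig_poly_mult)

lemma trig_poly_separates:
  fixes x y :: "'a::euclidean_space"
  assumes "x \<noteq> y"
  shows "\<exists>f. trig_poly f \<and> f x \<noteq> f y"
proof (rule ccontr)
  \<comment> \<open>Normalised so that \<open>t\<close> has inner product 1 with
    \<open>x - y\<close>; since 1 is not an integer multiple of 2 pi, the sine and the cosine cannot
    both agree at \<open>x\<close> and \<open>y\<close>.\<close>
  define t where "t = (1 / (norm (x - y))\<^sup>2) *\<^sub>R (x - y)"
  assume "\<not> ?thesis"
  then have eq: "f x = f y" if "trig_poly f" for f using that by blast
  have "cos (t \<bullet> x) = cos (t \<bullet> y)" "sin (t \<bullet> x) = sin (t \<bullet> y)"
    using eq[OF trig_poly.cos[of t]] eq[OF trig_poly.sin[of t]] by simp_all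
  then have "cos (t \<bullet> x - t \<bullet> y) = 1"
    by (simp add: cos_diff flip: power2_eq_square)
  moreover have "t \<bullet> x - t \<bullet> y = 1"
    using assms
    by (simp add: t_def power2_norm_eq_inner flip: diff_divide_distrib inner_diff_right)
  ultimately show False
    using cos_one_2pi_int[of 1] cos_monotone_0_pi[of 0 1] pi_gt3 by simp
qed

lemma trig_poly_approx:
  fixes f :: "'a::euclidean_space \<Rightarrow> real"
  assumes S: "compact S" and f: "continuous_on S f" and e: "0 < e"
    and bnd: "\<And>x. x \<in> S \<Longrightarrow> \<bar>f x\<bar> \<le> K"
  obtains g where "trig_poly g" "\<And>x. x \<in> S \<Longrightarrow> \<bar>f x - g x\<bar> < e" "\<And>x. \<bar>g x\<bar> \<le> \<bar>K\<bar> + e"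
proof -
  have "\<exists>g. trig_poly g \<and> (\<forall>x \<in> S. \<bar>f x - g x\<bar> < e/2)"
    by (rule Stone_Weierstrass_HOL[OF S])
      (use f e trig_poly_separates in \<open>auto intro: trig_poly_const trig_poly.add trig_poly_mult
        continuous_on_subset[OF trig_poly_continuous]\<close>)
  then obtain h where h: "trig_poly h" "\<And>x. x \<in> S \<Longrightarrow> \<bar>f x - h x\<bar> < e/2" by blast
  obtain L where L: "\<And>x. \<bar>h x\<bar> \<le> L" using trig_poly_bounded[OF h(1)] by blast
  \<comment> \<open>Off \<open>S\<close> the approximation may be large; a polynomial close to the truncation to
    \<open>[-K, K]\<close> restores a bound there and is harmless on \<open>S\<close>.\<close>
  define c where "c y = max (-\<bar>K\<bar>) (min \<bar>K\<bar> y)" for y :: real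
  have "continuous_on {-L..L} c" unfolding c_def by (intro continuous_intros)
  then obtain q where q: "real_polynomial_function q"
      "\<And>y. y \<in> {-L..L} \<Longrightarrow> \<bar>c y - q y\<bar> < e/2"
    using Stone_Weierstrass_real_polynomial_function[of "{-L..L}" c "e/2"] e by auto
  have q': "\<bar>c (h x) - q (h x)\<bar> < e/2" for x
    using q(2)[of "h x"] L[of x] by (simp add: abs_le_iff)
  show ?thesis
  proof
    show "trig_poly (\<lambda>x. q (h x))" by (rule trig_poly_compose_polynomial[OF q(1) h(1)])
    show "\<bar>f x - q (h x)\<bar> < e" if "x \<in> S" for x
      using q'[of x] h(2)[OF that] bnd[OF that] unfolding c_def by linarith
    show "\<bar>q (h x)\<bar> \<le> \<bar>K\<bar> + e" for x
      using q'[of x] e unfolding c_def by linarith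
  qed
qed

section \<open>Characteristic functions on Euclidean space and a continuity theorem under
  tightness\<close>

definition chf :: "'a::euclidean_space measure \<Rightarrow> 'a \<Rightarrow> complex" where
  "chf \<mu> t = (\<integral>x. cis (t \<bullet> x) \<partial>\<mu>)"

lemma borel_bounded_integrable:
  fixes f :: "'a::euclidean_space \<Rightarrow> 'b::{banach,second_countable_topology}"
  assumes "prob_space \<mu>" "sets \<mu> = sets borel" "f \<in> borel_measurable borel" "\<And>x. norm (f x) \<le> K"
  shows "integrable \<mu> f"
proof -
  interpret prob_space \<mu> by fact
  have "f \<in> borel_measurable \<mu>" using assms(2,3) by (simp cong: measurable_cong_sets)
  then show ?thesis by (intro integrable_const_bound[of _ K]) (use assms in auto)
qed

lemma cis_inner_measurable [measurable]:
  "(\<lambda>x. cis (t \<bullet> (x :: 'a::euclidean_space))) \<in> borel_measurable borel"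
  by (auto intro!: borel_measurable_continuous_onI continuous_intros simp: cis_conv_exp)

lemma chf_cos_sin:
  assumes "prob_space \<mu>" "sets \<mu> = sets borel"
  shows "Re (chf \<mu> t) = (\<integral>x. cos (t \<bullet> x) \<partial>\<mu>)" "Im (chf \<mu> t) = (\<integral>x. sin (t \<bullet> x) \<partial>\<mu>)"
proof -
  have "integrable \<mu> (\<lambda>x. cis (t \<bullet> x))"
    by (rule borel_bounded_integrable[OF assms, where K = 1]) simp_all
  then show "Re (chf \<mu> t) = (\<integral>x. cos (t \<bullet> x) \<partial>\<mu>)" "Im (chf \<mu> t) = (\<integral>x. sin (t \<bullet> x) \<partial>\<mu>)"
    unfolding chf_def by (simp_all flip: integral_Re integral_Im)
qed

text \<open>By linearity only the generators matter, and their integrals are the real and imaginary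
  parts of the characteristic function.\<close>

lemma trig_poly_integral_tendsto:
  assumes P: "\<And>n. prob_space (\<mu> n)" "\<And>n. sets (\<mu> n) = sets borel"
    and Q: "prob_space \<nu>" "sets \<nu> = sets borel"
    and lim: "\<And>t. (\<lambda>n. chf (\<mu> n) t) \<longlonglongrightarrow> chf \<nu> t"
    and f: "trig_poly f"
  shows "(\<lambda>n. \<integral>x. f x \<partial>\<mu> n) \<longlonglongrightarrow> (\<integral>x. f x \<partial>\<nu>)"
proof -
  have int: "integrable \<rho> g" if g: "trig_poly g" and \<rho>: "prob_space \<rho>" "sets \<rho> = sets borel" for \<rho> g
  proof -
    obtain K where "\<forall>x. \<bar>g x\<bar> \<le> K" using trig_poly_bounded[OF g] by blast
    then show ?thesis
      by (intro borel_bounded_integrable[OF \<rho>, where K = K]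
          borel_measurable_continuous_onI trig_poly_continuous g) auto
  qed
  show ?thesis
    using f
  proof (induction rule: trig_poly.induct)
    case (cos t)
    show ?case using tendsto_Re[OF lim[of t]] by (simp add: chf_cos_sin[OF P] chf_cos_sin[OF Q])
  next
    case (sin t)
    show ?case using tendsto_Im[OF lim[of t]] by (simp add: chf_cos_sin[OF P] chf_cos_sin[OF Q])
  next
    case (add f g)
    then show ?case by (simp add: int P Q tendsto_add)
  next
    case (scale f c)
    then show ?case by (simp add: tendsto_mult_left)
  qed
qed

lemma prob_space_tight:
  fixes \<nu> :: "'a::euclidean_space measure"
  assumes "prob_space \<nu>" "sets \<nu> = sets borel" "0 < e"
  shows "\<exists>R. measure \<nu> (- cball 0 R) < e"
proof -
  interpret prob_space \<nu> by fact
  have "(\<lambda>n. measure \<nu> (- cball 0 (real n))) \<longlonglongrightarrow> measure \<nu> (\<Inter>n. - cball 0 (real n))"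
    by (rule finite_Lim_measure_decseq) (auto simp: assms decseq_def)
  also have "(\<Inter>n. - cball (0::'a) (real n)) = {}"
    using real_arch_simple[where 'a = real] by (auto simp: not_le) (meson leD)
  finally have "\<forall>\<^sub>F n in sequentially. measure \<nu> (- cball 0 (real n)) < e"
    using assms(3) by (intro order_tendstoD) auto
  then show ?thesis by (meson eventually_sequentially order_refl)
qed

text \<open>On a large ball a bounded continuous function is close to a trigonometric polynomial,
  whose integrals converge. Off the ball the two differ by at most a constant that does not depend
  on the radius, and tightness makes the mass there small uniformly in \<open>n\<close>.\<close>

theorem weakly_converges_of_chf:
  fixes \<mu> :: "nat \<Rightarrow> 'a::euclidean_space measure"
  assumes P: "\<And>n. prob_space (\<mu> n)" "\<And>n. sets (\<mu> n) = sets borel"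
    and Q: "prob_space \<nu>" "sets \<nu> = sets borel"
    and lim: "\<And>t. (\<lambda>n. chf (\<mu> n) t) \<longlonglongrightarrow> chf \<nu> t"
    and tight: "\<And>e. 0 < e \<Longrightarrow> \<exists>R. \<forall>n. measure (\<mu> n) (- cball 0 R) < e"
  shows "weakly_converges \<mu> \<nu>"
  unfolding weakly_converges_def
proof (intro allI impI)
  fix f :: "'a \<Rightarrow> real"
  assume f: "continuous_on UNIV f \<and> bounded (range f)"
  then obtain K where K: "\<And>x. \<bar>f x\<bar> \<le> K" "0 < K"
    by (auto simp: bounded_pos)
  show "(\<lambda>n. \<integral>x. f x \<partial>\<mu> n) \<longlonglongrightarrow> (\<integral>x. f x \<partial>\<nu>)"
  proof (rule LIMSEQ_I)
    fix r :: real assume "0 < r"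
    \<comment> \<open>The error is \<open>e\<close> on the ball and at most \<open>2 * K + 1\<close>
      off it, where the mass is below \<open>e\<close>; together \<open>2 * (K + 1) * e\<close>,
      which must not exceed \<open>r / 4\<close>. The cap at 1 gives the bound
      \<open>2 * K + 1\<close>.\<close>
    define e where "e = min 1 (r / (4 * (K + 1)) / 2)"
    have e: "0 < e" "e \<le> 1" using \<open>0 < r\<close> K(2) by (auto simp: e_def)
    have er: "e + (2 * K + 1) * e \<le> r / 4"
    proof -
      have "e \<le> r / (4 * (K + 1)) / 2" by (simp add: e_def)
      then have "e * (2 * (K + 1)) \<le> r / (4 * (K + 1)) / 2 * (2 * (K + 1))"
        using K(2) by (intro mult_right_mono) auto
      also have "\<dots> = r / 4" using K(2) by (simp add: field_simps)
      finally show ?thesis by (simp add: algebra_simps)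
    qed
    obtain R1 where R1: "\<And>n. measure (\<mu> n) (- cball 0 R1) < e" using tight[OF e(1)] by blast
    obtain R2 where R2: "measure \<nu> (- cball 0 R2) < e" using prob_space_tight[OF Q e(1)] by blast
    define R where "R = max R1 R2"
    obtain g where g: "trig_poly g" "\<And>x. x \<in> cball 0 R \<Longrightarrow> \<bar>f x - g x\<bar> < e" "\<And>x. \<bar>g x\<bar> \<le> \<bar>K\<bar> + e"
      by (rule trig_poly_approx[of "cball 0 R" f e K])
        (use f e K(1) continuous_on_subset[of UNIV f "cball 0 R"] in auto)
    have diff: "\<bar>(\<integral>x. f x \<partial>\<rho>) - (\<integral>x. g x \<partial>\<rho>)\<bar> \<le> r / 4"
      if \<rho>: "prob_space \<rho>" "sets \<rho> = sets borel" "measure \<rho> (- cball 0 R) < e" for \<rho>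
    proof -
      interpret prob_space \<rho> by (rule \<rho>)
      have int: "integrable \<rho> f" "integrable \<rho> g"
        using f K g(1,3) by (auto intro!: borel_bounded_integrable[OF \<rho>(1,2)]
            borel_measurable_continuous_onI trig_poly_continuous)
      have set: "- cball 0 R \<in> sets \<rho>" by (simp add: \<rho>)
      have le: "\<bar>f x - g x\<bar> \<le> e + (2 * K + 1) * indicator (- cball 0 R) x" for x
      proof (cases "x \<in> cball 0 R")
        case True
        then show ?thesis using g(2)[OF True] by simp
      next
        case False
        then show ?thesis using g(3)[of x] K(1)[of x] K(2) e by simp
      qed
      have "\<bar>(\<integral>x. f x \<partial>\<rho>) - (\<integral>x. g x \<partial>\<rho>)\<bar> = \<bar>\<integral>x. f x - g x \<partial>\<rho>\<bar>"
        by (simp add: int)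
      also have "\<dots> \<le> (\<integral>x. \<bar>f x - g x\<bar> \<partial>\<rho>)" by (rule integral_abs_bound)
      also have "\<dots> \<le> (\<integral>x. e + (2 * K + 1) * indicator (- cball 0 R) x \<partial>\<rho>)"
        using le set by (intro integral_mono Bochner_Integration.integrable_add integrable_mult_right
            integrable_real_indicator integrable_abs Bochner_Integration.integrable_diff int)
          (auto simp: emeasure_eq_measure)
      also have "\<dots> = e + (2 * K + 1) * measure \<rho> (- cball 0 R)"
        using set prob_space
        by (subst Bochner_Integration.integral_add) (auto simp: emeasure_eq_measure)
      also have "\<dots> \<le> e + (2 * K + 1) * e"
        using \<rho>(3) K(2) by (intro add_left_mono mult_left_mono) auto
      finally show ?thesis using er by simp
    qed
    have small: "measure \<rho> (- cball 0 R) < e"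
      if "prob_space \<rho>" "sets \<rho> = sets borel" "measure \<rho> (- cball 0 R') < e" "R' \<le> R" for \<rho> R'
    proof -
      interpret prob_space \<rho> by (rule that)
      have "measure \<rho> (- cball 0 R) \<le> measure \<rho> (- cball 0 R')"
        by (intro finite_measure_mono) (use that(2,4) in auto)
      with that(3) show ?thesis by simp
    qed
    obtain N where N: "\<And>n. n \<ge> N \<Longrightarrow> \<bar>(\<integral>x. g x \<partial>\<mu> n) - (\<integral>x. g x \<partial>\<nu>)\<bar> < r / 2"
      using LIMSEQ_D[OF trig_poly_integral_tendsto[OF P Q lim g(1)], of "r/2"] \<open>0 < r\<close>
      by auto
    show "\<exists>no. \<forall>n\<ge>no. norm ((\<integral>x. f x \<partial>\<mu> n) - (\<integral>x. f x \<partial>\<nu>)) < r"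
    proof (intro exI allI impI)
      fix n assume "n \<ge> N"
      have "\<bar>(\<integral>x. f x \<partial>\<mu> n) - (\<integral>x. g x \<partial>\<mu> n)\<bar> \<le> r / 4"
        by (intro diff P small[OF P R1]) (simp add: R_def)
      moreover have "\<bar>(\<integral>x. f x \<partial>\<nu>) - (\<integral>x. g x \<partial>\<nu>)\<bar> \<le> r / 4"
        by (intro diff Q small[OF Q R2]) (simp add: R_def)
      ultimately show "norm ((\<integral>x. f x \<partial>\<mu> n) - (\<integral>x. f x \<partial>\<nu>)) < r"
        using N[OF \<open>n \<ge> N\<close>] \<open>0 < r\<close> unfolding real_norm_def by linarith
    qed
  qed
qed

subsection \<open>Multivariate normal laws\<close>

lemma prod_Basis_vec:
  fixes f :: "real^'n \<Rightarrow> 'b::comm_monoid_mult"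
  shows "(\<Prod>b\<in>Basis. f b) = (\<Prod>i\<in>UNIV. f (axis i 1))"
proof -
  have "(\<Prod>i\<in>UNIV. f (axis i 1)) = (\<Prod>b\<in>(\<lambda>i. axis i (1::real)) ` UNIV. f b)"
    by (subst prod.reindex) (auto simp: inj_on_def axis_eq_axis)
  also have "(\<lambda>i::'n. axis i (1::real)) ` UNIV = Basis"
    by (auto simp: Basis_vec_def)
  finally show ?thesis by simp
qed

lemma integral_lborel_prod_vec:
  fixes f :: "'n::finite \<Rightarrow> real \<Rightarrow> complex"
  assumes int: "\<And>i. integrable lborel (f i)"
  shows "(\<integral>x. (\<Prod>i\<in>UNIV. f i (x $ i)) \<partial>(lborel :: (real^'n) measure)) = (\<Prod>i\<in>UNIV. \<integral>x. f i x \<partial>lborel)"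
proof -
  interpret product_sigma_finite "\<lambda>_ :: real^'n. lborel :: real measure" ..
  \<comment> \<open>Lebesgue measure is a product over \<open>Basis\<close> rather than over the
    index type, so the family \<open>f\<close> is reindexed along \<open>axis i 1\<close>.\<close>
  define g where "g b = f (THE i. b = axis i (1::real))" for b :: "real^'n"
  have g: "g (axis i 1) = f i" for i
    by (simp add: g_def axis_eq_axis)
  have [measurable]: "f i \<in> borel_measurable borel" for i
    using int[of i] by (simp add: borel_measurable_integrable)
  have Basis: "b \<in> Basis \<Longrightarrow> \<exists>i. b = axis i 1" for b :: "real^'n"
    by (auto simp: Basis_vec_def)
  have "(\<integral>x. (\<Prod>i\<in>UNIV. f i (x $ i)) \<partial>(lborel :: (real^'n) measure))
      = (\<integral>x. (\<Prod>b\<in>Basis. g b (x \<bullet> b)) \<partial>(lborel :: (real^'n) measure))"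
    by (simp add: prod_Basis_vec g inner_axis)
  also have "\<dots> = (\<integral>h. (\<Prod>b\<in>Basis. g b ((\<Sum>b\<in>Basis. h b *\<^sub>R b) \<bullet> b)) \<partial>(\<Pi>\<^sub>M b\<in>(Basis :: (real^'n) set). lborel))"
    by (subst lborel_eq, subst integral_distr) (auto simp: prod_Basis_vec g inner_axis)
  also have "\<dots> = (\<integral>h. (\<Prod>b\<in>Basis. g b (h b)) \<partial>(\<Pi>\<^sub>M b\<in>(Basis :: (real^'n) set). lborel))"
    by (intro Bochner_Integration.integral_cong prod.cong refl)
      (simp add: inner_sum_left inner_Basis if_distrib sum.delta cong: if_cong)
  also have "\<dots> = (\<Prod>b\<in>Basis. \<integral>x. g b x \<partial>lborel)"
    by (rule product_integral_prod) (use int g in \<open>auto dest!: Basis\<close>)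
  also have "\<dots> = (\<Prod>i\<in>UNIV. \<integral>x. f i x \<partial>lborel)"
    by (simp add: prod_Basis_vec g)
  finally show ?thesis .
qed

lemma prob_space_std_normal_vec: "prob_space (std_normal_vec :: (real^'n) measure)"
proof
  have "emeasure (std_normal_vec :: (real^'n) measure) (space std_normal_vec)
      = (\<integral>\<^sup>+z. ennreal (\<Prod>b\<in>Basis. std_normal_density (z \<bullet> b)) \<partial>(lborel :: (real^'n) measure))"
    by (auto simp: std_normal_vec_def emeasure_density prod_Basis_vec inner_axis)
  also have "\<dots> = (\<integral>\<^sup>+z. (\<Prod>b\<in>Basis. ennreal (std_normal_density (z \<bullet> b))) \<partial>(lborel :: (real^'n) measure))"
    by (simp add: prod_ennreal)
  also have "\<dots> = (\<Prod>b\<in>(Basis::(real^'n) set). \<integral>\<^sup>+z. ennreal (std_normal_density z) \<partial>lborel)"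
    by (rule nn_integral_lborel_prod) auto
  also have "(\<integral>\<^sup>+z. ennreal (std_normal_density z) \<partial>lborel) = 1"
    using prob_space.emeasure_space_1[OF prob_space_normal_density[of 1 0]]
    by (simp add: emeasure_density)
  finally show "emeasure (std_normal_vec :: (real^'n) measure) (space std_normal_vec) = 1" by simp
qed

lemma sets_std_normal_vec [simp, measurable_cong]: "sets std_normal_vec = sets borel"
  by (simp add: std_normal_vec_def)

lemma chf_std_normal_vec: "chf (std_normal_vec :: (real^'n) measure) t = exp (- complex_of_real ((norm t)\<^sup>2 / 2))"
proof -
  have "chf (std_normal_vec :: (real^'n) measure) t
      = (\<integral>z. (\<Prod>i\<in>UNIV. std_normal_density (z $ i)) *\<^sub>R cis (t \<bullet> z) \<partial>lborel)"
    unfolding chf_def std_normal_vec_def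
    by (subst integral_density)
      (auto intro!: borel_measurable_continuous_onI continuous_intros prod_nonneg simp: cis_conv_exp)
  also have "\<dots> = (\<integral>z. (\<Prod>i\<in>UNIV. std_normal_density (z $ i) *\<^sub>R cis (t $ i * z $ i)) \<partial>lborel)"
    by (intro Bochner_Integration.integral_cong)
      (auto simp: scaleR_conv_of_real prod.distrib of_real_prod inner_vec_def cis_conv_exp sum_distrib_left exp_sum)
  also have "\<dots> = (\<Prod>i\<in>UNIV. \<integral>x. std_normal_density x *\<^sub>R cis (t $ i * x) \<partial>lborel)"
  proof (rule integral_lborel_prod_vec)
    fix i
    show "integrable lborel (\<lambda>x. std_normal_density x *\<^sub>R cis (t $ i * x))"
      by (rule Bochner_Integration.integrable_bound[OF integrable_normal_density[of 1 0]])
        (auto intro!: borel_measurable_continuous_onI continuous_intros simp: cis_conv_exp)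
  qed
  also have "\<dots> = (\<Prod>i\<in>UNIV. char std_normal_distribution (t $ i))"
    unfolding char_def
    by (intro prod.cong refl, subst integral_density)
      (auto intro!: borel_measurable_continuous_onI continuous_intros simp: cis_conv_exp )
  also have "\<dots> = exp (- complex_of_real ((norm t)\<^sup>2 / 2))"
    by (simp add: char_std_normal_distribution exp_sum[symmetric] norm_vec_def L2_set_def sum_nonneg
        sum_negf sum_divide_distrib flip: of_real_prod exp_of_real)
  finally show ?thesis .
qed

text \<open>The summand 0 keeps the term syntactically equal to the law in
  \<open>is_normal_vec\<close> with mean 0.\<close>

abbreviation normal_law :: "real^'n^'n \<Rightarrow> (real^'n) measure" where
  "normal_law A \<equiv> distr std_normal_vec borel (\<lambda>z. 0 + A *v z)"

lemma
  fixes A :: "real^'n^'n"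
  shows prob_space_normal_vec: "prob_space (normal_law A)"
    and chf_normal_vec: "chf (normal_law A) t =
      exp (- complex_of_real ((t \<bullet> ((A ** transpose A) *v t)) / 2))"
proof -
  have [measurable]: "(*v) A \<in> borel_measurable borel"
    by (intro borel_measurable_continuous_onI linear_continuous_on matrix_vector_mul_bounded_linear)
  show "prob_space (normal_law A)"
    by (intro prob_space.prob_space_distr prob_space_std_normal_vec) simp
  have "chf (normal_law A) t = (\<integral>z. cis (t \<bullet> (A *v z)) \<partial>std_normal_vec)"
    unfolding chf_def
    by (subst integral_distr) simp_all
  also have "\<dots> = chf std_normal_vec (transpose A *v t)"
    by (simp add: chf_def dot_lmul_matrix[symmetric])
  also have "\<dots> = exp (- complex_of_real ((t \<bullet> ((A ** transpose A) *v t)) / 2))"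
    by (simp add: chf_std_normal_vec power2_norm_eq_inner dot_lmul_matrix[symmetric]
        matrix_vector_mul_assoc[symmetric] inner_commute)
  finally show "chf (normal_law A) t =
      exp (- complex_of_real ((t \<bullet> ((A ** transpose A) *v t)) / 2))" .
qed

text \<open>Cholesky factorisation by Schur complements: the pivot row \<open>v\<close> is removed from \<open>C\<close>,
  and it vanishes identically when the pivot \<open>C v v\<close> does.\<close>

lemma psd_factorisation_on:
  fixes C :: "'n \<Rightarrow> 'n \<Rightarrow> real"
  assumes "finite F" "\<And>i j. C i j = C j i"
    and "\<And>x. 0 \<le> (\<Sum>i\<in>F. \<Sum>j\<in>F. x i * x j * C i j)"
  shows "\<exists>a. \<forall>i\<in>F. \<forall>j\<in>F. C i j = (\<Sum>k\<in>F. a i k * a j k)"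
  using assms
proof (induction F arbitrary: C rule: finite_induct)
  case empty
  then show ?case by simp
next
  case (insert v F)
  have expand: "(\<Sum>i\<in>insert v F. \<Sum>j\<in>insert v F. x i * x j * C i j)
      = x v * x v * C v v + 2 * x v * (\<Sum>j\<in>F. x j * C v j) + (\<Sum>i\<in>F. \<Sum>j\<in>F. x i * x j * C i j)" for x
  proof -
    have "(\<Sum>i\<in>F. x i * x v * C i v) = x v * (\<Sum>j\<in>F. x j * C v j)"
      unfolding sum_distrib_left
      by (intro sum.cong refl) (metis insert.prems(1) mult.assoc mult.commute)
    moreover have "(\<Sum>j\<in>F. x v * x j * C v j) = x v * (\<Sum>j\<in>F. x j * C v j)"
      by (simp add: sum_distrib_left mult_ac)
    ultimately show ?thesis
      using insert.hyps by (simp add: sum.distrib)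
  qed
  have quad: "0 \<le> c * c * C v v + 2 * c * (\<Sum>j\<in>F. x j * C v j) + (\<Sum>i\<in>F. \<Sum>j\<in>F. x i * x j * C i j)" for c x
  proof -
    have ne: "j \<in> F \<Longrightarrow> j \<noteq> v" for j using insert.hyps by auto
    show ?thesis
      using insert.prems(2)[of "x(v := c)"] unfolding expand by (simp add: ne)
  qed
  have pos: "0 \<le> C v v" using quad[of 1 "\<lambda>_. 0"] by simp
  define C' where "C' i j = C i j - C v i * C v j / C v v" for i j
  have zero: "C v i = 0" if "C v v = 0" "i \<in> F" for i
  proof (rule ccontr)
    assume nz: "C v i \<noteq> 0"
    \<comment> \<open>With value \<open>c\<close> at \<open>v\<close> and 1 at \<open>i\<close>, the
      quadratic form would equal -1 for this \<open>c\<close>.\<close>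
    define c where "c = - (C i i + 1) / (2 * C v i)"
    have "0 \<le> 2 * c * C v i + C i i"
      using quad[of c "\<lambda>k. if k = i then 1 else 0"] that insert.hyps
      by (simp add: if_distrib[of "\<lambda>x. x * _"] if_distrib[of "\<lambda>x. _ * x"] sum.delta cong: if_cong)
    also have "2 * c * C v i = - (C i i + 1)" using nz by (simp add: c_def)
    finally show False by simp
  qed
  have "\<exists>a. \<forall>i\<in>F. \<forall>j\<in>F. C' i j = (\<Sum>k\<in>F. a i k * a j k)"
  proof (rule insert.IH)
    show "C' i j = C' j i" for i j
      by (simp add: C'_def insert.prems(1)[of i j] mult.commute)
    fix x
    define L where "L = (\<Sum>j\<in>F. x j * C v j)"
    \<comment> \<open>The minimiser of the form in its coordinate \<open>v\<close>. If the pivot is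
      0, division by zero makes \<open>c\<close> and the correction term vanish, and the identity
      below still holds.\<close>
    define c where "c = - L / C v v"
    have "(\<Sum>i\<in>F. \<Sum>j\<in>F. x i * x j * C' i j)
        = (\<Sum>i\<in>F. \<Sum>j\<in>F. x i * x j * C i j) - (\<Sum>i\<in>F. \<Sum>j\<in>F. (x i * C v i) * (x j * C v j) / C v v)"
      by (simp add: C'_def sum_subtractf algebra_simps)
    also have "(\<Sum>i\<in>F. \<Sum>j\<in>F. (x i * C v i) * (x j * C v j) / C v v) = L * L / C v v"
      by (simp add: L_def sum_product sum_divide_distrib)
    also have "(\<Sum>i\<in>F. \<Sum>j\<in>F. x i * x j * C i j) - L * L / C v v
        = c * c * C v v + 2 * c * L + (\<Sum>i\<in>F. \<Sum>j\<in>F. x i * x j * C i j)"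
      by (cases "C v v = 0") (simp_all add: c_def field_simps)
    also have "\<dots> \<ge> 0" using quad[of c x] by (simp add: L_def)
    finally show "0 \<le> (\<Sum>i\<in>F. \<Sum>j\<in>F. x i * x j * C' i j)" .
  qed
  then obtain a where a: "\<And>i j. i \<in> F \<Longrightarrow> j \<in> F \<Longrightarrow> C' i j = (\<Sum>k\<in>F. a i k * a j k)" by blast
  \<comment> \<open>Column \<open>v\<close> is the scaled pivot row, and the other columns are zero
    in row \<open>v\<close>. A zero pivot gives a zero column.\<close>
  define b where "b i k = (if k = v then C v i / sqrt (C v v) else if i = v then 0 else a i k)" for i k
  have "C i j = (\<Sum>k\<in>insert v F. b i k * b j k)" if ij: "i \<in> insert v F" "j \<in> insert v F" for i j
  proof -
    have "(\<Sum>k\<in>insert v F. b i k * b j k) = C v i * C v j / C v v + (\<Sum>k\<in>F. b i k * b j k)"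
      using insert.hyps pos by (simp add: b_def)
    also have "(\<Sum>k\<in>F. b i k * b j k) = (\<Sum>k\<in>F. if i = v \<or> j = v then 0 else a i k * a j k)"
      using insert.hyps by (intro sum.cong) (auto simp: b_def)
    also have "\<dots> = (if i = v \<or> j = v then 0 else C' i j)"
      using a[of i j] ij by auto
    finally show ?thesis
      using zero ij insert.prems(1)[of i v] by (cases "C v v = 0") (auto simp: C'_def)
  qed
  then show ?case by blast
qed

lemma psd_factorisation:
  fixes C :: "real^'n^'n"
  assumes sym: "transpose C = C" and psd: "\<And>x. 0 \<le> x \<bullet> (C *v x)"
  obtains A :: "real^'n^'n" where "A ** transpose A = C"
proof -
  have "\<exists>a. \<forall>i\<in>(UNIV::'n set). \<forall>j\<in>(UNIV::'n set). C $ i $ j = (\<Sum>k\<in>(UNIV::'n set). a i k * a j k)"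
  proof (rule psd_factorisation_on[where C = "\<lambda>i j. C $ i $ j"])
    show "C $ i $ j = C $ j $ i" for i j
      using arg_cong[OF sym, of "\<lambda>M. M $ j $ i"] by (simp add: transpose_def)
    show "0 \<le> (\<Sum>i\<in>UNIV. \<Sum>j\<in>UNIV. x i * x j * C $ i $ j)" for x
      using psd[of "\<chi> i. x i"]
      by (simp add: inner_vec_def matrix_vector_mult_def sum_distrib_left mult_ac)
  qed auto
  then obtain a :: "'n \<Rightarrow> 'n \<Rightarrow> real" where "\<And>i j. C $ i $ j = (\<Sum>k\<in>UNIV. a i k * a j k)" by blast
  then have "(\<chi> i k. a i k) ** transpose (\<chi> i k. a i k) = C"
    by (simp add: vec_eq_iff matrix_matrix_mult_def transpose_def)
  then show ?thesis by (rule that)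
qed

lemma normal_vec_exists:
  fixes \<Sigma> :: "real^'n^'n"
  assumes "transpose \<Sigma> = \<Sigma>" "\<And>x. 0 \<le> x \<bullet> (\<Sigma> *v x)"
  obtains A :: "real^'n^'n" where "A ** transpose A = \<Sigma>"
    "is_normal_vec (normal_law A) 0 \<Sigma>"
  using psd_factorisation[OF assms] unfolding is_normal_vec_def by metis

subsection \<open>A perturbed linear recursion\<close>

lemma summable_three_halves: "summable (\<lambda>n. K * real n powr (-3/2))"
  by (intro summable_mult) (simp add: summable_real_powr_iff)

lemma powr_minus_two: "n \<ge> 1 \<Longrightarrow> K / (real n)\<^sup>2 = K * real n powr (-2)"
  unfolding powr_minus[of _ 2] by (simp add: divide_inverse)

text \<open>Discrete Gronwall: adding 1 to \<open>u\<close> absorbs the additive error into the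
  factor, and the factors have a convergent product because their exponents are summable. The power
  -3/2 leaves room for errors of order \<open>1 / n^2\<close> multiplied by anything up to
  \<open>sqrt n\<close>.\<close>

lemma bounded_of_summable_perturbation:
  fixes u :: "nat \<Rightarrow> real"
  assumes u: "\<And>n. 0 \<le> u n" and K: "0 \<le> K"
    and rec: "\<And>n. n \<ge> N \<Longrightarrow> u (Suc n) \<le> (1 + K * real n powr (-3/2)) * u n + K * real n powr (-3/2)"
  shows "\<exists>U>0. \<forall>n. u n \<le> U"
proof -
  define e where "e n = K * real n powr (-3/2)" for n
  have e: "0 \<le> e n" for n using K by (simp add: e_def)
  have sum: "summable e" unfolding e_def by (rule summable_three_halves)
  define s where "s n = (\<Sum>k<n. e k)" for n
  have s: "0 \<le> s n" "s n \<le> suminf e" for n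
    using e sum by (auto simp: s_def intro!: sum_nonneg sum_le_suminf)
  define v where "v n = exp (- s n) * (u n + 1)" for n
  have step: "v (Suc n) \<le> v n" if "n \<ge> N" for n
  proof -
    have "u (Suc n) + 1 \<le> (1 + e n) * (u n + 1)"
      using rec[OF that] by (simp add: e_def algebra_simps)
    also have "\<dots> \<le> exp (e n) * (u n + 1)"
      using u[of n] exp_ge_add_one_self[of "e n"] by (intro mult_right_mono) auto
    finally have "v (Suc n) \<le> exp (- s (Suc n)) * (exp (e n) * (u n + 1))"
      unfolding v_def by (intro mult_left_mono) auto
    also have "\<dots> = v n"
      by (simp add: v_def s_def mult.assoc[symmetric] exp_add[symmetric])
    finally show ?thesis .
  qed
  have "v n \<le> v N" if "n \<ge> N" for n
    using that by (induction n rule: dec_induct) (use step order_trans in blast)+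
  then have large: "u n \<le> exp (suminf e) * v N" if "n \<ge> N" for n
  proof -
    have "u n + 1 = exp (s n) * v n" by (simp add: v_def mult.assoc[symmetric] exp_add[symmetric])
    also have "\<dots> \<le> exp (suminf e) * v N"
      using \<open>n \<ge> N \<Longrightarrow> v n \<le> v N\<close>[OF that] s u[of n] by (intro mult_mono) (auto simp: v_def)
    finally show ?thesis by simp
  qed
  have "u n \<le> max 1 (Max (u ` {..N}) + exp (suminf e) * v N)" for n
  proof (cases "n \<le> N")
    case True
    have "u n \<le> Max (u ` {..N})" using True by auto
    moreover have "0 \<le> exp (suminf e) * v N" using u[of N] by (simp add: v_def)
    ultimately show ?thesis by linarith
  next
    case False
    have "0 \<le> u 0" by (rule u)
    also have "u 0 \<le> Max (u ` {..N})" by simp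
    finally show ?thesis using large[of n] False by linarith
  qed
  then show ?thesis by (intro exI[of _ "max 1 (Max (u ` {..N}) + exp (suminf e) * v N)"]) auto
qed

text \<open>Multiplication by \<open>(n + 1) powr \<delta>\<close> compensates the contraction and
  leaves a bounded sequence, which yields decay of order \<open>n powr (- \<delta>)\<close>. The cap
  1/2 on \<delta> keeps the multiplied error of order \<open>n powr (-3/2)\<close>.\<close>

lemma tendsto_0_of_contraction:
  fixes u :: "nat \<Rightarrow> real"
  assumes u: "\<And>n. 0 \<le> u n" and K: "0 \<le> K" and \<delta>: "0 < \<delta>" "\<delta> \<le> 1/2"
    and rec: "\<And>n. n \<ge> N \<Longrightarrow> u (Suc n) \<le> (1 - \<delta> / (real n + 1)) * u n + K / (real n)\<^sup>2"
  shows "u \<longlonglongrightarrow> 0"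
proof -
  define q where "q n = (real n + 1) powr \<delta> * u n" for n
  have "\<exists>U>0. \<forall>n. q n \<le> U"
  proof (rule bounded_of_summable_perturbation)
    show "0 \<le> q n" for n using u by (simp add: q_def)
    show "0 \<le> 2 * K" using K by simp
    fix n assume n: "n \<ge> max N 1"
    have le: "(real (Suc n) + 1) powr \<delta> * (1 - \<delta> / (real n + 1)) \<le> (real n + 1) powr \<delta>"
    proof -
      have "1 - \<delta> / (real n + 1) \<le> exp (- \<delta> / (real n + 1))"
        using exp_ge_add_one_self[of "- \<delta> / (real n + 1)"] by simp
      also have "\<dots> \<le> exp (\<delta> * ln ((real n + 1) / (real n + 2)))"
      proof -
        have "ln ((real n + 2) / (real n + 1)) \<le> (real n + 2) / (real n + 1) - 1"
          by (intro ln_le_minus_one) simp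
        also have "\<dots> = 1 / (real n + 1)" by (simp add: field_simps)
        finally have "- 1 / (real n + 1) \<le> ln ((real n + 1) / (real n + 2))"
          by (simp add: ln_div)
        then have "\<delta> * (- 1 / (real n + 1)) \<le> \<delta> * ln ((real n + 1) / (real n + 2))"
          using \<delta> by (intro mult_left_mono) auto
        then show ?thesis by (simp add: add.commute)
      qed
      also have "\<dots> = ((real n + 1) / (real n + 2)) powr \<delta>" by (simp add: powr_def)
      finally have "(real (Suc n) + 1) powr \<delta> * (1 - \<delta> / (real n + 1))
          \<le> (real (Suc n) + 1) powr \<delta> * ((real n + 1) / (real n + 2)) powr \<delta>"
        by (intro mult_left_mono) auto
      also have "\<dots> = (real n + 1) powr \<delta>"
        by (simp add: powr_divide add_ac)
      finally show ?thesis .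
    qed
    have pw: "(real (Suc n) + 1) powr \<delta> * (K / (real n)\<^sup>2) \<le> 2 * K * real n powr (-3/2)"
    proof -
      have "(real (Suc n) + 1) powr \<delta> \<le> (real (Suc n) + 1) powr (1/2)"
        using \<delta> by (intro powr_mono) auto
      also have "\<dots> \<le> (4 * real n) powr (1/2)"
      proof (rule powr_mono2)
        show "real (Suc n) + 1 \<le> 4 * real n" using n by simp
      qed simp_all
      also have "\<dots> = 2 * real n powr (1/2)" by (simp only: powr_mult powr_half_sqrt) simp
      finally have "(real (Suc n) + 1) powr \<delta> * (K / (real n)\<^sup>2) \<le> 2 * real n powr (1/2) * (K / (real n)\<^sup>2)"
        using K by (intro mult_right_mono) auto
      also have "\<dots> = 2 * K * (real n powr (1/2) * real n powr (-2))"
        using n by (subst powr_minus_two) simp_all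
      also have "real n powr (1/2) * real n powr (-2) = real n powr (-3/2)"
        by (simp flip: powr_add)
      finally show ?thesis by simp
    qed
    have "q (Suc n) \<le> (real (Suc n) + 1) powr \<delta> * ((1 - \<delta> / (real n + 1)) * u n + K / (real n)\<^sup>2)"
      unfolding q_def using n rec[of n] by (intro mult_left_mono) auto
    also have "\<dots> = (real (Suc n) + 1) powr \<delta> * (1 - \<delta> / (real n + 1)) * u n + (real (Suc n) + 1) powr \<delta> * (K / (real n)\<^sup>2)"
      by (simp add: distrib_left)
    also have "\<dots> \<le> (real n + 1) powr \<delta> * u n + 2 * K * real n powr (-3/2)"
      using le pw u[of n] by (intro add_mono mult_right_mono) auto
    also have "\<dots> \<le> (1 + 2 * K * real n powr (-3/2)) * q n + 2 * K * real n powr (-3/2)"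
      using K u[of n] by (simp add: q_def distrib_right)
    finally show "q (Suc n) \<le> (1 + 2 * K * real n powr (-3/2)) * q n + 2 * K * real n powr (-3/2)" .
  qed
  then obtain U where U: "\<And>n. q n \<le> U" by blast
  have "u n \<le> U * (real n + 1) powr (- \<delta>)" for n
  proof -
    have "u n = q n * (real n + 1) powr (- \<delta>)"
      by (simp add: q_def powr_minus)
    then show ?thesis using U[of n] by (simp add: mult_right_mono)
  qed
  moreover have "(\<lambda>n. U * (real n + 1) powr (- \<delta>)) \<longlonglongrightarrow> 0"
    using \<delta> by real_asymp
  ultimately show ?thesis
    using u by (intro tendsto_sandwich[of "\<lambda>_. 0" u _ "\<lambda>n. U * (real n + 1) powr (- \<delta>)"]) auto
qed

text \<open>From \<open>sqrt (r^2 + b^2) <= r + b^2 / (2 r)\<close>: the imaginary part enters the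
  modulus only at order \<open>1 / n\<close>, so contraction of the recursion is governed by the
  real part.\<close>

lemma norm_of_nat_add_le:
  fixes a :: complex
  assumes "real n + Re a > 0"
  shows "cmod (of_nat n + a) \<le> n + Re a + (Im a)\<^sup>2 / (2 * (n + Re a))"
proof (rule power2_le_imp_le)
  define r where "r = n + Re a"
  have r: "r > 0" using assms by (simp add: r_def)
  have "(cmod (of_nat n + a))\<^sup>2 = r\<^sup>2 + (Im a)\<^sup>2"
    by (simp add: cmod_power2 r_def)
  also have "\<dots> \<le> (r + (Im a)\<^sup>2 / (2 * r))\<^sup>2"
    using r by (simp add: power2_sum)
  finally show "(cmod (of_nat n + a))\<^sup>2 \<le> (n + Re a + (Im a)\<^sup>2 / (2 * (n + Re a)))\<^sup>2"
    by (simp add: r_def)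
qed (use assms in auto)

lemma inverse_square_le_three_halves:
  assumes "0 \<le> K" "n \<ge> 1"
  shows "K / (real n)\<^sup>2 \<le> K * real n powr (-3/2)"
proof -
  have "K / (real n)\<^sup>2 = K * real n powr (-2)"
    using assms(2) by (rule powr_minus_two)
  also have "\<dots> \<le> K * real n powr (-3/2)"
    using assms by (intro mult_left_mono powr_mono) auto
  finally show ?thesis .
qed

lemma tendsto_0_bounded_over_ln:
  fixes z :: "nat \<Rightarrow> complex"
  assumes "\<And>n. cmod (z n) \<le> U"
  shows "(\<lambda>n. z n / of_real (ln n)) \<longlonglongrightarrow> 0"
proof (rule Lim_null_comparison)
  show "\<forall>\<^sub>F n in sequentially. norm (z n / of_real (ln n)) \<le> U / ln n"
    using eventually_ge_at_top[of 2]
    by eventually_elim (simp add: norm_divide assms divide_right_mono)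
  show "(\<lambda>n. U / ln (real n)) \<longlonglongrightarrow> 0" by real_asymp
qed

text \<open>One entry of the quadratic form that sums the squared norms of transported vectors. At
  \<open>n = 0\<close> the quotients by 0 are 0, so the sequence starts with \<open>g\<close> at
  time 1.\<close>

primrec rec_seq :: "complex \<Rightarrow> complex \<Rightarrow> complex \<Rightarrow> nat \<Rightarrow> complex" where
  "rec_seq \<alpha> \<beta> g 0 = 0"
| "rec_seq \<alpha> \<beta> g (Suc n) = (1 + \<alpha> / of_nat n) * (1 + \<beta> / of_nat n) * rec_seq \<alpha> \<beta> g n + g"

context
  fixes \<alpha> \<beta> g a :: complex and y :: "nat \<Rightarrow> complex"
  assumes a: "a = \<alpha> + \<beta>" and y: "y = (\<lambda>n. rec_seq \<alpha> \<beta> g n / of_nat n)"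
begin

lemma rec_seq_mean_step:
  assumes "n \<ge> 1"
  shows "(of_nat n + 1) * y (Suc n) = (of_nat n + a + \<alpha> * \<beta> / of_nat n) * y n + g"
proof -
  have nz: "of_nat n \<noteq> (0::complex)" "1 + of_nat n \<noteq> (0::complex)"
    using assms of_nat_neq_0[of n] by auto
  have "(of_nat n + 1) * y (Suc n) = (1 + \<alpha> / of_nat n) * (1 + \<beta> / of_nat n) * rec_seq \<alpha> \<beta> g n + g"
    using nz by (simp add: y add.commute)
  also have "rec_seq \<alpha> \<beta> g n = of_nat n * y n" using nz by (simp add: y)
  also have "(1 + \<alpha> / of_nat n) * (1 + \<beta> / of_nat n) * (of_nat n * y n) = (of_nat n + a + \<alpha> * \<beta> / of_nat n) * y n"
    using nz by (simp add: a field_simps)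
  finally show ?thesis .
qed

text \<open>\<open>g / (1 - a)\<close> is the fixed point of the recursion without its
  \<open>1 / n\<close> correction. The distance to it is multiplied by
  \<open>(n + a) / (n + 1)\<close>, of modulus \<open>1 - (1 - Re a) / (n + 1)\<close> up to
  \<open>1 / n^2\<close>, and the correction contributes errors of that order as well.\<close>

lemma rec_seq_mean_contracts:
  assumes "a \<noteq> 1"
  defines "z \<equiv> (\<lambda>n. cmod (y n - g / (1 - a)))"
  obtains K N where "0 \<le> K" "N \<ge> 1"
    "\<And>n. n \<ge> N \<Longrightarrow> z (Suc n) \<le> (1 - (1 - Re a) / (real n + 1) + K / (real n)\<^sup>2) * z n + K / (real n)\<^sup>2"
proof -
  define L where "L = g / (1 - a)"
  define K where "K = (Im a)\<^sup>2 + cmod (\<alpha> * \<beta>) + cmod (\<alpha> * \<beta>) * cmod L"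
  \<comment> \<open>From this index on, \<open>n + Re a\<close> is at least \<open>n / 2\<close>,
    hence positive.\<close>
  define N where "N = nat \<lceil>2 * \<bar>Re a\<bar>\<rceil> + 1"
  show ?thesis
  proof
    show "0 \<le> K" by (simp add: K_def)
    show "N \<ge> 1" by (simp add: N_def)
    fix n assume n: "n \<ge> N"
    then have n1: "n \<ge> 1" and na: "real n \<ge> 2 * \<bar>Re a\<bar>" unfolding N_def by linarith+
    have pos: "real n + Re a \<ge> real n / 2" "real n > 0" using na n1 by linarith+
    have nz: "of_nat n \<noteq> (0::complex)" "1 + of_nat n \<noteq> (0::complex)"
      using n1 of_nat_neq_0[of n] by auto
    have "(of_nat n + 1) * (y (Suc n) - L) =
        (of_nat n + a + \<alpha> * \<beta> / of_nat n) * (y n - L) + (L * \<alpha> * \<beta> / of_nat n + (g - L * (1 - a)))"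
      using rec_seq_mean_step[OF n1] by (simp add: algebra_simps diff_divide_distrib)
    also have "g - L * (1 - a) = 0" using assms(1) by (simp add: L_def)
    finally have eq: "(of_nat n + 1) * (y (Suc n) - L) =
        (of_nat n + a) * (y n - L) + (\<alpha> * \<beta>) / of_nat n * (y n - L) + L * (\<alpha> * \<beta>) / of_nat n"
      by (simp add: distrib_right mult.assoc)
    have "(real n + 1) * z (Suc n) = cmod ((of_nat n + 1) * (y (Suc n) - L))"
      using norm_of_nat[of "Suc n", where 'a = complex] by (simp add: z_def L_def norm_mult add.commute)
    also have "\<dots> \<le> cmod (of_nat n + a) * z n + cmod (\<alpha> * \<beta>) / n * z n + cmod L * cmod (\<alpha> * \<beta>) / n"
      unfolding eq
      by (intro order_trans[OF norm_triangle_ineq] add_mono order_refl)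
        (auto simp: z_def L_def norm_mult norm_divide)
    also have "cmod (of_nat n + a) \<le> real n + Re a + (Im a)\<^sup>2 / n"
    proof -
      have "cmod (of_nat n + a) \<le> n + Re a + (Im a)\<^sup>2 / (2 * (n + Re a))"
        by (rule norm_of_nat_add_le) (use pos in linarith)
      also have "(Im a)\<^sup>2 / (2 * (n + Re a)) \<le> (Im a)\<^sup>2 / n"
        using pos by (intro divide_left_mono) auto
      finally show ?thesis by simp
    qed
    finally have "(real n + 1) * z (Suc n) \<le>
        (real n + Re a + (Im a)\<^sup>2 / n) * z n + cmod (\<alpha> * \<beta>) / n * z n + cmod L * cmod (\<alpha> * \<beta>) / n"
      by (simp add: z_def mult_right_mono)
    also have "\<dots> = (real n + Re a) * z n + ((Im a)\<^sup>2 + cmod (\<alpha> * \<beta>)) / n * z n + cmod L * cmod (\<alpha> * \<beta>) / n"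
      by (simp add: algebra_simps add_divide_distrib)
    also have "\<dots> \<le> (real n + Re a) * z n + K / n * z n + K / n"
    proof -
      have "(Im a)\<^sup>2 + cmod (\<alpha> * \<beta>) \<le> K" "cmod L * cmod (\<alpha> * \<beta>) \<le> K"
        by (simp_all add: K_def)
      then show ?thesis
        by (intro add_mono order_refl mult_right_mono divide_right_mono) (auto simp: z_def)
    qed
    finally have "z (Suc n) \<le> ((real n + Re a) * z n + K / n * z n + K / n) / (real n + 1)"
      using pos(2) by (simp only: pos_le_divide_eq mult.commute[of "z (Suc n)"] add_pos_pos zero_less_one)
    also have "\<dots> = (1 - (1 - Re a) / (real n + 1)) * z n + K / (n * (real n + 1)) * z n + K / (n * (real n + 1))"
    proof -
      have "((m + r) * x + c / m * x + c / m) / (m + 1) = (1 - (1 - r) / (m + 1)) * x + c / (m * (m + 1)) * x + c / (m * (m + 1))"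
        if "m > 0" for m r x c :: real
        using that by (simp add: divide_simps)
      then show ?thesis using pos(2) by blast
    qed
    also have "\<dots> \<le> (1 - (1 - Re a) / (real n + 1)) * z n + K / (real n)\<^sup>2 * z n + K / (real n)\<^sup>2"
    proof -
      have "K / (n * (real n + 1)) \<le> K / (real n)\<^sup>2"
        using pos \<open>0 \<le> K\<close> by (intro divide_left_mono) (auto simp: power2_eq_square)
      then show ?thesis by (intro add_mono order_refl mult_right_mono) (auto simp: z_def)
    qed
    finally show "z (Suc n) \<le> (1 - (1 - Re a) / (real n + 1) + K / (real n)\<^sup>2) * z n + K / (real n)\<^sup>2"
      by (simp add: distrib_right)
  qed
qed

text \<open>On the line \<open>Re a = 1\<close> with \<open>a\<close> different from 1 the
  contraction is lost, but the remaining errors are summable. Boundedness survives, and it is enough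
  once the sequence is divided by \<open>ln n\<close>.\<close>

lemma rec_seq_mean_bounded:
  assumes "a \<noteq> 1" "Re a \<le> 1"
  shows "\<exists>U>0. \<forall>n. cmod (y n - g / (1 - a)) \<le> U"
proof -
  let ?z = "\<lambda>n. cmod (y n - g / (1 - a))"
  obtain K N where K: "0 \<le> K" "N \<ge> 1" and rec: "\<And>n. n \<ge> N \<Longrightarrow> ?z (Suc n) \<le>
      (1 - (1 - Re a) / (real n + 1) + K / (real n)\<^sup>2) * ?z n + K / (real n)\<^sup>2"
    using rec_seq_mean_contracts[OF assms(1)] by blast
  show ?thesis
  proof (rule bounded_of_summable_perturbation)
    fix n assume n: "n \<ge> N"
    have le: "K / (real n)\<^sup>2 \<le> K * real n powr (-3/2)"
      using inverse_square_le_three_halves K n by simp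
    have "0 \<le> (1 - Re a) / (real n + 1)" using assms(2) by simp
    then have "(1 - (1 - Re a) / (real n + 1) + K / (real n)\<^sup>2) * ?z n + K / (real n)\<^sup>2
        \<le> (1 + K * real n powr (-3/2)) * ?z n + K * real n powr (-3/2)"
      using le by (intro add_mono mult_right_mono) auto
    with rec[OF n] show "?z (Suc n)
        \<le> (1 + K * real n powr (-3/2)) * ?z n + K * real n powr (-3/2)" by linarith
  qed (use K in auto)
qed

text \<open>Boundedness turns the multiplicative error \<open>K / n^2\<close> into an additive one,
  after which the contraction with rate \<open>1 - Re a\<close>, capped at 1/2, drives the distance
  to 0.\<close>

lemma rec_seq_mean_tendsto:
  assumes "Re a < 1"
  shows "y \<longlonglongrightarrow> g / (1 - a)"
proof -
  let ?z = "\<lambda>n. cmod (y n - g / (1 - a))"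
  have a1: "a \<noteq> 1" using assms by auto
  obtain K N where K: "0 \<le> K" "N \<ge> 1" and rec: "\<And>n. n \<ge> N \<Longrightarrow> ?z (Suc n) \<le>
      (1 - (1 - Re a) / (real n + 1) + K / (real n)\<^sup>2) * ?z n + K / (real n)\<^sup>2"
    using rec_seq_mean_contracts[OF a1] by blast
  obtain U where U: "U > 0" "\<And>n. ?z n \<le> U"
    using rec_seq_mean_bounded[OF a1] assms by auto
  have "?z \<longlonglongrightarrow> 0"
  proof (rule tendsto_0_of_contraction[where K = "K * (U + 1)" and \<delta> = "min (1/2) (1 - Re a)" and N = N])
    show "0 < min (1/2) (1 - Re a)" using assms by simp
    show "min (1/2) (1 - Re a) \<le> 1/2" by (rule min.cobounded1)
    show "0 \<le> K * (U + 1)" using K U by simp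
    fix n assume n: "n \<ge> N"
    have "(1 - (1 - Re a) / (real n + 1)) * ?z n \<le>
        (1 - min (1/2) (1 - Re a) / (real n + 1)) * ?z n"
      by (intro mult_right_mono diff_left_mono divide_right_mono) auto
    moreover have "K / (real n)\<^sup>2 * ?z n \<le> K / (real n)\<^sup>2 * U"
      using K U by (intro mult_left_mono) auto
    ultimately show "?z (Suc n) \<le>
        (1 - min (1/2) (1 - Re a) / (real n + 1)) * ?z n + K * (U + 1) / (real n)\<^sup>2"
      using rec[OF n] by (simp add: algebra_simps add_divide_distrib)
  qed auto
  then show ?thesis by (simp add: tendsto_norm_zero_iff LIM_zero_iff)
qed

text \<open>The resonant case: up to small errors \<open>y\<close> increases by
  \<open>g / (n + 1)\<close> at each step, so it follows \<open>g\<close> times the harmonic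
  numbers. These are compared exactly, and the logarithm enters only in the limit.\<close>

lemma rec_seq_log_bounded:
  assumes "a = 1"
  shows "\<exists>U>0. \<forall>n. cmod (y n - g * of_real (harm n)) \<le> U"
proof -
  define z where "z n = cmod (y n - g * of_real (harm n))" for n
  define K where "K = cmod (\<alpha> * \<beta>) * (1 + 3 * cmod g)"
  have "\<exists>U>0. \<forall>n. z n \<le> U"
  proof (rule bounded_of_summable_perturbation[where u = z and K = K and N = 1])
    show "0 \<le> K" by (simp add: K_def)
    fix n :: nat assume n: "n \<ge> 1"
    have nz: "of_nat n \<noteq> (0::complex)" "1 + of_nat n \<noteq> (0::complex)"
      using n of_nat_neq_0[of n] by auto
    \<comment> \<open>A square root is a crude bound for a logarithm, but it turns
      \<open>harm n / n^2\<close> into a multiple of \<open>n powr (-3/2)\<close>.\<close>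
    have h: "harm n \<ge> (0::real)" "harm n \<le> 3 * sqrt n"
    proof -
      show "harm n \<ge> (0::real)" by (simp add: harm_nonneg)
      have "harm n \<le> 1 + ln (real n)"
        using euler_mascheroni_sequence_decreasing[of 1 n] n by (simp add: harm_def)
      also have "ln (real n) = 2 * ln (sqrt n)" using n by (simp add: ln_sqrt)
      also have "ln (sqrt n) \<le> sqrt n - 1" using n by (intro ln_le_minus_one) simp
      finally have "harm n \<le> 2 * sqrt n - 1" by simp
      moreover have "0 \<le> sqrt n" by simp
      ultimately show "harm n \<le> 3 * sqrt n" by linarith
    qed
    have eq: "y (Suc n) - g * of_real (harm (Suc n)) = (y n - g * of_real (harm n))
        + (\<alpha> * \<beta>) / (of_nat n * (of_nat n + 1)) * (y n - g * of_real (harm n))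
        + (\<alpha> * \<beta>) / (of_nat n * (of_nat n + 1)) * (g * of_real (harm n))"
    proof -
      have "y (Suc n) = ((of_nat n + 1 + \<alpha> * \<beta> / of_nat n) * y n + g) / (of_nat n + 1)"
        using rec_seq_mean_step[OF n] nz(2) unfolding assms
        by (subst nonzero_eq_divide_eq) (simp_all add: add.commute mult.commute)
      also have "\<dots> = y n + (\<alpha> * \<beta>) / (of_nat n * (of_nat n + 1)) * y n + g / (of_nat n + 1)"
      proof -
        have "((m + 1 + c / m) * x + h) / (m + 1) = x + c / (m * (m + 1)) * x + h / (m + 1)"
          if "m \<noteq> 0" "m + 1 \<noteq> 0" for m c x h :: complex
          using that by (simp add: divide_simps) (simp add: algebra_simps)
        moreover have "of_nat n + 1 \<noteq> (0::complex)" using nz(2) by (simp add: add.commute)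
        ultimately show ?thesis using nz(1) by blast
      qed
      finally show ?thesis using nz(1,2)
        by (simp add: harm_Suc algebra_simps divide_inverse)
    qed
    have c: "cmod (of_nat n + 1) = real n + 1"
      using norm_of_nat[of "Suc n", where 'a = complex] by (simp add: add.commute)
    have "z (Suc n) \<le> z n + cmod (\<alpha> * \<beta>) / (n * (real n + 1)) * z n
        + cmod (\<alpha> * \<beta>) / (n * (real n + 1)) * (cmod g * harm n)"
      unfolding z_def eq
      by (intro order_trans[OF norm_triangle_ineq] add_mono order_refl)
        (use h(1) c in \<open>simp_all add: norm_mult norm_divide\<close>)
    also have "\<dots> \<le> z n + K * real n powr (-3/2) * z n + K * real n powr (-3/2)"
    proof (intro add_mono order_refl)
      have sq: "cmod (\<alpha> * \<beta>) / (n * (real n + 1)) \<le> cmod (\<alpha> * \<beta>) / (real n)\<^sup>2"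
        using n by (intro divide_left_mono) (auto simp: power2_eq_square)
      also have "\<dots> \<le> cmod (\<alpha> * \<beta>) * real n powr (-3/2)"
        by (rule inverse_square_le_three_halves) (use n in auto)
      also have "\<dots> \<le> K * real n powr (-3/2)"
        by (intro mult_right_mono) (simp_all add: K_def distrib_left)
      finally show "cmod (\<alpha> * \<beta>) / (n * (real n + 1)) * z n \<le> K * real n powr (-3/2) * z n"
        by (intro mult_right_mono) (auto simp: z_def)
      have "cmod (\<alpha> * \<beta>) / (n * (real n + 1)) * (cmod g * harm n)
          \<le> cmod (\<alpha> * \<beta>) / (real n)\<^sup>2 * (cmod g * (3 * sqrt n))"
        using sq h by (intro mult_mono) auto
      also have "\<dots> = cmod (\<alpha> * \<beta>) * (3 * cmod g) * (sqrt n / (real n)\<^sup>2)" by simp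
      also have "sqrt n / (real n)\<^sup>2 = real n powr (-3/2)"
      proof -
        have "sqrt n / (real n)\<^sup>2 = real n powr (1/2) * real n powr (-2)"
          using n by (subst powr_minus_two) (simp_all add: powr_half_sqrt)
        then show ?thesis by (simp flip: powr_add)
      qed
      also have "cmod (\<alpha> * \<beta>) * (3 * cmod g) * real n powr (-3/2) \<le> K * real n powr (-3/2)"
        unfolding K_def by (intro mult_right_mono mult_left_mono) auto
      finally show "cmod (\<alpha> * \<beta>) / (n * (real n + 1)) * (cmod g * harm n) \<le> K * real n powr (-3/2)" .
    qed
    finally show "z (Suc n) \<le> (1 + K * real n powr (-3/2)) * z n + K * real n powr (-3/2)"
      by (simp add: distrib_right)
  qed (auto simp: z_def)
  then show ?thesis by (simp add: z_def)
qed

lemma rec_seq_log_tendsto: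
  assumes "Re a \<le> 1"
  shows "(\<lambda>n. rec_seq \<alpha> \<beta> g n / of_real (n * ln n)) \<longlonglongrightarrow> (if a = 1 then g else 0)"
proof -
  have eq: "(\<lambda>n. rec_seq \<alpha> \<beta> g n / of_real (n * ln n)) = (\<lambda>n. y n / of_real (ln n))"
    by (simp add: y)
  show ?thesis
  proof (cases "a = 1")
    case True
    then obtain U where U: "\<And>n. cmod (y n - g * of_real (harm n)) \<le> U"
      using rec_seq_log_bounded by blast
    have "(\<lambda>n. (harm n - ln (real n)) / ln (real n)) \<longlonglongrightarrow> 0"
    proof (rule real_tendsto_divide_at_top)
      show "(\<lambda>n. harm n - ln (real n)) \<longlonglongrightarrow> (euler_mascheroni :: real)"
        using euler_mascheroni_LIMSEQ by simp
      show "filterlim (\<lambda>n. ln (real n)) at_top sequentially" by real_asymp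
    qed
    then have "(\<lambda>n. 1 + (harm n - ln (real n)) / ln (real n)) \<longlonglongrightarrow> 1 + 0"
      by (intro tendsto_intros)
    moreover have "\<forall>\<^sub>F n in sequentially. 1 + (harm n - ln (real n)) / ln (real n) = harm n / ln (real n)"
      using eventually_gt_at_top[of 1] by eventually_elim (simp add: field_simps)
    ultimately have "(\<lambda>n. harm n / ln (real n)) \<longlonglongrightarrow> (1::real)"
      using Lim_transform_eventually by fastforce
    then have "(\<lambda>n. (y n - g * of_real (harm n)) / of_real (ln n) + g * of_real (harm n / ln n)) \<longlonglongrightarrow> 0 + g * of_real 1"
      by (intro tendsto_intros tendsto_0_bounded_over_ln[OF U])
    then show ?thesis unfolding eq using True by (simp add: diff_divide_distrib)
  next
    case False
    then obtain U where U: "\<And>n. cmod (y n - g / (1 - a)) \<le> U"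
      using rec_seq_mean_bounded[OF False assms] by blast
    have "cmod (y n) \<le> U + cmod (g / (1 - a))" for n
      using U[of n] norm_triangle_sub[of "y n" "g / (1 - a)"] by linarith
    from tendsto_0_bounded_over_ln[OF this] show ?thesis unfolding eq using False by simp
  qed
qed

end

subsection \<open>Exponential sums of matrices\<close>

lemma sums_vec_componentwise:
  fixes f :: "nat \<Rightarrow> 'a::real_normed_vector^'n"
  assumes "\<And>i. (\<lambda>n. f n $ i) sums (s $ i)"
  shows "f sums s"
  unfolding sums_def by (rule vec_tendstoI) (use assms in \<open>simp add: sums_def\<close>)

text \<open>Eigenvector computations give complex values for real sums, limits and integrals. This
  lemma and its two analogues below show that such a value is real and bring the statement back to
  the real numbers.\<close>

lemma complex_sums_of_real:
  fixes f :: "nat \<Rightarrow> real"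
  assumes "(\<lambda>n. complex_of_real (f n)) sums s"
  shows "f sums Re s" "complex_of_real (Re s) = s"
proof -
  show *: "f sums Re s" using sums_Re[OF assms] by simp
  have "(\<lambda>n. complex_of_real (f n)) sums complex_of_real (Re s)" using * by (simp add: sums_of_real_iff)
  then show "complex_of_real (Re s) = s" using assms sums_unique2 by blast
qed

lemma complex_tendsto_of_real:
  fixes f :: "'a \<Rightarrow> real"
  assumes "((\<lambda>n. complex_of_real (f n)) \<longlongrightarrow> s) F" "F \<noteq> bot"
  shows "(f \<longlongrightarrow> Re s) F" "complex_of_real (Re s) = s"
proof -
  show *: "(f \<longlongrightarrow> Re s) F" using tendsto_Re[OF assms(1)] by simp
  show "complex_of_real (Re s) = s"
    using tendsto_unique[OF assms(2) tendsto_of_real[OF *] assms(1)] .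
qed

lemma complex_has_integral_of_real:
  fixes f :: "'a::euclidean_space \<Rightarrow> real"
  assumes "((\<lambda>x. complex_of_real (f x)) has_integral s) A"
  shows "(f has_integral Re s) A" "complex_of_real (Re s) = s"
proof -
  have "((Re \<circ> (\<lambda>x. complex_of_real (f x))) has_integral Re s) A"
    by (rule has_integral_linear[OF assms bounded_linear_Re])
  then show *: "(f has_integral Re s) A" by (simp add: o_def)
  have "((complex_of_real \<circ> f) has_integral complex_of_real (Re s)) A"
    by (rule has_integral_linear[OF * bounded_linear_of_real])
  then show "complex_of_real (Re s) = s" using assms has_integral_unique by (auto simp: o_def)
qed

lemma matrix_eq_sum_axis: "(M :: real^'n^'m) = (\<Sum>i\<in>UNIV. \<Sum>j\<in>UNIV. (M $ i $ j) *\<^sub>R axis i (axis j 1))"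
  by (simp add: vec_eq_iff axis_def if_distrib[of "\<lambda>x. _ * x"] if_distrib[of "\<lambda>x. x $ _"] if_distrib[of "\<lambda>x. _ *\<^sub>R x"] sum.If_cases cong: if_cong)

lemma has_integral_matrix_componentwise:
  fixes F :: "real \<Rightarrow> real^'n^'m"
  assumes "\<And>i j. ((\<lambda>t. F t $ i $ j) has_integral J $ i $ j) A"
  shows "(F has_integral J) A"
proof -
  have "((\<lambda>t. \<Sum>i\<in>UNIV. \<Sum>j\<in>UNIV. (F t $ i $ j) *\<^sub>R axis i (axis j (1::real))) has_integral
      (\<Sum>i\<in>UNIV. \<Sum>j\<in>UNIV. (J $ i $ j) *\<^sub>R axis i (axis j 1))) A"
    by (intro has_integral_sum has_integral_scaleR_left assms finite)
  then show ?thesis unfolding matrix_eq_sum_axis[symmetric] .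
qed

text \<open>The integral of \<open>exp (t * z)\<close> over \<open>{0..L}\<close> in closed form,
  not yet divided by \<open>L\<close>. When \<open>Re z <= 0\<close> it grows linearly for
  \<open>z = 0\<close> and stays bounded otherwise.\<close>

definition exp_mean :: "complex \<Rightarrow> real \<Rightarrow> complex" where
  "exp_mean z L = (if z = 0 then of_real L else (exp (of_real L * z) - 1) / z)"

lemma has_integral_exp_complex:
  assumes "0 \<le> L"
  shows "((\<lambda>t. exp (of_real t * z)) has_integral exp_mean z L) {0..L}"
proof (cases "z = 0")
  case True
  then show ?thesis
    using has_integral_const_real[of "1::complex" 0 L] assms by (simp add: exp_mean_def scaleR_conv_of_real)
next
  case False
  have "((\<lambda>t. exp (of_real t * z)) has_integral (exp (of_real L * z) / z - exp (of_real 0 * z) / z)) {0..L}"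
  proof (rule fundamental_theorem_of_calculus[OF assms])
    fix x :: real
    have "((\<lambda>w. exp (w * z) / z) has_field_derivative exp (of_real x * z)) (at (of_real x))"
      using False by (auto intro!: derivative_eq_intros)
    from has_vector_derivative_real_field[OF this]
    show "((\<lambda>t. exp (of_real t * z) / z) has_vector_derivative exp (of_real x * z)) (at x within {0..L})" .
  qed
  then show ?thesis using False by (simp add: exp_mean_def diff_divide_distrib)
qed

text \<open>Dominated convergence along the truncations to \<open>{0..k}\<close>, with the modulus
  \<open>exp (Re z * t)\<close> as the dominating function.\<close>

lemma has_integral_exp_complex_infinity:
  assumes "Re z < 0"
  shows "((\<lambda>t. exp (of_real t * z)) has_integral (- 1 / z)) {0..}"
proof -
  define f where "f k t = (if t \<in> {0..real k} then exp (of_real t * z) else 0)" for k :: nat and t :: real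
  have z: "z \<noteq> 0" using assms by auto
  have fint: "(f k has_integral exp_mean z (real k)) {0..}" for k
    unfolding f_def using has_integral_restrict[of "{0..real k}" "{0..}" "\<lambda>t. exp (of_real t * z)" "exp_mean z (real k)"]
      has_integral_exp_complex[of "real k" z] by auto
  have dom: "(\<lambda>t. exp (Re z * t)) integrable_on {0..}"
    using integrable_on_exp_minus_to_infinity[of "- Re z" 0] assms by simp
  have le: "norm (f k t) \<le> exp (Re z * t)" if "t \<in> {0..}" for k t
    by (simp add: f_def mult.commute)
  have conv: "(\<lambda>k. f k t) \<longlonglongrightarrow> exp (of_real t * z)" if "t \<in> {0..}" for t
  proof (rule tendsto_eventually)
    show "\<forall>\<^sub>F k in sequentially. f k t = exp (of_real t * z)"
      using eventually_ge_at_top[of "nat \<lceil>t\<rceil>"]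
    proof eventually_elim
      case (elim k)
      then have "t \<le> real k" by linarith
      then show ?case using that by (simp add: f_def)
    qed
  qed
  have 1: "(\<lambda>t. exp (of_real t * z)) integrable_on {0..}"
    and 2: "(\<lambda>k. integral {0..} (f k)) \<longlonglongrightarrow> integral {0..} (\<lambda>t. exp (of_real t * z))"
    using dominated_convergence[of f "{0..}", OF _ dom le conv] fint has_integral_integrable by blast+
  have "(\<lambda>k. exp_mean z (real k)) \<longlonglongrightarrow> - 1 / z"
  proof -
    have "(\<lambda>k. exp (of_real (real k) * z)) \<longlonglongrightarrow> 0"
    proof (rule tendsto_norm_zero_cancel)
      have "(\<lambda>k. exp (Re z * real k)) \<longlonglongrightarrow> 0" using assms by real_asymp
      then show "(\<lambda>k. norm (exp (of_real (real k) * z))) \<longlonglongrightarrow> 0" by (simp add: mult.commute)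
    qed
    then have "(\<lambda>k. (exp (of_real (real k) * z) - 1) / z) \<longlonglongrightarrow> (0 - 1) / z"
      using z by (intro tendsto_intros)
    then show ?thesis using z by (simp add: exp_mean_def)
  qed
  then have "integral {0..} (\<lambda>t. exp (of_real t * z)) = - 1 / z"
    using 2 integral_unique[OF fint] LIMSEQ_unique by simp
  then show ?thesis using 1 by (simp add: has_integral_integrable_integral)
qed

text \<open>For \<open>z\<close> nonzero, even on the imaginary axis where the integrand only
  oscillates, the integral is at most \<open>2 / |z|\<close> in modulus. Averaging therefore keeps
  the constant term alone.\<close>

lemma exp_mean_over_ln_tendsto:
  assumes "Re z \<le> 0"
  shows "(\<lambda>n. exp_mean z (ln (real n)) / of_real (ln (real n))) \<longlonglongrightarrow> (if z = 0 then 1 else 0)"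
proof (cases "z = 0")
  case True
  have "\<forall>\<^sub>F n in sequentially. exp_mean z (ln (real n)) / of_real (ln (real n)) = 1"
    using eventually_gt_at_top[of 1] by eventually_elim (simp add: exp_mean_def True)
  then show ?thesis using True by (simp add: tendsto_eventually)
next
  case False
  have "cmod ((exp (of_real (ln (real n)) * z) - 1) / z) \<le> 2 / cmod z" for n
  proof -
    have "ln (real n) \<ge> 0" by (cases "n = 0") auto
    then have "cmod (exp (of_real (ln (real n)) * z)) \<le> 1"
      using assms by (simp add: mult_nonneg_nonpos)
    then have "cmod (exp (of_real (ln (real n)) * z) - 1) \<le> 2"
      using norm_triangle_ineq4[of "exp (of_real (ln (real n)) * z)" 1] norm_one[where 'a = complex]
      by linarith
    then show ?thesis by (simp add: norm_divide divide_right_mono)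
  qed
  from tendsto_0_bounded_over_ln[OF this] show ?thesis
    using False by (simp add: exp_mean_def)
qed

context
  fixes F :: "real \<Rightarrow> real^'n^'m" and R :: "'r set" and \<kappa> :: "'r \<Rightarrow> 'm \<Rightarrow> 'n \<Rightarrow> complex" and z :: "'r \<Rightarrow> complex"
  assumes R: "finite R"
    and F: "\<And>t i j. of_real (F t $ i $ j) = (\<Sum>r\<in>R. \<kappa> r i j * exp (of_real t * z r))"
begin

lemma exp_sum_integral_infinity:
  assumes "\<And>r. r \<in> R \<Longrightarrow> Re (z r) < 0"
  shows "F integrable_on {0..}"
    and "of_real (integral {0..} F $ i $ j) = (\<Sum>r\<in>R. \<kappa> r i j * (- 1 / z r))"
proof -
  define J :: "real^'n^'m" where "J = (\<chi> i j. Re (\<Sum>r\<in>R. \<kappa> r i j * (- 1 / z r)))"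
  have *: "((\<lambda>t. of_real (F t $ i $ j)) has_integral (\<Sum>r\<in>R. \<kappa> r i j * (- 1 / z r))) {0..}" for i j
    unfolding F by (intro has_integral_sum R has_integral_mult_right has_integral_exp_complex_infinity assms)
  have J: "(F has_integral J) {0..}"
    by (rule has_integral_matrix_componentwise) (use complex_has_integral_of_real(1)[OF *] in \<open>simp add: J_def\<close>)
  then show "F integrable_on {0..}" by blast
  show "of_real (integral {0..} F $ i $ j) = (\<Sum>r\<in>R. \<kappa> r i j * (- 1 / z r))"
    using integral_unique[OF J] complex_has_integral_of_real(2)[OF *, of i j] by (simp add: J_def)
qed

lemma exp_sum_integral:
  shows "F integrable_on {0..L}"
    and "0 \<le> L \<Longrightarrow> of_real (integral {0..L} F $ i $ j) = (\<Sum>r\<in>R. \<kappa> r i j * exp_mean (z r) L)"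
proof -
  define J :: "real^'n^'m" where "J = (\<chi> i j. Re (\<Sum>r\<in>R. \<kappa> r i j * exp_mean (z r) L))"
  have *: "((\<lambda>t. of_real (F t $ i $ j)) has_integral (\<Sum>r\<in>R. \<kappa> r i j * exp_mean (z r) L)) {0..L}"
    if "0 \<le> L" for i j
    unfolding F using that by (intro has_integral_sum R has_integral_mult_right has_integral_exp_complex)
  have J: "(F has_integral J) {0..L}" if "0 \<le> L"
    by (rule has_integral_matrix_componentwise) (use complex_has_integral_of_real(1)[OF *[OF that]] in \<open>simp add: J_def\<close>)
  show "F integrable_on {0..L}"
  proof (cases "0 \<le> L")
    case False
    then show ?thesis by (simp add: integrable_on_empty)
  qed (use J in blast)
  show "of_real (integral {0..L} F $ i $ j) = (\<Sum>r\<in>R. \<kappa> r i j * exp_mean (z r) L)" if "0 \<le> L"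
    using integral_unique[OF J[OF that]] complex_has_integral_of_real(2)[OF *[OF that], of i j] by (simp add: J_def)
qed

lemma exp_sum_log_mean:
  assumes "\<And>r. r \<in> R \<Longrightarrow> Re (z r) \<le> 0"
  obtains J where "(\<lambda>n. (1 / ln (real n)) *\<^sub>R integral {0..ln (real n)} F) \<longlonglongrightarrow> J"
    "\<And>i j. of_real (J $ i $ j) = (\<Sum>r\<in>R. \<kappa> r i j * (if z r = 0 then 1 else 0))"
proof
  define J :: "real^'n^'m" where "J = (\<chi> i j. Re (\<Sum>r\<in>R. \<kappa> r i j * (if z r = 0 then 1 else 0)))"
  have *: "(\<lambda>n. of_real (((1 / ln (real n)) *\<^sub>R integral {0..ln (real n)} F) $ i $ j))
      \<longlonglongrightarrow> (\<Sum>r\<in>R. \<kappa> r i j * (if z r = 0 then 1 else 0))" for i j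
  proof -
    have "of_real (((1 / ln (real n)) *\<^sub>R integral {0..ln (real n)} F) $ i $ j)
        = (\<Sum>r\<in>R. \<kappa> r i j * (exp_mean (z r) (ln (real n)) / of_real (ln (real n))))" for n
    proof -
      have "ln (real n) \<ge> 0" by (cases "n = 0") auto
      then show ?thesis by (simp add: exp_sum_integral(2) sum_divide_distrib)
    qed
    then show ?thesis
      by (simp only:) (intro tendsto_sum tendsto_mult_left exp_mean_over_ln_tendsto assms)
  qed
  show "(\<lambda>n. (1 / ln (real n)) *\<^sub>R integral {0..ln (real n)} F) \<longlonglongrightarrow> J"
    by (intro vec_tendstoI) (use complex_tendsto_of_real(1)[OF *] in \<open>simp add: J_def\<close>)
  show "of_real (J $ i $ j) = (\<Sum>r\<in>R. \<kappa> r i j * (if z r = 0 then 1 else 0))" for i j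
    using complex_tendsto_of_real(2)[OF *, of i j] by (simp add: J_def)
qed

end

lemma mat_mult_vector: "(mat c :: real^'n^'n) *v y = c *\<^sub>R y"
proof -
  have "(if i = j then c else 0) * y $ j = (if j = i then c * y $ j else 0)" for i j by simp
  then show ?thesis by (simp add: vec_eq_iff matrix_vector_mult_def mat_def)
qed

lemma matrix_power_transpose: "matrix_power (transpose A) n = transpose (matrix_power A n)"
proof -
  have comm: "matrix_power A n ** A = A ** matrix_power A n" for A :: "real^'m^'m" and n
    by (induction n) (simp_all add: matrix_power_def matrix_mul_assoc[symmetric])
  show ?thesis
  proof (induction n)
    case 0
    then show ?case by (simp add: matrix_power_def transpose_mat)
  next
    case (Suc n)
    have "matrix_power (transpose A) (Suc n) = transpose A ** transpose (matrix_power A n)"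
      using Suc by (simp add: matrix_power_def)
    also have "\<dots> = transpose (matrix_power A n ** A)" by (simp add: matrix_transpose_mul)
    also have "matrix_power A n ** A = matrix_power A (Suc n)"
      unfolding comm by (simp add: matrix_power_def)
    finally show ?case .
  qed
qed

subsection \<open>Eigenvector coordinates\<close>

text \<open>The columns of \<open>P\<close> are right eigenvectors of \<open>B\<close> and the rows
  of \<open>Q\<close> the dual left eigenvectors. Keeping the basis abstract allows both an
  arbitrary diagonalisation and the orthogonal one of the symmetric case.\<close>

locale eigenbasis =
  fixes B :: "real^'n^'n" and P Q :: "complex^'n^'n" and d :: "'n \<Rightarrow> complex"
  assumes PQ: "P ** Q = mat 1" and QP: "Q ** P = mat 1"
    and QB: "\<And>a j. (Q ** complex_matrix B) $ a $ j = d a * Q $ a $ j"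
begin

definition coord :: "real^'n \<Rightarrow> 'n \<Rightarrow> complex" where
  "coord x a = (\<Sum>j\<in>UNIV. Q $ a $ j * of_real (x $ j))"

text \<open>The Gram matrix of the eigenvectors, which is the identity only for an orthonormal
  basis. The conjugate on the first index is the reason why exponents combine to
  \<open>cnj (d a) + d b\<close>.\<close>

definition gram :: "'n \<Rightarrow> 'n \<Rightarrow> complex" where
  "gram a b = (\<Sum>i\<in>UNIV. cnj (P $ i $ a) * P $ i $ b)"

abbreviation form :: "('n \<Rightarrow> complex) \<Rightarrow> ('n \<Rightarrow> 'n \<Rightarrow> complex) \<Rightarrow> ('n \<Rightarrow> complex) \<Rightarrow> complex" where
  "form f h g \<equiv> (\<Sum>a\<in>UNIV. \<Sum>b\<in>UNIV. cnj (f a) * h a b * g b)"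

lemma coord_axis [simp]: "coord (axis i 1) a = Q $ a $ i"
  by (simp add: coord_def axis_def if_distrib[of "\<lambda>x. _ * x"] if_distrib[of complex_of_real] cong: if_cong)

lemma coord_add: "coord (x + y) a = coord x a + coord y a"
  by (simp add: coord_def distrib_left sum.distrib)

lemma coord_scaleR: "coord (c *\<^sub>R x) a = of_real c * coord x a"
  by (simp add: coord_def sum_distrib_left mult_ac)

lemma coord_mult: "coord (B *v x) a = d a * coord x a"
proof -
  have "coord (B *v x) a = (\<Sum>j\<in>UNIV. \<Sum>l\<in>UNIV. Q $ a $ j * of_real (B $ j $ l) * of_real (x $ l))"
    by (simp add: coord_def matrix_vector_mult_def sum_distrib_left mult_ac)
  also have "\<dots> = (\<Sum>l\<in>UNIV. \<Sum>j\<in>UNIV. Q $ a $ j * of_real (B $ j $ l) * of_real (x $ l))"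
    by (rule sum.swap)
  also have "\<dots> = (\<Sum>l\<in>UNIV. (Q ** complex_matrix B) $ a $ l * of_real (x $ l))"
    by (simp add: matrix_matrix_mult_def sum_distrib_right)
  also have "\<dots> = d a * coord x a" by (simp add: QB coord_def sum_distrib_left mult_ac)
  finally show ?thesis .
qed

lemma of_real_component: "of_real (x $ i) = (\<Sum>a\<in>UNIV. P $ i $ a * coord x a)"
proof -
  have "(\<Sum>a\<in>UNIV. P $ i $ a * coord x a) = (\<Sum>a\<in>UNIV. \<Sum>j\<in>UNIV. P $ i $ a * Q $ a $ j * of_real (x $ j))"
    by (simp add: coord_def sum_distrib_left mult_ac)
  also have "\<dots> = (\<Sum>j\<in>UNIV. \<Sum>a\<in>UNIV. P $ i $ a * Q $ a $ j * of_real (x $ j))"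
    by (rule sum.swap)
  also have "\<dots> = (\<Sum>j\<in>UNIV. (P ** Q) $ i $ j * of_real (x $ j))"
    by (simp add: matrix_matrix_mult_def sum_distrib_right)
  also have "\<dots> = of_real (x $ i)"
    by (simp add: PQ mat_def if_distrib[of "\<lambda>x. x * _"] cong: if_cong)
  finally show ?thesis by simp
qed

lemma of_real_inner:
  "of_real (x \<bullet> y) = form (coord x) gram (coord y)"
proof -
  let ?f = "\<lambda>i a b. cnj (coord x a) * (cnj (P $ i $ a) * P $ i $ b) * coord y b"
  have "of_real (x \<bullet> y) = (\<Sum>i\<in>UNIV. cnj (of_real (x $ i)) * of_real (y $ i))"
    by (simp add: inner_vec_def)
  also have "\<dots> = (\<Sum>i\<in>UNIV. \<Sum>a\<in>UNIV. \<Sum>b\<in>UNIV. ?f i a b)"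
    unfolding of_real_component cnj_sum sum_product
    by (intro sum.cong refl) (simp add: mult_ac)
  also have "\<dots> = (\<Sum>a\<in>UNIV. \<Sum>i\<in>UNIV. \<Sum>b\<in>UNIV. ?f i a b)"
    by (rule sum.swap)
  also have "\<dots> = (\<Sum>a\<in>UNIV. \<Sum>b\<in>UNIV. \<Sum>i\<in>UNIV. ?f i a b)"
    by (intro sum.cong refl sum.swap)
  also have "\<dots> = form (coord x) gram (coord y)"
    by (simp add: gram_def sum_distrib_left sum_distrib_right)
  finally show ?thesis .
qed

text \<open>Converts an entrywise formula for a covariance matrix into the shape in which the limits
  of the transported quadratic form are computed, so that the two can be compared coefficient by
  coefficient.\<close>

lemma of_real_quadratic:
  assumes "\<And>i j. of_real (M $ i $ j) = form (\<lambda>a. Q $ a $ i) h (\<lambda>b. Q $ b $ j)"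
  shows "of_real (x \<bullet> (M *v x)) = form (coord x) h (coord x)"
proof -
  let ?f = "\<lambda>i j a b. cnj (Q $ a $ i * of_real (x $ i)) * h a b * (Q $ b $ j * of_real (x $ j))"
  have "complex_of_real (x \<bullet> (M *v x)) = (\<Sum>i\<in>UNIV. \<Sum>j\<in>UNIV. of_real (x $ i) * of_real (M $ i $ j) * of_real (x $ j))"
    by (simp add: inner_vec_def matrix_vector_mult_def sum_distrib_left mult_ac)
  also have "\<dots> = (\<Sum>i\<in>UNIV. \<Sum>j\<in>UNIV. \<Sum>a\<in>UNIV. \<Sum>b\<in>UNIV. ?f i j a b)"
    by (simp add: assms sum_distrib_left sum_distrib_right mult_ac)
  also have "\<dots> = (\<Sum>i\<in>UNIV. \<Sum>a\<in>UNIV. \<Sum>j\<in>UNIV. \<Sum>b\<in>UNIV. ?f i j a b)"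
    by (intro sum.cong refl sum.swap)
  also have "\<dots> = (\<Sum>a\<in>UNIV. \<Sum>i\<in>UNIV. \<Sum>j\<in>UNIV. \<Sum>b\<in>UNIV. ?f i j a b)"
    by (rule sum.swap)
  also have "\<dots> = (\<Sum>a\<in>UNIV. \<Sum>i\<in>UNIV. \<Sum>b\<in>UNIV. \<Sum>j\<in>UNIV. ?f i j a b)"
    by (intro sum.cong refl sum.swap)
  also have "\<dots> = (\<Sum>a\<in>UNIV. \<Sum>b\<in>UNIV. \<Sum>i\<in>UNIV. \<Sum>j\<in>UNIV. ?f i j a b)"
    by (intro sum.cong refl sum.swap)
  also have "\<dots> = form (coord x) h (coord x)"
    unfolding coord_def cnj_sum by (simp only: sum_distrib_left sum_distrib_right)
      (intro sum.cong refl sum.swap)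
  finally show ?thesis .
qed

text \<open>The candidate for the exponential of \<open>t (B - I/2)\<close>. Taking
  \<open>Re\<close> makes it a real matrix by definition; \<open>of_real_expB\<close> shows that no
  imaginary part is lost.\<close>

definition expB :: "real \<Rightarrow> real^'n^'n" where
  "expB t = (\<chi> i j. Re (\<Sum>a\<in>UNIV. P $ i $ a * exp (of_real t * (d a - 1/2)) * Q $ a $ j))"

abbreviation gen_mat :: "real \<Rightarrow> real^'n^'n" where
  "gen_mat t \<equiv> t *\<^sub>R (B - mat (1/2))"

lemma coord_matrix_power:
  "coord (matrix_power (gen_mat t) n *v x) a = (of_real t * (d a - 1/2)) ^ n * coord x a"
proof (induction n)
  case 0
  then show ?case by (simp add: matrix_power_def)
next
  case (Suc n)
  have step: "coord (gen_mat t *v y) a = of_real t * (d a - 1/2) * coord y a" for y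
  proof -
    have "(gen_mat t) *v y = t *\<^sub>R (B *v y + (- (1/2)) *\<^sub>R y)"
      by (simp only: scaleR_matrix_vector_assoc[symmetric] matrix_vector_mult_diff_rdistrib mat_mult_vector) simp
    then show ?thesis by (simp only: coord_scaleR coord_add coord_mult) (simp add: algebra_simps)
  qed
  show ?case
    using Suc by (simp add: matrix_power_def matrix_vector_mul_assoc[symmetric] step mult_ac)
qed

lemma of_real_matrix_power:
  "of_real (matrix_power (gen_mat t) n $ i $ j)
    = (\<Sum>a\<in>UNIV. P $ i $ a * (of_real t * (d a - 1/2)) ^ n * Q $ a $ j)"
proof -
  have "matrix_power (gen_mat t) n $ i $ j = (matrix_power (gen_mat t) n *v axis j 1) $ i"
    by (simp add: matrix_vector_mult_basis column_def)
  then show ?thesis by (simp add: of_real_component coord_matrix_power mult_ac)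
qed

lemma expB_sums: "(\<lambda>n. (1 / fact n) *\<^sub>R matrix_power (gen_mat t) n) sums expB t"
  and of_real_expB: "of_real (expB t $ i $ j) = (\<Sum>a\<in>UNIV. P $ i $ a * exp (of_real t * (d a - 1/2)) * Q $ a $ j)"
proof -
  have *: "(\<lambda>n. of_real (((1 / fact n) *\<^sub>R matrix_power (gen_mat t) n) $ i $ j)) sums
      (\<Sum>a\<in>UNIV. P $ i $ a * exp (of_real t * (d a - 1/2)) * Q $ a $ j)" for i j
  proof -
    have "(\<lambda>n. \<Sum>a\<in>UNIV. P $ i $ a * ((of_real t * (d a - 1/2)) ^ n /\<^sub>R fact n) * Q $ a $ j) sums
        (\<Sum>a\<in>UNIV. P $ i $ a * exp (of_real t * (d a - 1/2)) * Q $ a $ j)"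
      by (intro sums_sum sums_mult sums_mult2 exp_converges)
    moreover have "of_real (((1 / fact n) *\<^sub>R matrix_power (gen_mat t) n) $ i $ j)
        = (\<Sum>a\<in>UNIV. P $ i $ a * ((of_real t * (d a - 1/2)) ^ n /\<^sub>R fact n) * Q $ a $ j)" for n
    proof -
      have "of_real (((1 / fact n) *\<^sub>R matrix_power (gen_mat t) n) $ i $ j)
          = inverse (fact n) * (\<Sum>a\<in>UNIV. P $ i $ a * (of_real t * (d a - 1/2)) ^ n * Q $ a $ j)"
        by (simp only: vector_scaleR_component real_scaleR_def of_real_mult of_real_matrix_power
            of_real_divide of_real_fact of_real_1 inverse_eq_divide)
      also have "\<dots> = (\<Sum>a\<in>UNIV. P $ i $ a * ((of_real t * (d a - 1/2)) ^ n /\<^sub>R fact n) * Q $ a $ j)"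
        unfolding sum_distrib_left scaleR_conv_of_real of_real_inverse of_real_fact
        by (intro sum.cong refl) (simp only: mult.assoc mult.left_commute)
      finally show ?thesis .
    qed
    ultimately show ?thesis by presburger
  qed
  show "(\<lambda>n. (1 / fact n) *\<^sub>R matrix_power (gen_mat t) n) sums expB t"
    by (intro sums_vec_componentwise) (use complex_sums_of_real(1)[OF *] in \<open>simp add: expB_def\<close>)
  show "of_real (expB t $ i $ j) = (\<Sum>a\<in>UNIV. P $ i $ a * exp (of_real t * (d a - 1/2)) * Q $ a $ j)"
    using complex_sums_of_real(2)[OF *, of i j] by (simp add: expB_def)
qed

lemma matrix_exp_eq: "matrix_exp (gen_mat t) = expB t"
  using expB_sums by (simp add: matrix_exp_def sums_iff)

lemma matrix_exp_transpose_eq: "matrix_exp (t *\<^sub>R transpose (B - mat (1/2))) = transpose (expB t)"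
proof -
  have "(\<lambda>n. (1 / fact n) *\<^sub>R matrix_power (t *\<^sub>R transpose (B - mat (1/2))) n) sums transpose (expB t)"
  proof (intro sums_vec_componentwise)
    fix i j
    have t: "t *\<^sub>R transpose (B - mat (1/2)) = transpose (gen_mat t)"
      by (simp add: vec_eq_iff transpose_def)
    have "(\<lambda>n. ((1 / fact n) *\<^sub>R matrix_power (gen_mat t) n) $ j $ i) sums (expB t $ j $ i)"
      using tendsto_vec_nth[OF tendsto_vec_nth[OF expB_sums[of t, unfolded sums_def], of j], of i]
      by (simp add: sums_def)
    then show "(\<lambda>n. ((1 / fact n) *\<^sub>R matrix_power (t *\<^sub>R transpose (B - mat (1/2))) n) $ i $ j) sums (transpose (expB t) $ i $ j)"
      unfolding t matrix_power_transpose by (simp add: transpose_def)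
  qed
  then show ?thesis by (simp add: matrix_exp_def sums_iff)
qed

lemma cov_integrand_eq: "cov_integrand B t = transpose (expB t) ** expB t"
  by (simp add: cov_integrand_def matrix_exp_eq matrix_exp_transpose_eq)

text \<open>The two shifts by 1/2 add up to the -1 in the exponent. The double sum is written over
  pairs \<open>r\<close> so that it has the single index set of the exponential-sum lemmas.\<close>

lemma of_real_cov_integrand:
  "of_real (cov_integrand B t $ i $ j) =
    (\<Sum>r\<in>UNIV. (cnj (Q $ fst r $ i) * gram (fst r) (snd r) * Q $ snd r $ j) *
      exp (of_real t * (cnj (d (fst r)) + d (snd r) - 1)))" (is "?l = ?r")
proof -
  define e where "e a = exp (of_real t * (d a - 1/2))" for a
  let ?f = "\<lambda>l a b. cnj (Q $ a $ i) * (cnj (P $ l $ a) * P $ l $ b) * Q $ b $ j * (cnj (e a) * e b)"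
  have "of_real (cov_integrand B t $ i $ j)
      = (\<Sum>l\<in>UNIV. cnj (of_real (expB t $ l $ i)) * of_real (expB t $ l $ j))"
    by (simp add: cov_integrand_eq matrix_matrix_mult_def transpose_def)
  also have "\<dots> = (\<Sum>l\<in>UNIV. \<Sum>a\<in>UNIV. \<Sum>b\<in>UNIV. ?f l a b)"
    unfolding of_real_expB cnj_sum sum_product
    by (intro sum.cong refl) (simp add: e_def mult_ac)
  also have "\<dots> = (\<Sum>a\<in>UNIV. \<Sum>l\<in>UNIV. \<Sum>b\<in>UNIV. ?f l a b)"
    by (rule sum.swap)
  also have "\<dots> = (\<Sum>a\<in>UNIV. \<Sum>b\<in>UNIV. \<Sum>l\<in>UNIV. ?f l a b)"
    by (intro sum.cong refl sum.swap)
  also have "\<dots> = (\<Sum>a\<in>UNIV. \<Sum>b\<in>UNIV. (cnj (Q $ a $ i) * gram a b * Q $ b $ j) * (cnj (e a) * e b))"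
    by (simp add: gram_def sum_distrib_left sum_distrib_right)
  also have "\<dots> = (\<Sum>a\<in>UNIV. \<Sum>b\<in>UNIV. (cnj (Q $ a $ i) * gram a b * Q $ b $ j) * exp (of_real t * (cnj (d a) + d b - 1)))"
    by (simp add: e_def exp_cnj exp_add[symmetric] algebra_simps)
  also have "\<dots> = ?r"
    by (simp add: sum.cartesian_product case_prod_unfold)
  finally show ?thesis .
qed

end

subsection \<open>Backward transport of test vectors\<close>

text \<open>The adjoint of the one-step conditional mean: given \<open>S n = s\<close> with
  \<open>n >= 1\<close>, the mean of \<open>t\<close> against \<open>S (n + 1)\<close> is
  \<open>back_step B n t\<close> against \<open>s\<close>. At \<open>n = 0\<close> division by zero
  makes it the identity.\<close>

definition back_step :: "real^'n^'n \<Rightarrow> nat \<Rightarrow> real^'n \<Rightarrow> real^'n" where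
  "back_step B n t = t + (1 / n) *\<^sub>R (B *v t)"

text \<open>For \<open>1 <= k <= n\<close> the product of \<open>I + B/j\<close> over
  \<open>k <= j < n\<close>, applied to \<open>t\<close>; for \<open>k >= n\<close> it is
  \<open>t\<close>. The recursion strips the latest time first, matching the conditioning on the
  past.\<close>

primrec tback :: "real^'n^'n \<Rightarrow> nat \<Rightarrow> nat \<Rightarrow> real^'n \<Rightarrow> real^'n" where
  "tback B 0 k t = t"
| "tback B (Suc n) k t = (if Suc n \<le> k then t else tback B n k (back_step B n t))"

definition Wsum :: "real^'n^'n \<Rightarrow> nat \<Rightarrow> real^'n \<Rightarrow> real" where
  "Wsum B n t = (\<Sum>k=1..n. (norm (tback B n k t))\<^sup>2)"

text \<open>Plays the part of a Lindeberg condition: uniformly in \<open>k\<close>, a single time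
  contributes a vanishing share to a variance of order \<open>b n\<close>.\<close>

abbreviation tback_negligible :: "real^'n^'n \<Rightarrow> (nat \<Rightarrow> real) \<Rightarrow> real^'n \<Rightarrow> bool" where
  "tback_negligible B b t \<equiv> \<exists>\<epsilon>. \<epsilon> \<longlonglongrightarrow> 0 \<and> (\<forall>n k. k \<in> {1..n} \<longrightarrow> (norm (tback B n k t))\<^sup>2 / b n \<le> \<epsilon> n)"

lemma back_step_scaleR: "back_step B n (c *\<^sub>R t) = c *\<^sub>R back_step B n t"
  by (simp add: back_step_def scaleR_add_right matrix_vector_mult_scaleR)

lemma tback_scaleR: "tback B n k (c *\<^sub>R t) = c *\<^sub>R tback B n k t"
  by (induction n arbitrary: t) (simp_all add: back_step_scaleR)

lemma Wsum_scaleR: "Wsum B n (c *\<^sub>R t) = c\<^sup>2 * Wsum B n t"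
  by (simp add: Wsum_def tback_scaleR power_mult_distrib sum_distrib_left)

lemma Wsum_nonneg: "0 \<le> Wsum B n t"
  by (simp add: Wsum_def sum_nonneg)

lemma sum_tback_Suc:
  "(\<Sum>k=1..Suc n. f k (tback B (Suc n) k t)) = f (Suc n) t + (\<Sum>k=1..n. f k (tback B n k (back_step B n t)))"
proof -
  have "(\<Sum>k=1..Suc n. f k (tback B (Suc n) k t)) = f (Suc n) t + (\<Sum>k=1..n. f k (tback B (Suc n) k t))"
    by (simp add: add.commute)
  also have "(\<Sum>k=1..n. f k (tback B (Suc n) k t)) = (\<Sum>k=1..n. f k (tback B n k (back_step B n t)))"
    by (intro sum.cong) auto
  finally show ?thesis .
qed

lemma Wsum_0 [simp]: "Wsum B 0 t = 0"
  by (simp add: Wsum_def)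

lemma Wsum_Suc: "Wsum B (Suc n) t = (norm t)\<^sup>2 + Wsum B n (back_step B n t)"
  unfolding Wsum_def by (rule sum_tback_Suc)

context eigenbasis
begin

lemma coord_back_step: "coord (back_step B n t) a = (1 + d a / of_nat n) * coord t a"
  by (simp add: back_step_def coord_add coord_scaleR coord_mult algebra_simps)

text \<open>A backward step multiplies coordinate \<open>a\<close> by \<open>1 + d a / n\<close>, so
  the pairs \<open>(a, b)\<close> do not mix and each coefficient follows its own scalar recursion;
  the new term \<open>|t|^2\<close> contributes the Gram entry.\<close>

lemma of_real_Wsum:
  "of_real (Wsum B n t) =
    form (coord t) (\<lambda>a b. rec_seq (cnj (d a)) (d b) (gram a b) n) (coord t)"
proof (induction n arbitrary: t)
  case 0
  then show ?case by simp
next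
  case (Suc n)
  have "of_real (Wsum B (Suc n) t) =
      form (coord t) gram (coord t) +
      form (coord (back_step B n t)) (\<lambda>a b. rec_seq (cnj (d a)) (d b) (gram a b) n) (coord (back_step B n t))"
    using of_real_inner[of t t] by (simp add: Wsum_Suc Suc dot_square_norm)
  moreover have "sa * g * sb + ((1 + x) * sa) * r * ((1 + y) * sb) = sa * ((1 + x) * (1 + y) * r + g) * sb"
    for sa sb g r x y :: complex by (simp add: algebra_simps)
  ultimately show ?case
    by (simp add: coord_back_step del: times_divide_eq_left times_divide_eq_right flip: sum.distrib)
qed

lemma Wsum_mean_tendsto:
  assumes "\<And>a. Re (d a) < 1/2"
  shows "(\<lambda>n. of_real (Wsum B n t / n)) \<longlonglongrightarrow>
    form (coord t) (\<lambda>a b. gram a b / (1 - (cnj (d a) + d b))) (coord t)"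
proof -
  have "(\<lambda>n. rec_seq (cnj (d a)) (d b) (gram a b) n / of_nat n) \<longlonglongrightarrow> gram a b / (1 - (cnj (d a) + d b))" for a b
    by (rule rec_seq_mean_tendsto[OF refl refl]) (use assms[of a] assms[of b] in simp)
  then have "(\<lambda>n. \<Sum>a\<in>UNIV. \<Sum>b\<in>UNIV. cnj (coord t a) * (rec_seq (cnj (d a)) (d b) (gram a b) n / of_nat n) * coord t b)
      \<longlonglongrightarrow> form (coord t) (\<lambda>a b. gram a b / (1 - (cnj (d a) + d b))) (coord t)"
    by (intro tendsto_sum tendsto_mult tendsto_const)
  then show ?thesis by (simp add: of_real_Wsum sum_divide_distrib)
qed

lemma Wsum_log_tendsto:
  assumes "\<And>a. Re (d a) \<le> 1/2"
  shows "(\<lambda>n. of_real (Wsum B n t / (n * ln n))) \<longlonglongrightarrow>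
    form (coord t) (\<lambda>a b. if cnj (d a) + d b = 1 then gram a b else 0) (coord t)"
proof -
  have "(\<lambda>n. rec_seq (cnj (d a)) (d b) (gram a b) n / of_real (n * ln n)) \<longlonglongrightarrow> (if cnj (d a) + d b = 1 then gram a b else 0)" for a b
    by (rule rec_seq_log_tendsto[OF refl refl]) (use assms[of a] assms[of b] in simp)
  then have "(\<lambda>n. \<Sum>a\<in>UNIV. \<Sum>b\<in>UNIV. cnj (coord t a) * (rec_seq (cnj (d a)) (d b) (gram a b) n / of_real (n * ln n)) * coord t b)
      \<longlonglongrightarrow> form (coord t) (\<lambda>a b. if cnj (d a) + d b = 1 then gram a b else 0) (coord t)"
    by (intro tendsto_sum tendsto_mult tendsto_const)
  moreover have "of_real (Wsum B n t / (n * ln n)) =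
      form (coord t) (\<lambda>a b. rec_seq (cnj (d a)) (d b) (gram a b) n / of_real (n * ln n)) (coord t)" for n
    unfolding of_real_divide of_real_Wsum sum_divide_distrib by simp
  ultimately show ?thesis by presburger
qed

text \<open>A squared norm adapted to the eigenvectors: backward steps are diagonal there, so growth
  can be bounded coordinate by coordinate even if the eigenvectors are not orthogonal.\<close>

definition coord_norm :: "real^'n \<Rightarrow> real" where
  "coord_norm x = (\<Sum>a\<in>UNIV. (cmod (coord x a))\<^sup>2)"

lemma coord_norm_nonneg: "0 \<le> coord_norm x"
  by (simp add: coord_norm_def sum_nonneg)

lemma norm_le_coord_norm: "(norm x)\<^sup>2 \<le> (\<Sum>a\<in>UNIV. \<Sum>b\<in>UNIV. cmod (gram a b)) * coord_norm x"
proof -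
  have le: "(cmod (coord x a))\<^sup>2 \<le> coord_norm x" for a
    unfolding coord_norm_def by (rule member_le_sum) auto
  have "(norm x)\<^sup>2 = cmod (of_real (x \<bullet> x))"
    by (simp only: norm_of_real dot_square_norm abs_power2)
  also have "\<dots> \<le> (\<Sum>a\<in>UNIV. \<Sum>b\<in>UNIV. cmod (cnj (coord x a) * gram a b * coord x b))"
    unfolding of_real_inner by (intro order_trans[OF norm_sum] sum_mono norm_sum)
  also have "\<dots> \<le> (\<Sum>a\<in>UNIV. \<Sum>b\<in>UNIV. cmod (gram a b) * coord_norm x)"
  proof (intro sum_mono)
    fix a b
    have "cmod (coord x a) * cmod (coord x b) \<le> ((cmod (coord x a))\<^sup>2 + (cmod (coord x b))\<^sup>2) / 2"
      using sum_squares_bound[of "cmod (coord x a)" "cmod (coord x b)"] by simp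
    also have "\<dots> \<le> coord_norm x" using le[of a] le[of b] by simp
    finally have "cmod (gram a b) * (cmod (coord x a) * cmod (coord x b)) \<le> cmod (gram a b) * coord_norm x"
      by (rule mult_left_mono) simp
    then show "cmod (cnj (coord x a) * gram a b * coord x b) \<le> cmod (gram a b) * coord_norm x"
      by (simp add: norm_mult mult_ac)
  qed
  also have "\<dots> = (\<Sum>a\<in>UNIV. \<Sum>b\<in>UNIV. cmod (gram a b)) * coord_norm x"
    by (simp add: sum_distrib_right)
  finally show ?thesis .
qed

text \<open>Each factor satisfies \<open>|1 + d/n|^2 = 1 + 2 Re d / n + |d|^2 / n^2\<close>, which
  is at most the exponential of \<open>\<rho> / n + \<kappa> / n^2\<close>. With \<rho> nonnegative
  all exponents are nonnegative, so one bound serves for transport stopped at any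
  \<open>k\<close>.\<close>

lemma coord_norm_tback:
  assumes \<rho>: "0 \<le> \<rho>" and d: "\<And>a. 2 * Re (d a) \<le> \<rho>"
  defines "\<kappa> \<equiv> (\<Sum>a\<in>UNIV. (cmod (d a))\<^sup>2)"
  shows "coord_norm (tback B n k t) \<le> exp (\<Sum>j<n. \<rho> / j + \<kappa> / (real j)\<^sup>2) * coord_norm t"
proof (induction n arbitrary: t)
  case 0
  then show ?case by simp
next
  case (Suc n)
  have \<kappa>: "0 \<le> \<kappa>" "(cmod (d a))\<^sup>2 \<le> \<kappa>" for a
    unfolding \<kappa>_def by (auto intro: sum_nonneg member_le_sum)
  have pos: "0 \<le> \<rho> / j + \<kappa> / (real j)\<^sup>2" for j using \<rho> \<kappa>(1) by simp
  show ?case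
  proof (cases "Suc n \<le> k")
    case True
    have "0 \<le> (\<Sum>j<Suc n. \<rho> / j + \<kappa> / (real j)\<^sup>2)" by (intro sum_nonneg pos)
    then have "1 * coord_norm t \<le> exp (\<Sum>j<Suc n. \<rho> / j + \<kappa> / (real j)\<^sup>2) * coord_norm t"
      by (intro mult_right_mono coord_norm_nonneg) (simp only: one_le_exp_iff)
    then show ?thesis using True by simp
  next
    case False
    have step: "coord_norm (back_step B n t) \<le> exp (\<rho> / n + \<kappa> / (real n)\<^sup>2) * coord_norm t"
      unfolding coord_norm_def sum_distrib_left
    proof (rule sum_mono)
      fix a
      have "(cmod (1 + d a / of_nat n))\<^sup>2 \<le> exp (\<rho> / n + \<kappa> / (real n)\<^sup>2)"
      proof -
        have "(cmod (1 + d a / of_nat n))\<^sup>2 = 1 + 2 * Re (d a) / n + (cmod (d a))\<^sup>2 / (real n)\<^sup>2"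
          unfolding cmod_power2 by (cases "n = 0") (simp_all add: power2_eq_square field_simps)
        also have "\<dots> \<le> 1 + (\<rho> / n + \<kappa> / (real n)\<^sup>2)"
          using d[of a] \<kappa>(2)[of a] by (simp add: divide_right_mono add_mono)
        also have "\<dots> \<le> exp (\<rho> / n + \<kappa> / (real n)\<^sup>2)" by (rule exp_ge_add_one_self)
        finally show ?thesis .
      qed
      then show "(cmod (coord (back_step B n t) a))\<^sup>2 \<le> exp (\<rho> / n + \<kappa> / (real n)\<^sup>2) * (cmod (coord t a))\<^sup>2"
        by (simp add: coord_back_step norm_mult power_mult_distrib mult_right_mono)
    qed
    have "coord_norm (tback B (Suc n) k t) \<le> exp (\<Sum>j<n. \<rho> / j + \<kappa> / (real j)\<^sup>2) * coord_norm (back_step B n t)"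
      using False Suc by simp
    also have "\<dots> \<le> exp (\<Sum>j<n. \<rho> / j + \<kappa> / (real j)\<^sup>2) * (exp (\<rho> / n + \<kappa> / (real n)\<^sup>2) * coord_norm t)"
      by (intro mult_left_mono step) simp
    finally show ?thesis by (simp add: exp_add mult.assoc)
  qed
qed

text \<open>The harmonic part of the exponent is at most \<open>\<rho> * (1 + ln n)\<close> and
  becomes the power \<open>n powr \<rho>\<close>; the part with \<open>1 / j^2\<close> is summable
  and goes into the constant. The bound is uniform in \<open>k\<close>.\<close>

lemma tback_bound:
  assumes \<rho>: "0 \<le> \<rho>" and d: "\<And>a. 2 * Re (d a) \<le> \<rho>"
  obtains C where "\<And>n k t. 1 \<le> n \<Longrightarrow> (norm (tback B n k t))\<^sup>2 \<le> C * real n powr \<rho> * coord_norm t"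
proof -
  define \<kappa> where "\<kappa> = (\<Sum>a\<in>UNIV. (cmod (d a))\<^sup>2)"
  define K where "K = (\<Sum>a\<in>UNIV. \<Sum>b\<in>UNIV. cmod (gram a b))"
  define s where "s = (\<Sum>j. 1 / (real j)\<^sup>2)"
  have \<kappa>: "0 \<le> \<kappa>" and K: "0 \<le> K" by (auto simp: \<kappa>_def K_def intro!: sum_nonneg)
  have sq: "summable (\<lambda>j. 1 / (real j)\<^sup>2)"
    using inverse_power_summable[of 2, where 'a = real] by (simp add: inverse_eq_divide)
  have exponent: "(\<Sum>j<n. \<rho> / j + \<kappa> / (real j)\<^sup>2) \<le> \<rho> * (1 + ln n) + \<kappa> * s" if n: "1 \<le> n" for n
  proof -
    have "(\<Sum>j<n. 1 / real j) \<le> harm n"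
    proof -
      \<comment> \<open>The term for \<open>j = 0\<close> is \<open>1 / 0 = 0\<close>.\<close>
      have "(\<Sum>j<n. 1 / real j) = (\<Sum>j\<in>{1..<n}. 1 / real j)"
        by (rule sum.mono_neutral_right) auto
      also have "\<dots> \<le> (\<Sum>j\<in>{1..n}. 1 / real j)" by (rule sum_mono2) auto
      finally show ?thesis by (simp add: harm_def inverse_eq_divide)
    qed
    also have "harm n \<le> 1 + ln (real n)"
      using euler_mascheroni_sequence_decreasing[of 1 n] n by (simp add: harm_def)
    finally have "\<rho> * (\<Sum>j<n. 1 / real j) \<le> \<rho> * (1 + ln n)" using \<rho> by (rule mult_left_mono)
    moreover have "\<kappa> * (\<Sum>j<n. 1 / (real j)\<^sup>2) \<le> \<kappa> * s"
      unfolding s_def by (intro mult_left_mono \<kappa> sum_le_suminf sq) auto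
    ultimately show ?thesis by (simp add: sum.distrib sum_distrib_left)
  qed
  show ?thesis
  proof
    fix n k t assume n: "1 \<le> (n::nat)"
    have "(norm (tback B n k t))\<^sup>2 \<le> K * coord_norm (tback B n k t)"
      unfolding K_def by (rule norm_le_coord_norm)
    also have "\<dots> \<le> K * (exp (\<Sum>j<n. \<rho> / j + \<kappa> / (real j)\<^sup>2) * coord_norm t)"
      unfolding \<kappa>_def by (intro mult_left_mono coord_norm_tback assms K)
    also have "\<dots> \<le> K * (exp (\<rho> * (1 + ln n) + \<kappa> * s) * coord_norm t)"
      using exponent[OF n] by (intro mult_left_mono mult_right_mono coord_norm_nonneg K) auto
    also have "exp (\<rho> * (1 + ln n) + \<kappa> * s) = exp (\<rho> + \<kappa> * s) * real n powr \<rho>"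
      using n by (simp add: powr_def exp_add[symmetric] algebra_simps)
    finally show "(norm (tback B n k t))\<^sup>2 \<le> (K * exp (\<rho> + \<kappa> * s)) * real n powr \<rho> * coord_norm t"
      by (simp add: mult_ac)
  qed
qed

lemma gram_hermitian: "cnj (gram a b) = gram b a"
  by (simp add: gram_def mult.commute)

lemma transpose_of_hermitian:
  assumes M: "\<And>i j. of_real (M $ i $ j) = form (\<lambda>a. Q $ a $ i) h (\<lambda>b. Q $ b $ j)"
    and h: "\<And>a b. cnj (h a b) = h b a"
  shows "transpose M = (M :: real^'n^'n)"
proof -
  have "of_real (M $ j $ i) = cnj (of_real (M $ j $ i))" for i j by simp
  also have "cnj (of_real (M $ j $ i)) = (\<Sum>a\<in>UNIV. \<Sum>b\<in>UNIV. cnj (Q $ b $ i) * h b a * Q $ a $ j)" for i j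
    unfolding M by (simp add: h mult_ac)
  also have "(\<Sum>a\<in>UNIV. \<Sum>b\<in>UNIV. cnj (Q $ b $ i) * h b a * Q $ a $ j) = of_real (M $ i $ j)" for i j
    unfolding M by (rule sum.swap)
  finally show ?thesis by (simp add: vec_eq_iff transpose_def)
qed

end

subsection \<open>The one-step law of the process\<close>

lemma sum_PiE_insert:
  assumes "v \<notin> F"
  shows "(\<Sum>y\<in>Pi\<^sub>E (insert v F) B. f y) = (\<Sum>x\<in>B v. \<Sum>g\<in>Pi\<^sub>E F B. f (g(v := x)))"
  unfolding PiE_insert_eq sum.reindex[OF inj_combinator[OF assms]] sum.cartesian_product
  by (simp add: o_def case_prod_unfold)

lemma sum_PiE_prod:
  fixes f :: "'v \<Rightarrow> 'x \<Rightarrow> 'b::comm_semiring_1"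
  assumes "finite F"
  shows "(\<Sum>y\<in>Pi\<^sub>E F B. \<Prod>v\<in>F. f v (y v)) = (\<Prod>v\<in>F. \<Sum>x\<in>B v. f v x)"
  using assms
proof (induction F rule: finite_induct)
  case (insert v F)
  have "(\<Sum>y\<in>Pi\<^sub>E (insert v F) B. \<Prod>v\<in>insert v F. f v (y v))
      = (\<Sum>x\<in>B v. \<Sum>g\<in>Pi\<^sub>E F B. f v x * (\<Prod>v\<in>F. f v (g v)))"
    unfolding sum_PiE_insert[OF insert.hyps(2)]
    by (intro sum.cong refl) (use insert.hyps in \<open>auto intro!: arg_cong[where f = "(*) _"] prod.cong\<close>)
  then show ?case
    using insert by (simp add: sum_distrib_left[symmetric] sum_distrib_right)
qed simp

text \<open>Squared mean plus variance for a sum of independent signs with means \<open>m v\<close>,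
  as a purely algebraic identity. The offset \<open>a\<close> is general in the induction, since it
  absorbs each sign that has been drawn.\<close>

lemma sum_PiE_pm1_second_moment:
  fixes m t :: "'v \<Rightarrow> real"
  assumes "finite F"
  shows "(\<Sum>y\<in>F \<rightarrow>\<^sub>E {-1, 1::int}. (\<Prod>v\<in>F. (1 + real_of_int (y v) * m v) / 2) *
      (a + (\<Sum>v\<in>F. t v * real_of_int (y v)))\<^sup>2)
    = (a + (\<Sum>v\<in>F. t v * m v))\<^sup>2 + (\<Sum>v\<in>F. (t v)\<^sup>2 * (1 - (m v)\<^sup>2))"
  using assms
proof (induction F arbitrary: a rule: finite_induct)
  case empty
  then show ?case by simp
next
  case (insert v F)
  have *: "(\<Prod>w\<in>F. (1 + real_of_int ((g(v := x)) w) * m w) / 2) = (\<Prod>w\<in>F. (1 + real_of_int (g w) * m w) / 2)"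
    "(\<Sum>w\<in>F. t w * real_of_int ((g(v := x)) w)) = (\<Sum>w\<in>F. t w * real_of_int (g w))" for g x
    using insert.hyps by (auto intro!: prod.cong sum.cong)
  have "(\<Sum>y\<in>insert v F \<rightarrow>\<^sub>E {-1, 1::int}. (\<Prod>v\<in>insert v F. (1 + real_of_int (y v) * m v) / 2) *
        (a + (\<Sum>v\<in>insert v F. t v * real_of_int (y v)))\<^sup>2)
      = (\<Sum>x\<in>{-1, 1::int}. \<Sum>g\<in>F \<rightarrow>\<^sub>E {-1, 1::int}. (1 + real_of_int x * m v) / 2 *
          ((\<Prod>w\<in>F. (1 + real_of_int (g w) * m w) / 2) *
           ((a + t v * real_of_int x) + (\<Sum>w\<in>F. t w * real_of_int (g w)))\<^sup>2))"
    unfolding sum_PiE_insert[OF insert.hyps(2)] prod.insert[OF insert.hyps] sum.insert[OF insert.hyps] *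
    by (simp add: mult.assoc add.assoc)
  also have "\<dots> = (\<Sum>x\<in>{-1, 1::int}. (1 + real_of_int x * m v) / 2 *
      ((a + t v * real_of_int x + (\<Sum>v\<in>F. t v * m v))\<^sup>2 + (\<Sum>v\<in>F. (t v)\<^sup>2 * (1 - (m v)\<^sup>2))))"
    by (simp only: insert.IH flip: sum_distrib_left)
  also have "\<dots> = (a + (\<Sum>v\<in>insert v F. t v * m v))\<^sup>2 + (\<Sum>v\<in>insert v F. (t v)\<^sup>2 * (1 - (m v)\<^sup>2))"
    using insert.hyps by (simp add: field_simps power2_eq_square)
  finally show ?case .
qed

context ERWG
begin

abbreviation "X n v w \<equiv> erwg_X \<sigma> \<xi> D u w n v"
abbreviation "S \<equiv> erwg_S \<sigma> \<xi> D u"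
abbreviation "evs \<equiv> driver_events M \<sigma> \<xi> D u"
abbreviation "drivers \<equiv> range Init \<union> (\<Union>n\<in>{1..}. range (Sign n) \<union> range (Time n) \<union> range (Nbr n))"

text \<open>\<open>X n\<close> is built from the initial signs and the drivers with index below
  \<open>n\<close>; the drivers with index \<open>n\<close>, collected in
  \<open>present n v\<close>, produce \<open>X (n + 1)\<close>.\<close>

definition past :: "nat \<Rightarrow> 'v driver set" where
  "past n = range Init \<union> (\<Union>m\<in>{1..<n}. range (Sign m) \<union> range (Time m) \<union> range (Nbr m))"

definition present :: "nat \<Rightarrow> 'v \<Rightarrow> 'v driver set" where
  "present n v = {Sign n v, Time n v, Nbr n v}"

lemma in_past_iff [simp]:
  "Init v \<in> past n" "Sign m v \<in> past n \<longleftrightarrow> 1 \<le> m \<and> m < n"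
  "Time m v \<in> past n \<longleftrightarrow> 1 \<le> m \<and> m < n" "Nbr m v \<in> past n \<longleftrightarrow> 1 \<le> m \<and> m < n"
  by (auto simp: past_def image_iff)

lemma in_drivers_iff:
  "Init v \<in> drivers" "Sign m v \<in> drivers \<longleftrightarrow> 1 \<le> m"
  "Time m v \<in> drivers \<longleftrightarrow> 1 \<le> m" "Nbr m v \<in> drivers \<longleftrightarrow> 1 \<le> m"
  by (auto simp: image_iff)

abbreviation "gen I \<equiv> sigma (space M) (\<Union>i\<in>I. evs i)"

lemma in_nbrs: "finite (in_nbrs E v)" "in_nbrs E v \<noteq> {}"
  using in_deg_ge_1[of v] by (auto simp: in_deg_def)

lemma has_law_measurable: "has_law M Y P \<Longrightarrow> Y \<in> measurable M (count_space UNIV)"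
  by (simp add: has_law_def)

lemma has_law_prob: "has_law M Y P \<Longrightarrow> prob (Y -` A \<inter> space M) = measure (measure_pmf P) A"
  unfolding has_law_def by (metis UNIV_I measure_distr sets_count_space Pow_UNIV)

lemma has_law_prob_eq: "has_law M Y P \<Longrightarrow> prob (Y -` {a} \<inter> space M) = pmf P a"
  by (simp add: has_law_prob measure_pmf_single)

lemma has_law_AE:
  assumes "has_law M Y P"
  shows "AE w in M. Y w \<in> set_pmf P"
proof -
  have "AE x in distr M (count_space UNIV) Y. x \<in> set_pmf P"
    using assms AE_measure_pmf[of P] unfolding has_law_def by (elim conjE) (simp only:)
  then show ?thesis
    by (subst (asm) AE_distr_iff) (use has_law_measurable[OF assms] in auto)
qed

lemma Rad_AE:
  assumes "has_law M Y (Rad r)"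
  shows "AE w in M. Y w \<in> {-1, 1}"
  using has_law_AE[OF assms] by eventually_elim (auto simp: Rad_def)

lemma Rad_prob:
  fixes s :: int
  assumes "has_law M Y (Rad r)" "r \<in> {0..1}" "s \<in> {-1, 1}"
  shows "prob (Y -` {s} \<inter> space M) = (1 + real_of_int s * (2 * r - 1)) / 2"
proof -
  define f where "f b = (if b then 1 else - 1 :: int)" for b
  have "inj f" by (auto simp: inj_def f_def split: if_splits)
  then have "pmf (Rad r) (f b) = pmf (bernoulli_pmf r) b" for b
    unfolding Rad_def f_def[symmetric] by (rule pmf_map_inj')
  from this[of True] this[of False] show ?thesis
    using assms(2,3) unfolding has_law_prob_eq[OF assms(1)] by (auto simp: f_def)
qed

section \<open>Sigma-algebras generated by the drivers, and independence of past and present\<close>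

lemma evs_events: "i \<in> drivers \<Longrightarrow> evs i \<subseteq> events"
  using indep by (auto simp: indep_sets_def)

lemma evs_space: "evs i \<subseteq> Pow (space M)"
  by (cases i) auto

lemma Int_stable_vimages: "Int_stable {f -` A \<inter> \<Omega> | A. True}"
proof (rule Int_stableI)
  fix a b assume "a \<in> {f -` A \<inter> \<Omega> | A. True}" "b \<in> {f -` A \<inter> \<Omega> | A. True}"
  then obtain A B where "a = f -` A \<inter> \<Omega>" "b = f -` B \<inter> \<Omega>" by blast
  then have "a \<inter> b = f -` (A \<inter> B) \<inter> \<Omega>" by blast
  then show "a \<inter> b \<in> {f -` A \<inter> \<Omega> | A. True}" by blast
qed

lemma Int_stable_evs: "Int_stable (evs i)"
  by (cases i) (simp_all only: driver_events.simps Int_stable_vimages)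

lemma sets_gen: "sets (gen I) = sigma_sets (space M) (\<Union>i\<in>I. evs i)"
  using evs_space by (intro sets_measure_of) blast

lemma space_gen: "space (gen I) = space M"
  using evs_space by (intro space_measure_of) blast

lemma gen_measurable:
  assumes "\<And>A. f -` A \<inter> space M \<in> evs i" "i \<in> I"
  shows "f \<in> measurable (gen I) (count_space UNIV)"
  unfolding measurable_def sets_gen space_gen
  using assms by (auto intro!: sigma_sets.Basic)

lemma gen_events: "I \<subseteq> drivers \<Longrightarrow> sets (gen I) \<subseteq> events"
  unfolding sets_gen using evs_events by (intro sets.sigma_sets_subset) blast

lemma gen_measurable_M:
  assumes "f \<in> measurable (gen I) N" "I \<subseteq> drivers"
  shows "f \<in> measurable M N"
  using assms(1) gen_events[OF assms(2)] by (auto simp: measurable_def space_gen)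

lemma past_drivers: "past n \<subseteq> drivers"
  by (auto simp: past_def)

lemma present_drivers: "1 \<le> n \<Longrightarrow> present n v \<subseteq> drivers"
  unfolding present_def by (simp only: insert_subset in_drivers_iff empty_subsetI simp_thms)

text \<open>Strong induction, because a step may look back at any earlier time. The random time and
  neighbour take countably many values, so measurability is checked after fixing them.\<close>

lemma X_past: "j \<le> n \<Longrightarrow> X j v \<in> measurable (gen (past n)) (count_space UNIV)"
proof (induction j arbitrary: v rule: less_induct)
  case (less j)
  let ?M = "measurable (gen (past n)) (count_space UNIV)"
  consider "j = 0" | "j = Suc 0" | m where "j = Suc (Suc m)" by (metis not0_implies_Suc)
  then show ?case
  proof cases
    case 1
    then show ?thesis by simp
  next
    case 2
    have "\<sigma> v \<in> ?M"
      by (rule gen_measurable[of _ "Init v"]) auto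
    then show ?thesis using 2 by simp
  next
    case 3
    have \<xi>: "\<xi> (Suc m) v \<in> ?M"
      using less.prems 3 by (intro gen_measurable[of _ "Sign (Suc m) v"]) auto
    have D: "D (Suc m) v \<in> ?M"
      using less.prems 3 by (intro gen_measurable[of _ "Time (Suc m) v"]) auto
    have u: "u (Suc m) v \<in> ?M"
      using less.prems 3 by (intro gen_measurable[of _ "Nbr (Suc m) v"]) auto
    have "(\<lambda>w. if d \<le> Suc m then \<xi> (Suc m) v w * X d (u (Suc m) v w) w else 0)
        \<in> ?M" for d
    proof (cases "d \<le> Suc m")
      case True
      have "(\<lambda>w. X d (u (Suc m) v w) w) \<in> ?M"
        by (rule measurable_compose_countable[OF _ u]) (use True less 3 in auto)
      with \<xi> have "(\<lambda>w. \<xi> (Suc m) v w * X d (u (Suc m) v w) w) \<in> ?M"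
        by measurable
      then show ?thesis using True by simp
    qed simp
    then have "(\<lambda>w. if D (Suc m) v w \<le> Suc m then \<xi> (Suc m) v w * X (D (Suc m) v w) (u (Suc m) v w) w else 0)
        \<in> ?M"
      by (rule measurable_compose_countable[OF _ D])
    then show ?thesis using 3 by (simp add: Let_def)
  qed
qed

lemma X_measurable [measurable]: "X n v \<in> measurable M (count_space UNIV)"
  using X_past[of n n v] past_drivers gen_measurable_M by blast

lemma S_measurable [measurable]: "S n \<in> borel_measurable M"
proof -
  have "(\<lambda>w. \<chi> v. real_of_int (X j v w)) \<in> borel_measurable M" for j
    by (subst borel_measurable_euclidean_space) (auto simp: Basis_vec_def inner_axis)
  then show ?thesis unfolding erwg_S_def by measurable
qed

text \<open>The drivers are grouped into disjoint blocks: \<open>None\<close> stands for the whole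
  past and \<open>Some v\<close> for the three drivers of vertex \<open>v\<close> at time
  \<open>n\<close>. Grouping keeps independence because the generating families are stable under
  intersection.\<close>

lemma indep_past_present:
  assumes "1 \<le> n"
  shows "indep_sets (case_option (sets (gen (past n))) (\<lambda>v. sets (gen (present n v)))) UNIV"
proof -
  have "indep_sets (\<lambda>j. sigma_sets (space M) (\<Union>i\<in>case_option (past n) (present n) j. evs i)) UNIV"
  proof (rule indep_sets_collect_sigma)
    show "indep_sets evs (\<Union>j\<in>UNIV. case_option (past n) (present n) j)"
      by (rule indep_sets_mono_index[OF _ indep])
        (use past_drivers present_drivers[OF assms] in
          \<open>intro UN_least, simp split: option.split\<close>)
    show "disjoint_family_on (case_option (past n) (present n)) UNIV"
      by (auto simp: disjoint_family_on_def present_def split: option.splits)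
  qed (rule Int_stable_evs)
  also have "(\<lambda>j. sigma_sets (space M) (\<Union>i\<in>case_option (past n) (present n) j. evs i))
      = case_option (sets (gen (past n))) (\<lambda>v. sets (gen (present n v)))"
    by (auto simp: fun_eq_iff sets_gen split: option.splits)
  finally show ?thesis .
qed

lemma prob_past_present:
  assumes "1 \<le> n" "A \<in> sets (gen (past n))" "\<And>v. C v \<in> sets (gen (present n v))"
  shows "prob (A \<inter> (\<Inter>v. C v)) = prob A * (\<Prod>v\<in>UNIV. prob (C v))"
proof -
  have "prob (\<Inter>j\<in>UNIV. case_option A C j) = (\<Prod>j\<in>UNIV. prob (case_option A C j))"
    using assms by (intro indep_setsD[OF indep_past_present[OF assms(1)]]) (auto split: option.splits)
  then show ?thesis
    by (simp add: UNIV_option_conv prod.reindex)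
qed

section \<open>The conditional law of the next sign vector given the history\<close>

definition drift :: "nat \<Rightarrow> real^'v \<Rightarrow> 'v \<Rightarrow> real" where
  "drift n s v = (s v* memory_matrix E p) $ v / n"

text \<open>For reachable states, the conditional probability of the next sign vector
  \<open>y\<close> given \<open>S n = s\<close>: independent components, the one at \<open>v\<close>
  having mean \<open>drift n s v\<close>.\<close>

abbreviation weight :: "nat \<Rightarrow> real^'v \<Rightarrow> ('v \<Rightarrow> int) \<Rightarrow> real" where
  "weight n s y \<equiv> (\<Prod>v\<in>UNIV. (1 + real_of_int (y v) * drift n s v) / 2)"

text \<open>For a frozen history \<open>h\<close> the event is split according to the chosen time
  and in-neighbour. Averaging \<open>h\<close> uniformly over both replaces it by the partial sums
  of the in-neighbours divided by \<open>n\<close> times the in-degree, so the law of the next sign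
  depends on \<open>h\<close> only through \<open>s\<close>.\<close>

lemma present_prob:
  assumes n: "1 \<le> n" and h: "\<And>d w. 1 \<le> d \<Longrightarrow> d \<le> n \<Longrightarrow> h d w \<in> {-1, 1::int}" and y: "y \<in> {-1, 1}"
  defines "s \<equiv> (\<Sum>d=1..n. \<chi> w. real_of_int (h d w)) :: real^'v"
  shows "prob {w \<in> space M. D n v w \<le> n \<and> \<xi> n v w * h (D n v w) (u n v w) = y}
    = (1 + real_of_int y * drift n s v) / 2"
proof -
  note [measurable] = has_law_measurable[OF law_\<xi>[OF n]] has_law_measurable[OF law_D[OF n]]
    has_law_measurable[OF law_u[OF n]]
  define I where "I = {1..n} \<times> in_nbrs E v"
  let ?Q = "\<lambda>w. D n v w \<le> n \<and> \<xi> n v w * h (D n v w) (u n v w) = y"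
  \<comment> \<open>The equation for the sign of the step is solved by multiplying with
    \<open>h\<close>, which is its own inverse.\<close>
  let ?P = "\<lambda>i w. D n v w = fst i \<and> u n v w = snd i \<and> \<xi> n v w = y * h (fst i) (snd i)"
  have "prob {w \<in> space M. ?Q w} = (\<Sum>i\<in>I. prob {w \<in> space M. ?P i w})"
  proof (rule prob_sum)
    show "finite I" by (simp add: I_def in_nbrs)
    show "{w \<in> space M. ?P i w} \<in> events" for i by measurable
    have "(\<lambda>w. \<xi> n v w * h (D n v w) (u n v w)) \<in> measurable M (count_space UNIV)"
      by (rule measurable_compose_countable[where g = "\<lambda>w. (D n v w, u n v w)"
            and f = "\<lambda>i w. \<xi> n v w * h (fst i) (snd i)", simplified]) measurable
    then show "{w \<in> space M. ?Q w} \<in> events" by measurable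
    have "AE w in M. D n v w \<in> {1..n}" "AE w in M. u n v w \<in> in_nbrs E v" "AE w in M. \<xi> n v w \<in> {-1, 1}"
      using has_law_AE[OF law_D[OF n, of v]] has_law_AE[OF law_u[OF n, of v]] Rad_AE[OF law_\<xi>[OF n, of v]] n in_nbrs[of v]
      by (simp_all add: set_pmf_of_set)
    then show "AE w in M. (\<forall>i\<in>I. ?P i w \<longrightarrow> ?Q w) \<and> (?Q w \<longrightarrow> (\<exists>!i. i \<in> I \<and> ?P i w))"
    proof eventually_elim
      case (elim w)
      have hh: "h (D n v w) (u n v w) \<in> {-1, 1}" using h elim(1) by simp
      have "?Q w" if "i \<in> I" "?P i w" for i
        using that hh elim(1) y by auto
      moreover have "\<exists>!i. i \<in> I \<and> ?P i w" if "?Q w"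
        using that hh elim y by (intro ex1I[of _ "(D n v w, u n v w)"]) (auto simp: I_def)
      ultimately show ?case by blast
    qed
  qed
  also have "\<dots> = (\<Sum>i\<in>I. 1 / n * (1 / in_deg E v) * ((1 + real_of_int (y * h (fst i) (snd i)) * (2 * p v - 1)) / 2))"
  proof (intro sum.cong refl)
    fix i assume i: "i \<in> I"
    \<comment> \<open>One event for each of the three drivers; the default branch serves
      \<open>Sign\<close>.\<close>
    let ?A = "\<lambda>j. case j of
        Time _ _ \<Rightarrow> D n v -` {fst i} \<inter> space M | Nbr _ _ \<Rightarrow> u n v -` {snd i} \<inter> space M
      | _ \<Rightarrow> \<xi> n v -` {y * h (fst i) (snd i)} \<inter> space M"
    have "prob {w \<in> space M. ?P i w} = prob (\<Inter>j\<in>{Time n v, Nbr n v, Sign n v}. ?A j)"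
      by (rule arg_cong[where f = prob]) auto
    also have "\<dots> = (\<Prod>j\<in>{Time n v, Nbr n v, Sign n v}. prob (?A j))"
      using n by (intro indep_setsD[OF indep]) (auto simp: image_iff)
    also have "\<dots> = prob (D n v -` {fst i} \<inter> space M) * prob (u n v -` {snd i} \<inter> space M)
        * prob (\<xi> n v -` {y * h (fst i) (snd i)} \<inter> space M)"
      by simp
    also have "prob (D n v -` {fst i} \<inter> space M) = 1 / n"
      using i n by (auto simp: has_law_prob_eq[OF law_D] I_def)
    also have "prob (u n v -` {snd i} \<inter> space M) = 1 / in_deg E v"
      using i n by (auto simp: has_law_prob_eq[OF law_u] I_def in_nbrs in_deg_def)
    also have "prob (\<xi> n v -` {y * h (fst i) (snd i)} \<inter> space M)
        = (1 + real_of_int (y * h (fst i) (snd i)) * (2 * p v - 1)) / 2"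
    proof (intro Rad_prob law_\<xi> n p_range)
      have "1 \<le> fst i" "fst i \<le> n" using i by (auto simp: I_def)
      then show "y * h (fst i) (snd i) \<in> {-1, 1}" using h[of "fst i" "snd i"] y by auto
    qed
    finally show "prob {w \<in> space M. ?P i w} =
        1 / n * (1 / in_deg E v) * ((1 + real_of_int (y * h (fst i) (snd i)) * (2 * p v - 1)) / 2)" .
  qed
  also have "\<dots> = (1 / n * (1 / in_deg E v) / 2) * (\<Sum>i\<in>I. 1 + real_of_int (y * h (fst i) (snd i)) * (2 * p v - 1))"
    by (simp add: sum_distrib_left)
  also have "(\<Sum>i\<in>I. 1 + real_of_int (y * h (fst i) (snd i)) * (2 * p v - 1))
      = real n * in_deg E v + y * (2 * p v - 1) * (\<Sum>w\<in>in_nbrs E v. s $ w)"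
  proof -
    have "(\<Sum>w\<in>in_nbrs E v. s $ w) = (\<Sum>i\<in>I. real_of_int (h (fst i) (snd i)))"
      unfolding I_def s_def by (simp add: sum.cartesian_product' sum.swap[of _ "in_nbrs E v"])
    then show ?thesis
      by (simp add: sum.distrib I_def in_deg_def sum_distrib_left mult_ac)
  qed
  also have "(1 / n * (1 / in_deg E v) / 2) * (real n * in_deg E v + y * (2 * p v - 1) * (\<Sum>w\<in>in_nbrs E v. s $ w))
      = (1 + real_of_int y * ((\<Sum>w\<in>in_nbrs E v. s $ w) * ((2 * p v - 1) / in_deg E v) / n)) / 2"
    using n in_deg_ge_1[of v] by (simp add: field_simps)
  also have "(\<Sum>w\<in>in_nbrs E v. s $ w) * ((2 * p v - 1) / in_deg E v) = (s v* memory_matrix E p) $ v"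
    unfolding vector_matrix_mult_def memory_matrix_def vec_lambda_beta sum_distrib_right
    by (rule sum.mono_neutral_cong_left) (auto simp: in_nbrs_def)
  also have "\<dots> / n = drift n s v"
    by (simp add: drift_def)
  finally show ?thesis .
qed

text \<open>Almost sure only, since the laws fix the ranges of the drivers up to null sets;
  elsewhere the default value 0 can occur.\<close>

lemma X_pm1: "AE w in M. \<forall>j\<in>{1..n}. \<forall>v. X j v w \<in> {-1, 1}"
proof -
  have "AE w in M. \<forall>v. X (Suc j) v w \<in> {-1, 1}" for j
  proof (induction j rule: less_induct)
    case (less j)
    show ?case
    proof (cases j)
      case 0
      have "AE w in M. \<forall>v\<in>UNIV. \<sigma> v w \<in> {-1, 1}"
        by (rule AE_finite_allI[OF _ Rad_AE[OF law_\<sigma>]]) simp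
      then show ?thesis using 0 by simp
    next
      case (Suc m)
      have 1: "AE w in M. \<forall>v\<in>UNIV. \<xi> (Suc m) v w \<in> {-1, 1} \<and> D (Suc m) v w \<in> {1..Suc m}"
      proof (rule AE_finite_allI)
        fix v
        show "AE w in M. \<xi> (Suc m) v w \<in> {-1, 1} \<and> D (Suc m) v w \<in> {1..Suc m}"
          using Rad_AE[OF law_\<xi>[of "Suc m" v]] has_law_AE[OF law_D[of "Suc m" v]]
          by (simp add: set_pmf_of_set)
      qed simp
      have 2: "AE w in M. \<forall>i\<in>{..m}. \<forall>v. X (Suc i) v w \<in> {-1, 1}"
        by (rule AE_finite_allI) (use less Suc in auto)
      from 1 2 show ?thesis
      proof eventually_elim
        case (elim w)
        show ?case
        proof
          fix v
          have "D (Suc m) v w \<in> {1..Suc m}" "\<xi> (Suc m) v w \<in> {-1, 1}" using elim(1) by auto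
          moreover then have "X (D (Suc m) v w) (u (Suc m) v w) w \<in> {-1, 1}"
            using elim(2)[rule_format, of "D (Suc m) v w - 1" "u (Suc m) v w"] by auto
          ultimately show "X (Suc j) v w \<in> {-1, 1}" using Suc by (auto simp: Let_def)
        qed
      qed
    qed
  qed
  then have "AE w in M. \<forall>v. X j v w \<in> {-1, 1}" if "j \<in> {1..n}" for j
    using that by (cases j) auto
  then show ?thesis by (intro AE_finite_allI) auto
qed

lemma S_Suc: "S (Suc n) w = S n w + (\<chi> v. real_of_int (X (Suc n) v w))"
  by (simp add: erwg_S_def)

text \<open>The Markov property of \<open>S\<close> in integrated form. There are only finitely many
  sign histories, so conditioning reduces to finite sums of probabilities of events "history is
  \<open>h\<close> and next vector is \<open>y\<close>", and these factorise by independence of past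
  and present.\<close>

lemma expectation_step:
  fixes g :: "real^'v \<Rightarrow> ('v \<Rightarrow> int) \<Rightarrow> 'b::{banach,second_countable_topology}"
  assumes n: "1 \<le> n" and g: "\<And>y. (\<lambda>s. g s y) \<in> borel_measurable borel"
  shows "(\<integral>w. g (S n w) (\<lambda>v. X (Suc n) v w) \<partial>M) =
    (\<integral>w. (\<Sum>y\<in>UNIV \<rightarrow>\<^sub>E {-1, 1}. weight n (S n w) y *\<^sub>R g (S n w) y) \<partial>M)"
proof -
  \<comment> \<open>Histories are fixed to 0 outside \<open>{1..n}\<close>, which makes
    \<open>H\<close> finite, makes the history of an outcome unique, and agrees with the value 0 of
    \<open>X\<close> at time 0.\<close>
  define H where "H = {h :: nat \<Rightarrow> 'v \<Rightarrow> int. \<forall>j v. if j \<in> {1..n} then h j v \<in> {-1, 1} else h j v = 0}"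
  define Y where "Y = (UNIV :: 'v set) \<rightarrow>\<^sub>E {-1, 1 :: int}"
  define sv where "sv h = (\<Sum>d=1..n. \<chi> v. real_of_int (h d v))" for h :: "nat \<Rightarrow> 'v \<Rightarrow> int"
  define A where "A h = {w \<in> space M. \<forall>j\<in>{1..n}. \<forall>v. X j v w = h j v}" for h
  define C where "C y = {w \<in> space M. \<forall>v. X (Suc n) v w = y v}" for y
  define W where "W s y = (\<Prod>v\<in>UNIV. (1 + real_of_int (y v) * drift n s v) / 2)" for s and y :: "'v \<Rightarrow> int"
  let ?F = "\<lambda>w. \<Sum>h\<in>H. \<Sum>y\<in>Y. indicator (A h \<inter> C y) w *\<^sub>R g (sv h) y"
  let ?G = "\<lambda>h. \<Sum>y\<in>Y. W (sv h) y *\<^sub>R g (sv h) y"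
  have finH: "finite H"
  proof -
    have "H \<subseteq> (\<lambda>h j v. h (j, v)) ` PiE_dflt ({1..n} \<times> UNIV) 0 (\<lambda>_. {-1, 1})"
    proof
      fix h assume h: "h \<in> H"
      have "h a b \<in> {-1, 1}" if "a \<in> {1..n}" for a b
        using h that unfolding H_def mem_Collect_eq by metis
      moreover have "h a b = 0" if "a \<notin> {1..n}" for a b
        using h that unfolding H_def mem_Collect_eq by metis
      ultimately show "h \<in> (\<lambda>h j v. h (j, v)) ` PiE_dflt ({1..n} \<times> UNIV) 0 (\<lambda>_. {-1, 1})"
        by (intro image_eqI[of _ _ "\<lambda>(j, v). h j v"])
          (simp_all add: PiE_dflt_def)
    qed
    then show ?thesis by (rule finite_subset) (intro finite_imageI finite_PiE_dflt; simp)
  qed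
  have finY: "finite Y" by (auto simp: Y_def intro!: finite_PiE)
  have A_past: "A h \<in> sets (gen (past n))" for h
  proof -
    have "A h = space (gen (past n)) \<inter> (\<Inter>j\<in>{1..n}. \<Inter>v. X j v -` {h j v} \<inter> space (gen (past n)))"
      by (auto simp: A_def space_gen)
    also have "\<dots> \<in> sets (gen (past n))"
      using n by (intro sets.Int sets.top sets.finite_INT measurable_sets[OF X_past]) auto
    finally show ?thesis .
  qed
  have A_events [measurable]: "A h \<in> events" for h
    using A_past gen_events[OF past_drivers] by blast
  have C_events [measurable]: "C y \<in> events" for y
    unfolding C_def by measurable
  have prob: "prob (A h \<inter> C y) = prob (A h) * W (sv h) y" if h: "h \<in> H" and y: "y \<in> Y" for h y
  proof -
    define Z where "Z v = {w \<in> space M. D n v w \<le> n \<and> \<xi> n v w * h (D n v w) (u n v w) = y v}" for v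
    have y': "y v \<in> {-1, 1}" for v using y by (auto simp: Y_def)
    have h': "d \<le> n \<Longrightarrow> d \<noteq> 0 \<or> h d v = 0" for d v using h unfolding H_def by (cases d) (auto split: if_splits)
    have h0: "h 0 v = 0" for v using h unfolding H_def by (auto dest: spec[of _ 0])
    \<comment> \<open>Valid at every outcome in \<open>A h\<close>, not just almost surely: if the
      chosen time exceeds \<open>n\<close>, then \<open>X (Suc n) v w\<close> is 0 and differs from
      the sign \<open>y v\<close>; a chosen time 0 is covered by \<open>h0\<close>.\<close>
    have "X (Suc n) v w = y v \<longleftrightarrow> w \<in> Z v" if "w \<in> A h" for v w
    proof -
      obtain m where m: "n = Suc m" using n by (cases n) auto
      have "X d v' w = h d v'" if "d \<le> n" for d v'
        using that \<open>w \<in> A h\<close> h0 by (cases d) (auto simp: A_def)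
      moreover have "w \<in> space M" using that by (auto simp: A_def)
      ultimately show ?thesis using y'[of v] by (auto simp: m Z_def Let_def)
    qed
    then have "A h \<inter> C y = A h \<inter> (\<Inter>v. Z v)"
      by (auto simp: C_def A_def)
    moreover have "Z v \<in> sets (gen (present n v))" for v
    proof -
      let ?M = "measurable (gen (present n v)) (count_space UNIV)"
      have [measurable]: "\<xi> n v \<in> ?M"
        "D n v \<in> ?M"
        "u n v \<in> ?M"
        by (rule gen_measurable[of _ "Sign n v"] gen_measurable[of _ "Time n v"]
            gen_measurable[of _ "Nbr n v"]; auto simp: present_def)+
      have [measurable]: "(\<lambda>w. \<xi> n v w * h (D n v w) (u n v w)) \<in> ?M"
        by (rule measurable_compose_countable[where g = "\<lambda>w. (D n v w, u n v w)"
              and f = "\<lambda>i w. \<xi> n v w * h (fst i) (snd i)", simplified]) measurable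
      have "{w \<in> space (gen (present n v)). D n v w \<le> n \<and> \<xi> n v w * h (D n v w) (u n v w) = y v} \<in> sets (gen (present n v))"
        by measurable
      then show ?thesis by (simp only: Z_def space_gen)
    qed
    ultimately have "prob (A h \<inter> C y) = prob (A h) * (\<Prod>v\<in>UNIV. prob (Z v))"
      using prob_past_present[OF n A_past, of Z] by simp
    also have "(\<Prod>v\<in>UNIV. prob (Z v)) = W (sv h) y"
      unfolding W_def Z_def sv_def
      by (intro prod.cong refl present_prob n y') (use h in \<open>auto simp: H_def split: if_splits\<close>)
    finally show ?thesis .
  qed
  have hist: "\<exists>h\<in>H. w \<in> A h \<and> (\<forall>h'\<in>H. w \<in> A h' \<longrightarrow> h' = h) \<and> S n w = sv h"
    if "\<forall>j\<in>{1..n}. \<forall>v. X j v w \<in> {-1, 1}" "w \<in> space M" for w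
  proof (intro bexI[of _ "\<lambda>j v. if j \<in> {1..n} then X j v w else 0"] conjI ballI impI)
    fix h' assume "h' \<in> H" "w \<in> A h'"
    then show "h' = (\<lambda>j v. if j \<in> {1..n} then X j v w else 0)"
      unfolding fun_eq_iff A_def H_def by (auto split: if_splits)
  qed (use that in \<open>auto simp: H_def A_def sv_def erwg_S_def\<close>)
  have sumH: "(\<Sum>h\<in>H. indicator (A h) w *\<^sub>R F h) = F h"
    if "h \<in> H" "w \<in> A h" "\<forall>h'\<in>H. w \<in> A h' \<longrightarrow> h' = h" for F :: "_ \<Rightarrow> 'b" and h w
  proof -
    have "(\<Sum>h\<in>H. indicator (A h) w *\<^sub>R F h) = (\<Sum>h'\<in>H. if h' = h then F h' else 0)"
    proof (intro sum.cong refl)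
      fix h' assume "h' \<in> H"
      then have "w \<in> A h' \<longleftrightarrow> h' = h" using that(2,3) by blast
      then show "indicator (A h') w *\<^sub>R F h' = (if h' = h then F h' else 0)"
        by (cases "h' = h") simp_all
    qed
    then show ?thesis using finH that(1) by (simp only: sum.delta if_True)
  qed
  \<comment> \<open>Integer vectors over a finite index type form a countable type, so singletons
    suffice.\<close>
  have [measurable]: "(\<lambda>w v. X (Suc n) v w) \<in> measurable M (count_space UNIV)"
  proof (subst measurable_count_space_eq_countable[OF countableI_type], intro conjI ballI)
    fix y
    have "(\<lambda>w v. X (Suc n) v w) -` {y} \<inter> space M = C y" by (auto simp: C_def)
    then show "(\<lambda>w v. X (Suc n) v w) -` {y} \<inter> space M \<in> events" by simp
  qed auto
  note [measurable] = g
  have "(\<lambda>w. g (S n w) (\<lambda>v. X (Suc n) v w)) \<in> borel_measurable M"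
    by (rule measurable_compose_countable[where g = "\<lambda>w v. X (Suc n) v w" and f = "\<lambda>y w. g (S n w) y"]) measurable
  then have "(\<integral>w. g (S n w) (\<lambda>v. X (Suc n) v w) \<partial>M)
      = (\<integral>w. ?F w \<partial>M)"
  proof (rule integral_cong_AE)
    show "AE w in M. g (S n w) (\<lambda>v. X (Suc n) v w) = ?F w"
      using X_pm1[of "Suc n"] AE_space
    proof eventually_elim
      case (elim w)
      then obtain h where h: "h \<in> H" "w \<in> A h" "\<forall>h'\<in>H. w \<in> A h' \<longrightarrow> h' = h" "S n w = sv h"
        using hist[of w] by (metis atLeastAtMost_iff le_SucI)
      define y where "y v = X (Suc n) v w" for v
      have "\<forall>v. X (Suc n) v w \<in> {-1, 1}" using elim(1) by (rule bspec) simp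
      then have y: "y \<in> Y" unfolding Y_def y_def PiE_UNIV_domain by blast
      have "?F w
          = (\<Sum>h\<in>H. indicator (A h) w *\<^sub>R (\<Sum>y\<in>Y. indicator (C y) w *\<^sub>R g (sv h) y))"
        by (simp add: indicator_inter_arith scaleR_sum_right)
      also have "\<dots> = (\<Sum>z\<in>Y. indicator (C z) w *\<^sub>R g (sv h) z)" by (rule sumH[OF h(1-3)])
      also have "\<dots> = (\<Sum>z\<in>Y. if z = y then g (sv h) z else 0)"
        using elim(2) by (intro sum.cong) (auto simp: indicator_def C_def y_def)
      also have "\<dots> = g (sv h) y" using finY y by simp
      finally have "?F w = g (sv h) y" .
      moreover have "(\<lambda>v. X (Suc n) v w) = y" by (simp add: y_def fun_eq_iff)
      ultimately show ?case using h(4) by simp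
    qed
  qed measurable
  also have "\<dots> = (\<Sum>h\<in>H. \<Sum>y\<in>Y. prob (A h \<inter> C y) *\<^sub>R g (sv h) y)"
    by (simp add: Bochner_Integration.integral_sum emeasure_eq_measure)
  also have "\<dots> = (\<Sum>h\<in>H. prob (A h) *\<^sub>R ?G h)"
    by (simp add: prob scaleR_sum_right)
  also have "\<dots> = (\<integral>w. (\<Sum>h\<in>H. indicator (A h) w *\<^sub>R ?G h) \<partial>M)"
    by (simp add: Bochner_Integration.integral_sum emeasure_eq_measure)
  also have "\<dots> = (\<integral>w. (\<Sum>y\<in>Y. W (S n w) y *\<^sub>R g (S n w) y) \<partial>M)"
  proof (rule integral_cong_AE)
    have [measurable]: "(\<lambda>s. drift n s v) \<in> borel_measurable borel" for v
      unfolding drift_def vector_matrix_mult_def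
      by (auto intro!: borel_measurable_continuous_onI continuous_intros)
    show "(\<lambda>w. \<Sum>y\<in>Y. W (S n w) y *\<^sub>R g (S n w) y) \<in> borel_measurable M"
      unfolding W_def by measurable
    show "AE w in M. (\<Sum>h\<in>H. indicator (A h) w *\<^sub>R ?G h) =
        (\<Sum>y\<in>Y. W (S n w) y *\<^sub>R g (S n w) y)"
      using X_pm1[of n] AE_space
    proof eventually_elim
      case (elim w)
      then obtain h where h: "h \<in> H" "w \<in> A h" "\<forall>h'\<in>H. w \<in> A h' \<longrightarrow> h' = h" "S n w = sv h"
        using hist[of w] by blast
      show ?case by (simp only: sumH[OF h(1-3)] h(4))
    qed
  qed measurable
  finally show ?thesis by (simp add: W_def Y_def)
qed

end

subsection \<open>One step of the characteristic function\<close>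

text \<open>The first term is the characteristic function at \<tau> of a sign with mean
  \<open>m\<close>, the second that of a normal law with mean \<open>m\<close> and variance 1. The
  true variance is \<open>1 - m^2\<close>, and the discrepancy is the term
  \<open>m^2 \<tau>^2\<close> of the bound; it also dominates the square of the linear term in the
  Taylor remainder.\<close>

lemma cmod_rademacher_chf_le:
  fixes \<tau> m :: real
  assumes "\<bar>\<tau>\<bar> \<le> 1" "\<bar>m\<bar> \<le> 1"
  shows "cmod (Complex (cos \<tau>) (m * sin \<tau>) - exp (Complex (- \<tau>\<^sup>2 / 2) (m * \<tau>))) \<le> 3 * (\<bar>\<tau>\<bar> ^ 3 + m\<^sup>2 * \<tau>\<^sup>2)"
proof -
  have sin3: "\<bar>sin x - x\<bar> \<le> \<bar>x\<bar> ^ 3 / 6" for x :: real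
    using Maclaurin_sin_bound[of x 3] by (simp add: sin_coeff_def eval_nat_numeral)
  have cos4: "\<bar>cos \<tau> - (1 - \<tau>\<^sup>2 / 2)\<bar> \<le> \<bar>\<tau>\<bar> ^ 3 / 2"
  proof -
    \<comment> \<open>The half-angle form of \<open>1 - cos \<tau>\<close> makes the remainder a
      difference of two squares, so the cubic bound for the sine can be reused.\<close>
    have "cos \<tau> - (1 - \<tau>\<^sup>2 / 2) = 2 * ((\<tau>/2 - sin (\<tau>/2)) * (\<tau>/2 + sin (\<tau>/2)))"
      using cos_double_sin[of "\<tau>/2"] by (simp add: field_simps power2_eq_square)
    also have "\<bar>\<dots>\<bar> = 2 * (\<bar>\<tau>/2 - sin (\<tau>/2)\<bar> * \<bar>\<tau>/2 + sin (\<tau>/2)\<bar>)"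
      by (simp add: abs_mult)
    also have "\<dots> \<le> 2 * (\<bar>\<tau>/2\<bar> ^ 3 / 6 * (1/2 + 1))"
    proof (intro mult_left_mono mult_mono)
      show "\<bar>\<tau>/2 - sin (\<tau>/2)\<bar> \<le> \<bar>\<tau>/2\<bar> ^ 3 / 6"
        using sin3[of "\<tau>/2"] by (simp add: abs_minus_commute)
      show "\<bar>\<tau>/2 + sin (\<tau>/2)\<bar> \<le> 1/2 + 1"
        using assms(1) abs_sin_le_one[of "\<tau>/2"] abs_triangle_ineq[of "\<tau>/2" "sin (\<tau>/2)"] by linarith
    qed auto
    also have "\<dots> \<le> \<bar>\<tau>\<bar> ^ 3 / 2" by (simp add: power_divide)
    finally show ?thesis .
  qed
  define z where "z = Complex (- \<tau>\<^sup>2 / 2) (m * \<tau>)"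
  have \<tau>2: "\<tau>\<^sup>2 \<le> 1" using assms(1) by (simp add: abs_square_le_1)
  have "cmod (exp z - (1 + z)) \<le> exp \<bar>Re z\<bar> * cmod z ^ 2"
    using Taylor_exp[of z 1] by (simp add: power2_eq_square)
  also have "\<dots> \<le> 2 * cmod z ^ 2"
  proof (intro mult_right_mono)
    have "exp \<bar>Re z\<bar> \<le> exp (1/2)" using \<tau>2 by (simp add: z_def)
    also have "\<dots> \<le> (2::real)"
      using exp_bound_half[of "1/2 :: real"] by simp
    finally show "exp \<bar>Re z\<bar> \<le> 2" .
  qed simp
  also have "cmod z ^ 2 = (\<tau>\<^sup>2)\<^sup>2 / 4 + m\<^sup>2 * \<tau>\<^sup>2"
    by (simp add: z_def cmod_power2 power_divide power_mult_distrib)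
  also have "(\<tau>\<^sup>2)\<^sup>2 \<le> \<bar>\<tau>\<bar> ^ 3"
    using power_decreasing[of 3 4 "\<bar>\<tau>\<bar>"] assms(1) by simp
  finally have expz: "cmod (exp z - (1 + z)) \<le> \<bar>\<tau>\<bar> ^ 3 / 2 + 2 * (m\<^sup>2 * \<tau>\<^sup>2)" by simp
  have "Complex (cos \<tau>) (m * sin \<tau>) - exp z
      = of_real (cos \<tau> - (1 - \<tau>\<^sup>2 / 2)) + \<i> * of_real (m * (sin \<tau> - \<tau>)) - (exp z - (1 + z))"
    by (simp add: z_def complex_eq_iff algebra_simps)
  also have "cmod \<dots> \<le> cmod (of_real (cos \<tau> - (1 - \<tau>\<^sup>2 / 2))) + cmod (\<i> * of_real (m * (sin \<tau> - \<tau>)))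
      + cmod (exp z - (1 + z))"
    by (intro order_trans[OF norm_triangle_ineq4] add_right_mono norm_triangle_ineq)
  also have "cmod (of_real (cos \<tau> - (1 - \<tau>\<^sup>2 / 2))) \<le> \<bar>\<tau>\<bar> ^ 3 / 2"
    using cos4 by (simp only: norm_of_real)
  also have "cmod (\<i> * of_real (m * (sin \<tau> - \<tau>))) \<le> \<bar>\<tau>\<bar> ^ 3 / 6"
  proof -
    have "cmod (\<i> * of_real (m * (sin \<tau> - \<tau>))) = \<bar>m\<bar> * \<bar>sin \<tau> - \<tau>\<bar>"
      by (simp only: norm_mult norm_ii norm_of_real abs_mult mult_1)
    also have "\<dots> \<le> 1 * (\<bar>\<tau>\<bar> ^ 3 / 6)" using assms sin3 by (intro mult_mono) auto
    finally show ?thesis by simp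
  qed
  also note expz
  finally have "cmod (Complex (cos \<tau>) (m * sin \<tau>) - exp z)
      \<le> \<bar>\<tau>\<bar> ^ 3 / 2 + \<bar>\<tau>\<bar> ^ 3 / 6 + (\<bar>\<tau>\<bar> ^ 3 / 2 + 2 * (m\<^sup>2 * \<tau>\<^sup>2))" by simp
  also have "\<dots> \<le> 3 * (\<bar>\<tau>\<bar> ^ 3 + m\<^sup>2 * \<tau>\<^sup>2)"
    using zero_le_power[of "\<bar>\<tau>\<bar>" 3] zero_le_mult_iff[of "m\<^sup>2" "\<tau>\<^sup>2"] by auto
  finally show ?thesis unfolding z_def .
qed

lemma cmod_cis_minus_one_le: "cmod (cis x - 1) \<le> \<bar>x\<bar>"
  using iexp_approx1[of x 0] by (simp add: cis_conv_exp)

lemma norm_integral_le_AE: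
  fixes f :: "_ \<Rightarrow> 'b::{banach,second_countable_topology}"
  assumes "AE w in M. norm (f w) \<le> g w" "integrable M f" "integrable M g"
  shows "norm (\<integral>w. f w \<partial>M) \<le> (\<integral>w. g w \<partial>M)"
  by (rule order_trans[OF integral_norm_bound integral_mono_AE[OF integrable_norm[OF assms(2)] assms(3,1)]])

context ERWG
begin

abbreviation "B \<equiv> memory_matrix E p"

definition \<phi> :: "nat \<Rightarrow> real^'v \<Rightarrow> complex" where
  "\<phi> n t = (\<integral>w. cis (t \<bullet> S n w) \<partial>M)"

definition q2 :: "nat \<Rightarrow> real^'v \<Rightarrow> real" where
  "q2 n t = (\<integral>w. (t \<bullet> S n w)\<^sup>2 \<partial>M)"

abbreviation "bstep \<equiv> back_step B"

lemma drift_eq_inner: "drift n s v = (column v B \<bullet> s) / n"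
  by (simp add: drift_def vector_matrix_mult_def inner_vec_def column_def mult.commute)

lemma sum_drift: "(\<Sum>v\<in>UNIV. t $ v * drift n s v) = ((1 / n) *\<^sub>R (B *v t)) \<bullet> s"
proof -
  have "(\<Sum>v\<in>UNIV. t $ v * drift n s v) = (\<Sum>v\<in>UNIV. t $ v * (column v B \<bullet> s)) / n"
    by (simp add: drift_eq_inner sum_divide_distrib)
  also have "(\<Sum>v\<in>UNIV. t $ v * (column v B \<bullet> s)) = (B *v t) \<bullet> s"
    by (simp add: matrix_mult_sum inner_sum_left scalar_mult_eq_scaleR)
  finally show ?thesis by simp
qed

lemma inner_bstep: "bstep n t \<bullet> s = t \<bullet> s + (\<Sum>v\<in>UNIV. t $ v * drift n s v)"
  unfolding sum_drift back_step_def inner_add_left ..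

lemma inner_S_Suc: "t \<bullet> S (Suc n) w = t \<bullet> S n w + (\<Sum>v\<in>UNIV. t $ v * real_of_int (X (Suc n) v w))"
  by (simp add: S_Suc inner_add_right) (simp add: inner_vec_def)

lemma S_bound: "AE w in M. \<forall>v. \<bar>S n w $ v\<bar> \<le> n"
  using X_pm1[of n]
proof eventually_elim
  case (elim w)
  show ?case
  proof
    fix v
    have "\<bar>S n w $ v\<bar> \<le> (\<Sum>j=1..n. \<bar>real_of_int (X j v w)\<bar>)"
      by (simp add: erwg_S_def sum_abs)
    also have "\<dots> \<le> (\<Sum>j=1..n. 1)"
    proof (rule sum_mono)
      fix j assume "j \<in> {1..n}"
      then have "X j v w \<in> {-1, 1}" using elim by blast
      then show "\<bar>real_of_int (X j v w)\<bar> \<le> 1" by auto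
    qed
    finally show "\<bar>S n w $ v\<bar> \<le> n" by simp
  qed
qed

lemma drift_bound: "AE w in M. \<forall>v. \<bar>drift n (S n w) v\<bar> \<le> 1"
  using S_bound[of n]
proof eventually_elim
  case (elim w)
  show ?case
  proof
    fix v
    have "\<bar>(S n w v* B) $ v\<bar> \<le> (\<Sum>i\<in>UNIV. \<bar>B $ i $ v\<bar> * \<bar>S n w $ i\<bar>)"
      by (simp add: vector_matrix_mult_def mult.commute sum_abs flip: abs_mult)
    also have "\<dots> \<le> (\<Sum>i\<in>UNIV. \<bar>B $ i $ v\<bar> * n)" using elim by (intro sum_mono mult_left_mono) auto
    also have "(\<Sum>i\<in>UNIV. \<bar>B $ i $ v\<bar> * n) = (\<Sum>i\<in>in_nbrs E v. \<bar>2 * p v - 1\<bar> / in_deg E v) * n"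
      unfolding sum_distrib_right[symmetric]
      by (intro arg_cong[where f = "\<lambda>x. x * _"] sum.mono_neutral_cong_right)
        (auto simp: memory_matrix_def in_nbrs_def)
    also have "\<dots> = \<bar>2 * p v - 1\<bar> * n"
      using in_nbrs[of v] by (simp add: in_deg_def)
    also have "\<dots> \<le> 1 * real n" using p_range[of v] by (intro mult_right_mono) auto
    finally show "\<bar>drift n (S n w) v\<bar> \<le> 1"
      by (cases "n = 0") (simp_all add: drift_def)
  qed
qed

lemma inner_S_bound: "AE w in M. \<bar>t \<bullet> S n w\<bar> \<le> CARD('v) * norm t * n"
  using S_bound[of n]
proof eventually_elim
  case (elim w)
  have "\<bar>t \<bullet> S n w\<bar> \<le> (\<Sum>v\<in>UNIV. \<bar>t $ v\<bar> * \<bar>S n w $ v\<bar>)"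
    by (simp add: inner_vec_def sum_abs flip: abs_mult)
  also have "\<dots> \<le> (\<Sum>v\<in>(UNIV::'v set). norm t * n)"
    using elim by (intro sum_mono mult_mono component_le_norm_cart) auto
  finally show ?case by simp
qed

lemma integrable_inner_S_sq: "integrable M (\<lambda>w. (t \<bullet> S n w)\<^sup>2)"
proof (rule integrable_const_bound[where B = "(CARD('v) * norm t * n)\<^sup>2"])
  show "AE w in M. norm ((t \<bullet> S n w)\<^sup>2) \<le> (CARD('v) * norm t * n)\<^sup>2"
    using inner_S_bound[of t n]
  proof eventually_elim
    case (elim w)
    have "(t \<bullet> S n w)\<^sup>2 = \<bar>t \<bullet> S n w\<bar>\<^sup>2" by simp
    also have "\<dots> \<le> (CARD('v) * norm t * n)\<^sup>2" using elim by (intro power_mono) auto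
    finally show ?case by simp
  qed
qed measurable

lemma integrable_cis_S: "integrable M (\<lambda>w. cis (t \<bullet> S n w))"
  by (rule integrable_const_bound[where B = 1]) (simp_all add: cis_conv_exp)

lemma integrable_drift_sq: "integrable M (\<lambda>w. (drift n (S n w) v)\<^sup>2)"
  unfolding drift_eq_inner power_divide by (intro integrable_divide integrable_inner_S_sq)

lemma drift_measurable [measurable]: "(\<lambda>s. drift n s v) \<in> borel_measurable borel"
  unfolding drift_eq_inner by measurable

text \<open>The conditional variance \<open>1 - drift^2\<close> of each component is bounded by 1.
  What remains is the recursion satisfied by \<open>Wsum\<close>, as an inequality.\<close>

lemma q2_step:
  assumes n: "1 \<le> n"
  shows "q2 (Suc n) t \<le> q2 n (bstep n t) + (norm t)\<^sup>2"
proof -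
  have "q2 (Suc n) t = (\<integral>w. (t \<bullet> S n w + (\<Sum>v\<in>UNIV. t $ v * real_of_int (X (Suc n) v w)))\<^sup>2 \<partial>M)"
    by (simp only: q2_def inner_S_Suc)
  also have "\<dots> = (\<integral>w. (\<Sum>y\<in>UNIV \<rightarrow>\<^sub>E {-1, 1}. weight n (S n w) y *\<^sub>R
      (t \<bullet> S n w + (\<Sum>v\<in>UNIV. t $ v * real_of_int (y v)))\<^sup>2) \<partial>M)"
    by (rule expectation_step[OF n]) measurable
  also have "\<dots> = (\<integral>w. (bstep n t \<bullet> S n w)\<^sup>2 + (\<Sum>v\<in>UNIV. (t $ v)\<^sup>2 * (1 - (drift n (S n w) v)\<^sup>2)) \<partial>M)"
    by (simp add: sum_PiE_pm1_second_moment inner_bstep)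
  also have "\<dots> \<le> (\<integral>w. (bstep n t \<bullet> S n w)\<^sup>2 + (norm t)\<^sup>2 \<partial>M)"
  proof (rule integral_mono)
    fix w
    have "(\<Sum>v\<in>UNIV. (t $ v)\<^sup>2 * (1 - (drift n (S n w) v)\<^sup>2)) \<le> (\<Sum>v\<in>UNIV. (t $ v)\<^sup>2 * 1)"
      by (intro sum_mono mult_left_mono) auto
    also have "\<dots> = (norm t)\<^sup>2"
      by (simp add: norm_vec_def L2_set_def sum_nonneg)
    finally show "(bstep n t \<bullet> S n w)\<^sup>2 + (\<Sum>v\<in>UNIV. (t $ v)\<^sup>2 * (1 - (drift n (S n w) v)\<^sup>2))
        \<le> (bstep n t \<bullet> S n w)\<^sup>2 + (norm t)\<^sup>2" by simp
  qed (intro Bochner_Integration.integrable_add Bochner_Integration.integrable_sum integrable_mult_right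
      Bochner_Integration.integrable_diff integrable_inner_S_sq integrable_drift_sq integrable_const)+
  also have "\<dots> = q2 n (bstep n t) + (norm t)\<^sup>2"
    by (simp add: q2_def integrable_inner_S_sq prob_space)
  finally show ?thesis .
qed

lemma q2_1: "q2 1 t \<le> (CARD('v))\<^sup>2 * (norm t)\<^sup>2"
proof -
  have "q2 1 t \<le> (\<integral>w. (CARD('v) * norm t * 1)\<^sup>2 \<partial>M)"
    unfolding q2_def
  proof (rule integral_mono_AE)
    show "AE w in M. (t \<bullet> S 1 w)\<^sup>2 \<le> (CARD('v) * norm t * 1)\<^sup>2"
      using inner_S_bound[of t 1]
    proof eventually_elim
      case (elim w)
      then have "\<bar>t \<bullet> S 1 w\<bar>\<^sup>2 \<le> (CARD('v) * norm t * 1)\<^sup>2" by (intro power_mono) auto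
      then show ?case by simp
    qed
  qed (auto intro: integrable_inner_S_sq)
  then show ?thesis by (simp add: prob_space power_mult_distrib)
qed

abbreviation gauss :: "real^'v \<Rightarrow> complex" where
  "gauss t \<equiv> exp (- of_real ((norm t)\<^sup>2 / 2))"

text \<open>The initial signs need not be centred, so the error is linear in \<open>t\<close>. Being
  committed at a single time, it vanishes with the norm of the transported vector.\<close>

lemma \<phi>_1:
  assumes "norm t \<le> 1"
  shows "cmod (\<phi> 1 t - gauss t) \<le> 2 * CARD('v) * norm t"
proof -
  have "cmod (\<phi> 1 t - 1) = cmod (\<integral>w. cis (t \<bullet> S 1 w) - 1 \<partial>M)"
    using integrable_cis_S[of t 1] by (simp add: \<phi>_def prob_space)
  also have "\<dots> \<le> (\<integral>w. CARD('v) * norm t * 1 \<partial>M)"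
  proof (rule norm_integral_le_AE)
    show "AE w in M. cmod (cis (t \<bullet> S 1 w) - 1) \<le> CARD('v) * norm t * 1"
      using inner_S_bound[of t 1]
      by eventually_elim (use cmod_cis_minus_one_le order_trans in fastforce)
  qed (auto intro: Bochner_Integration.integrable_diff integrable_cis_S)
  also have "\<dots> = CARD('v) * norm t" by (simp add: prob_space)
  finally have 1: "cmod (\<phi> 1 t - 1) \<le> CARD('v) * norm t" .
  have "cmod (gauss t - 1) = \<bar>exp (- (norm t)\<^sup>2 / 2) - 1\<bar>"
  proof -
    have "exp (- complex_of_real a) - 1 = of_real (exp (- a) - 1)" for a
      by (simp flip: exp_of_real)
    then show ?thesis by (simp only: norm_of_real minus_divide_left)
  qed
  also have "\<dots> \<le> (norm t)\<^sup>2 / 2"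
    using exp_ge_add_one_self[of "- (norm t)\<^sup>2 / 2"] by (simp add: abs_if)
  also have "\<dots> \<le> 1 * norm t"
    using assms mult_right_mono[of "norm t" 2 "norm t"] by (simp add: power2_eq_square mult.commute)
  also have "\<dots> \<le> CARD('v) * norm t"
    by (rule mult_right_mono) (use one_le_card_finite[where 'a = 'v] in linarith, simp)
  finally have 2: "cmod (gauss t - 1) \<le> CARD('v) * norm t" .
  show ?thesis
    using norm_triangle_ineq4[of "\<phi> 1 t - 1" "gauss t - 1"] 1 2
    by simp
qed

text \<open>Conditionally on \<open>S n\<close> the step contributes a product over the vertices.
  All factors, and the normal ones replacing them, have modulus at most 1, so the errors of the
  factors add up; integrating the squared drifts produces the second moments.\<close>

lemma \<phi>_step:
  assumes n: "1 \<le> n" and t: "norm t \<le> 1"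
  shows "cmod (\<phi> (Suc n) t - gauss t * \<phi> n (bstep n t))
    \<le> 3 * (CARD('v) * norm t ^ 3 + (norm t)\<^sup>2 * (\<Sum>v\<in>UNIV. q2 n (column v B) / (real n)\<^sup>2))"
proof -
  let ?s = "\<lambda>w. (\<Sum>y\<in>UNIV \<rightarrow>\<^sub>E {-1, 1}. weight n (S n w) y *\<^sub>R
      (cis (t \<bullet> S n w) * (\<Prod>v\<in>UNIV. cis (t $ v * real_of_int (y v)))))"
  let ?u = "\<lambda>s. 3 * (CARD('v) * norm t ^ 3 + (norm t)\<^sup>2 * (\<Sum>v\<in>UNIV. (drift n s v)\<^sup>2))"
  define e where "e = (\<lambda>s v. exp (Complex (- (t $ v)\<^sup>2 / 2) (drift n s v * t $ v)))"
  define c where "c = (\<lambda>s v. Complex (cos (t $ v)) (drift n s v * sin (t $ v)))"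
  let ?c = "\<lambda>s. cis (t \<bullet> s) * (\<Prod>v\<in>UNIV. c s v)"
  let ?e = "\<lambda>s. cis (t \<bullet> s) * (\<Prod>v\<in>UNIV. e s v)"
  have "\<phi> (Suc n) t = (\<integral>w. cis (t \<bullet> S n w) * (\<Prod>v\<in>UNIV. cis (t $ v * real_of_int (X (Suc n) v w))) \<partial>M)"
    unfolding \<phi>_def inner_S_Suc cis_mult[symmetric]
    by (simp add: cis_conv_exp exp_sum sum_distrib_left)
  also have "\<dots> = (\<integral>w. ?s w \<partial>M)"
    by (rule expectation_step[OF n]) (simp add: cis_conv_exp)
  also have "\<dots> = (\<integral>w. ?c (S n w) \<partial>M)"
  proof (intro Bochner_Integration.integral_cong refl)
    fix w
    have "?s w
      = cis (t \<bullet> S n w) * (\<Sum>y\<in>UNIV \<rightarrow>\<^sub>E {-1, 1}. \<Prod>v\<in>UNIV.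
          (of_real ((1 + real_of_int (y v) * drift n (S n w) v) / 2) * cis (t $ v * real_of_int (y v))))"
      by (simp add: scaleR_conv_of_real prod.distrib sum_distrib_left mult.left_commute of_real_prod
          del: of_real_add of_real_divide of_real_mult)
    also have "(\<Sum>y\<in>UNIV \<rightarrow>\<^sub>E {-1, 1}. \<Prod>v\<in>UNIV.
          (of_real ((1 + real_of_int (y v) * drift n (S n w) v) / 2) * cis (t $ v * real_of_int (y v))))
        = (\<Prod>v\<in>UNIV. \<Sum>x\<in>{-1, 1::int}. of_real ((1 + real_of_int x * drift n (S n w) v) / 2)
            * cis (t $ v * real_of_int x))"
      by (rule sum_PiE_prod) simp
    also have "\<dots> = (\<Prod>v\<in>UNIV. c (S n w) v)"
      by (intro prod.cong refl) (simp add: c_def complex_eq_iff field_simps)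
    finally show "?s w
      = ?c (S n w)" .
  qed
  finally have lhs: "\<phi> (Suc n) t = (\<integral>w. ?c (S n w) \<partial>M)" .
  \<comment> \<open>The phases of the normal factors sum to the inner product with the drift, which
    completes \<open>t\<close> to the transported vector.\<close>
  have prod_e: "?e s = gauss t * cis (bstep n t \<bullet> s)" for s
  proof -
    have "(\<Sum>v\<in>UNIV. Complex (- (t $ v)\<^sup>2 / 2) (drift n s v * t $ v))
        = - of_real ((norm t)\<^sup>2 / 2) + \<i> * of_real (\<Sum>v\<in>UNIV. t $ v * drift n s v)"
      by (simp add: complex_eq_iff norm_vec_def L2_set_def sum_nonneg sum_negf sum_divide_distrib mult.commute)
    then have "(\<Prod>v\<in>UNIV. e s v) =
        exp (- of_real ((norm t)\<^sup>2 / 2) + \<i> * of_real (\<Sum>v\<in>UNIV. t $ v * drift n s v))"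
      unfolding e_def exp_sum[OF finite, symmetric] by (rule arg_cong)
    then show ?thesis
      unfolding inner_bstep of_real_add distrib_left cis_conv_exp by (simp only: exp_add mult_ac)
  qed
  have rhs: "gauss t * \<phi> n (bstep n t) = (\<integral>w. ?e (S n w) \<partial>M)"
    by (simp add: prod_e \<phi>_def)
  have t1: "\<bar>t $ v\<bar> \<le> norm t" for v by (rule component_le_norm_cart)
  have bound: "cmod (?c s - ?e s)
      \<le> ?u s"
    and c_le: "\<And>v. cmod (c s v) \<le> 1" if d: "\<And>v. \<bar>drift n s v\<bar> \<le> 1" for s
  proof -
    show c1: "cmod (c s v) \<le> 1" for v
    proof -
      have "(cmod (c s v))\<^sup>2 = (cos (t $ v))\<^sup>2 + (drift n s v)\<^sup>2 * (sin (t $ v))\<^sup>2"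
        by (simp add: c_def cmod_power2 power_mult_distrib)
      also have "\<dots> \<le> (cos (t $ v))\<^sup>2 + 1 * (sin (t $ v))\<^sup>2"
        using d[of v] by (intro add_left_mono mult_right_mono) (auto simp: abs_square_le_1)
      finally show ?thesis by (simp add: power_le_one_iff)
    qed
    have e1: "cmod (e s v) \<le> 1" for v by (simp add: e_def)
    have "cmod (?c s - ?e s)
        = cmod ((\<Prod>v\<in>UNIV. c s v) - (\<Prod>v\<in>UNIV. e s v))"
      by (simp add: norm_mult flip: right_diff_distrib)
    also have "\<dots> \<le> (\<Sum>v\<in>UNIV. cmod (c s v - e s v))"
      by (rule norm_prod_diff) (use c1 e1 in auto)
    also have "\<dots> \<le> (\<Sum>v\<in>UNIV. 3 * (norm t ^ 3 + (norm t)\<^sup>2 * (drift n s v)\<^sup>2))"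
    proof (rule sum_mono)
      fix v
      have "cmod (c s v - e s v) \<le> 3 * (\<bar>t $ v\<bar> ^ 3 + (drift n s v)\<^sup>2 * (t $ v)\<^sup>2)"
        unfolding c_def e_def
        by (rule cmod_rademacher_chf_le) (use t1[of v] t d in auto)
      also have "\<dots> \<le> 3 * (norm t ^ 3 + (norm t)\<^sup>2 * (drift n s v)\<^sup>2)"
      proof (subst mult.commute[of "(drift n s v)\<^sup>2"], intro mult_left_mono add_mono)
        show "(t $ v)\<^sup>2 * (drift n s v)\<^sup>2 \<le> (norm t)\<^sup>2 * (drift n s v)\<^sup>2"
          using power_mono[OF t1[of v], of 2] by (intro mult_right_mono) auto
      qed (use power_mono[OF t1[of v], of 3] in auto)
      finally show "cmod (c s v - e s v) \<le> 3 * (norm t ^ 3 + (norm t)\<^sup>2 * (drift n s v)\<^sup>2)" .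
    qed
    also have "\<dots> = ?u s"
      by (simp add: sum.distrib sum_distrib_left distrib_left)
    finally show "cmod (?c s - ?e s)
      \<le> ?u s" .
  qed
  have c_meas [measurable]: "(\<lambda>w. c (S n w) v) \<in> borel_measurable M" for v
    unfolding c_def Complex_eq by measurable
  have int_c: "integrable M (\<lambda>w. ?c (S n w))"
  proof (rule integrable_const_bound[where B = 1])
    show "AE w in M. cmod (?c (S n w)) \<le> 1"
      using drift_bound[of n]
    proof eventually_elim
      case (elim w)
      have "cmod (?c (S n w)) = (\<Prod>v\<in>UNIV. cmod (c (S n w) v))"
        by (simp add: norm_mult prod_norm)
      also have "\<dots> \<le> 1" using c_le[of "S n w"] elim by (intro prod_le_1) auto
      finally show ?case .
    qed
  qed (simp add: cis_conv_exp)
  have int_e: "integrable M (\<lambda>w. ?e (S n w))"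
    unfolding prod_e by (intro integrable_mult_right integrable_cis_S)
  have "cmod (\<phi> (Suc n) t - gauss t * \<phi> n (bstep n t))
      = cmod (\<integral>w. ?c (S n w) - ?e (S n w) \<partial>M)"
    unfolding lhs rhs using int_c int_e by simp
  also have "\<dots> \<le> (\<integral>w. ?u (S n w) \<partial>M)"
  proof (rule norm_integral_le_AE)
    show "AE w in M. cmod (?c (S n w) - ?e (S n w))
        \<le> ?u (S n w)"
      using drift_bound[of n] by eventually_elim (rule bound, blast)
  qed (intro integrable_mult_right Bochner_Integration.integrable_add Bochner_Integration.integrable_sum
      integrable_drift_sq integrable_const Bochner_Integration.integrable_diff int_c int_e)+
  also have "\<dots> = 3 * (CARD('v) * norm t ^ 3 + (norm t)\<^sup>2 * (\<Sum>v\<in>UNIV. q2 n (column v B) / (real n)\<^sup>2))"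
    by (simp add: integrable_drift_sq prob_space q2_def drift_eq_inner power_divide integrable_inner_S_sq
        Bochner_Integration.integral_sum)
  finally show ?thesis .
qed

end

subsection \<open>Convergence of the characteristic functions\<close>

lemma tendsto_imp_bounded_above:
  fixes X :: "nat \<Rightarrow> real"
  assumes "X \<longlonglongrightarrow> l"
  shows "\<exists>V. \<forall>n. X n \<le> V"
proof -
  obtain K where "\<And>n. norm (X n) \<le> K"
    using convergent_imp_Bseq[OF convergentI[OF assms]] unfolding Bseq_def by blast
  then show ?thesis by (metis abs_le_D1 real_norm_def)
qed

text \<open>A Toeplitz argument: indices below a fixed \<open>K\<close> carry vanishing weight
  because each weight is at most \<open>\<epsilon> n\<close>, and beyond \<open>K\<close> the values
  of \<alpha> are small while the total weight stays below \<open>V\<close>.\<close>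

lemma weighted_sum_tendsto_0:
  fixes x :: "nat \<Rightarrow> nat \<Rightarrow> real" and \<alpha> \<epsilon> :: "nat \<Rightarrow> real"
  assumes x: "\<And>n k. k \<in> {1..n} \<Longrightarrow> 0 \<le> x n k" "\<And>n k. k \<in> {1..n} \<Longrightarrow> x n k \<le> \<epsilon> n"
    and V: "\<And>n. (\<Sum>k=1..n. x n k) \<le> V" and \<epsilon>: "\<epsilon> \<longlonglongrightarrow> 0"
    and \<alpha>: "\<And>k. 0 \<le> \<alpha> k" "\<alpha> \<longlonglongrightarrow> 0"
  shows "(\<lambda>n. \<Sum>k=1..n. x n k * \<alpha> k) \<longlonglongrightarrow> 0"
proof (rule LIMSEQ_I)
  fix r :: real assume r: "0 < r"
  have V0: "0 \<le> V" using V[of 0] by simp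
  define \<delta> where "\<delta> = r / (2 * (V + 1))"
  have \<delta>: "0 < \<delta>" "\<delta> * V < r / 2"
  proof -
    show "0 < \<delta>" using r V0 by (simp add: \<delta>_def)
    have "\<delta> * V < \<delta> * (V + 1)" using \<open>0 < \<delta>\<close> by simp
    also have "\<dots> = r / 2" using V0 by (simp add: \<delta>_def field_simps)
    finally show "\<delta> * V < r / 2" .
  qed
  obtain K where K: "\<And>k. k \<ge> K \<Longrightarrow> \<alpha> k < \<delta>"
    using order_tendstoD(2)[OF \<alpha>(2) \<delta>(1)] by (auto simp: eventually_sequentially)
  have "(\<lambda>n. \<bar>\<epsilon> n\<bar> * (\<Sum>k<K. \<alpha> k)) \<longlonglongrightarrow> 0"
    using tendsto_mult_left_zero[OF tendsto_rabs_zero[OF \<epsilon>]] .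
  then obtain N where N: "\<And>n. n \<ge> N \<Longrightarrow> \<bar>\<epsilon> n\<bar> * (\<Sum>k<K. \<alpha> k) < r / 2"
    using order_tendstoD(2)[of _ 0 sequentially "r / 2"] r by (force simp: eventually_sequentially)
  show "\<exists>no. \<forall>n\<ge>no. norm ((\<Sum>k=1..n. x n k * \<alpha> k) - 0) < r"
  proof (intro exI allI impI)
    fix n assume n: "n \<ge> N"
    have nonneg: "0 \<le> (\<Sum>k=1..n. x n k * \<alpha> k)"
      using x \<alpha>(1) by (intro sum_nonneg mult_nonneg_nonneg)
    have "(\<Sum>k=1..n. x n k * \<alpha> k) \<le> (\<Sum>k=1..n. x n k * \<delta> + (if k < K then \<bar>\<epsilon> n\<bar> * \<alpha> k else 0))"
    proof (rule sum_mono)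
      fix k assume k: "k \<in> {1..n}"
      show "x n k * \<alpha> k \<le> x n k * \<delta> + (if k < K then \<bar>\<epsilon> n\<bar> * \<alpha> k else 0)"
      proof (cases "k < K")
        case True
        have "x n k * \<alpha> k \<le> \<bar>\<epsilon> n\<bar> * \<alpha> k" using x(2)[OF k] \<alpha>(1) by (intro mult_right_mono) auto
        moreover have "0 \<le> x n k * \<delta>" using x(1)[OF k] \<delta> by simp
        ultimately show ?thesis using True by simp
      next
        case False
        then show ?thesis using x(1)[OF k] K[of k] by (simp add: mult_left_mono)
      qed
    qed
    also have "\<dots> = \<delta> * (\<Sum>k=1..n. x n k) + (\<Sum>k=1..n. if k < K then \<bar>\<epsilon> n\<bar> * \<alpha> k else 0)"
      by (simp add: sum.distrib sum_distrib_left mult.commute)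
    also have "(\<Sum>k=1..n. if k < K then \<bar>\<epsilon> n\<bar> * \<alpha> k else 0) = (\<Sum>k\<in>{1..n} \<inter> {..<K}. \<bar>\<epsilon> n\<bar> * \<alpha> k)"
      by (rule sum.mono_neutral_cong_right) auto
    also have "\<dots> \<le> (\<Sum>k\<in>{..<K}. \<bar>\<epsilon> n\<bar> * \<alpha> k)"
      by (rule sum_mono2) (use \<alpha>(1) in auto)
    also have "\<dots> = \<bar>\<epsilon> n\<bar> * (\<Sum>k<K. \<alpha> k)" by (simp add: sum_distrib_left)
    also have "\<delta> * (\<Sum>k=1..n. x n k) \<le> \<delta> * V" using V \<delta> by (intro mult_left_mono) auto
    finally have "(\<Sum>k=1..n. x n k * \<alpha> k) < r" using \<delta>(2) N[OF n] by linarith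
    then show "norm ((\<Sum>k=1..n. x n k * \<alpha> k) - 0) < r" using nonneg by simp
  qed
qed

context ERWG
begin

text \<open>The factor \<open>CARD('v)^2\<close> comes from the crude bound on the initial signs;
  the induction step carries it along since it is at least 1.\<close>

lemma q2_le_Wsum: "1 \<le> n \<Longrightarrow> q2 n t \<le> (CARD('v))\<^sup>2 * Wsum B n t"
proof (induction n arbitrary: t rule: nat_induct_at_least)
  case base
  show ?case using q2_1[of t] by (simp add: Wsum_Suc[of _ 0, simplified] back_step_def)
next
  case (Suc n)
  have c: "1 \<le> (real CARD('v))\<^sup>2" using one_le_card_finite[where 'a = 'v] by simp
  have "q2 (Suc n) t \<le> q2 n (bstep n t) + (norm t)\<^sup>2" by (rule q2_step[OF Suc.hyps])
  also have "\<dots> \<le> (CARD('v))\<^sup>2 * Wsum B n (bstep n t) + (CARD('v))\<^sup>2 * (norm t)\<^sup>2"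
    using Suc.IH[of "bstep n t"] mult_right_mono[OF c, of "(norm t)\<^sup>2"] by simp
  also have "\<dots> = (CARD('v))\<^sup>2 * Wsum B (Suc n) t" by (simp add: Wsum_Suc algebra_simps)
  finally show ?case .
qed

lemma q2_nonneg: "0 \<le> q2 n t"
  by (simp add: q2_def)

lemma q2_scaleR: "q2 n (c *\<^sub>R t) = c\<^sup>2 * q2 n t"
  by (simp add: q2_def power_mult_distrib)

text \<open>The mean squared length of the drift vector, since \<open>drift n s v\<close> is the
  inner product of \<open>s\<close> with column \<open>v\<close> of \<open>B\<close>, divided by
  \<open>n\<close>.\<close>

definition drift_var :: "nat \<Rightarrow> real" where
  "drift_var n = (\<Sum>v\<in>UNIV. q2 n (column v B) / (real n)\<^sup>2)"

lemma drift_var_nonneg: "0 \<le> drift_var n"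
  by (simp add: drift_var_def sum_nonneg q2_nonneg)

text \<open>Index \<open>k\<close> is the time after the step, hence the drift at
  \<open>k - 1\<close>; \<open>k = 1\<close> is the initial step with its linear error.\<close>

definition err :: "nat \<Rightarrow> real \<Rightarrow> real" where
  "err k x = (if k = 1 then 2 * real CARD('v) * x else 3 * (real CARD('v) * x ^ 3 + x\<^sup>2 * drift_var (k - 1)))"

text \<open>Unrolling from the last time: the Gaussian factor split off has modulus at most 1, so
  the error at earlier times, measured at the transported vector, is inherited without
  amplification.\<close>

lemma \<phi>_approx:
  assumes "1 \<le> n" "\<And>k. k \<in> {1..n} \<Longrightarrow> norm (tback B n k t) \<le> 1"
  shows "cmod (\<phi> n t - exp (- of_real (Wsum B n t / 2))) \<le> (\<Sum>k=1..n. err k (norm (tback B n k t)))"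
  using assms
proof (induction n arbitrary: t rule: nat_induct_at_least)
  case base
  have "norm t \<le> 1" using base[of 1] by simp
  from \<phi>_1[OF this] show ?case
    by (simp add: Wsum_Suc[of _ 0, simplified] back_step_def err_def)
next
  case (Suc n)
  let ?g = "gauss t"
  let ?w = "exp (- of_real (Wsum B n (bstep n t) / 2))"
  have t: "norm t \<le> 1" using Suc.prems[of "Suc n"] by simp
  have g: "cmod ?g \<le> 1" by (simp del: of_real_divide of_real_power)
  have "cmod (\<phi> n (bstep n t) - ?w) \<le> (\<Sum>k=1..n. err k (norm (tback B n k (bstep n t))))"
  proof (rule Suc.IH)
    fix k assume "k \<in> {1..n}"
    then show "norm (tback B n k (bstep n t)) \<le> 1" using Suc.prems[of k] by simp
  qed
  then have "cmod (?g * (\<phi> n (bstep n t) - ?w)) \<le> 1 * (\<Sum>k=1..n. err k (norm (tback B n k (bstep n t))))"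
    unfolding norm_mult using g by (intro mult_mono) auto
  moreover have "cmod (\<phi> (Suc n) t - ?g * \<phi> n (bstep n t)) \<le> err (Suc n) (norm t)"
    using \<phi>_step[OF Suc.hyps t] Suc.hyps by (simp add: err_def drift_var_def)
  moreover have "\<phi> (Suc n) t - exp (- of_real (Wsum B (Suc n) t / 2))
      = (\<phi> (Suc n) t - ?g * \<phi> n (bstep n t)) + ?g * (\<phi> n (bstep n t) - ?w)"
  proof -
    have "exp (- of_real (Wsum B (Suc n) t / 2)) = ?g * ?w"
      by (simp add: Wsum_Suc exp_add[symmetric] add_divide_distrib)
    then show ?thesis by (simp add: algebra_simps)
  qed
  ultimately have "cmod (\<phi> (Suc n) t - exp (- of_real (Wsum B (Suc n) t / 2)))
      \<le> err (Suc n) (norm t) + (\<Sum>k=1..n. err k (norm (tback B n k (bstep n t))))"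
    using norm_triangle_ineq[of "\<phi> (Suc n) t - ?g * \<phi> n (bstep n t)" "?g * (\<phi> n (bstep n t) - ?w)"]
    by (simp only: mult_1)
  then show ?case unfolding sum_tback_Suc[of "\<lambda>k x. err k (norm x)"] .
qed

section \<open>Limit theorem for an abstract normalising sequence \<open>b\<close> and covariance
  \<Sigma>\<close>

context
  fixes b :: "nat \<Rightarrow> real" and \<Sigma> :: "real^'v^'v"
  assumes b: "\<And>n. 0 \<le> b n" "\<forall>\<^sub>F n in sequentially. 0 < b n" "(\<lambda>n. b n / (real n)\<^sup>2) \<longlonglongrightarrow> 0"
    and Wlim: "\<And>t. (\<lambda>n. Wsum B n t / b n) \<longlonglongrightarrow> t \<bullet> (\<Sigma> *v t)"
    and small: "\<And>t. tback_negligible B b t"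
begin

abbreviation "Y n w \<equiv> (1 / sqrt (b n)) *\<^sub>R S n w"

text \<open>The second moments are of the order of \<open>Wsum\<close>, hence of \<open>b n\<close>,
  which is negligible against \<open>n^2\<close>. No rate is extracted.\<close>

lemma drift_var_tendsto: "drift_var \<longlonglongrightarrow> 0"
proof -
  have "(\<lambda>n. q2 n t / (real n)\<^sup>2) \<longlonglongrightarrow> 0" for t
  proof (rule tendsto_sandwich)
    show "\<forall>\<^sub>F n in sequentially. 0 \<le> q2 n t / (real n)\<^sup>2" by (simp add: q2_nonneg)
    show "\<forall>\<^sub>F n in sequentially. q2 n t / (real n)\<^sup>2 \<le> (CARD('v))\<^sup>2 * (Wsum B n t / b n * (b n / (real n)\<^sup>2))"
      using b(2) eventually_ge_at_top[of 1]
    proof eventually_elim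
      case (elim n)
      have "q2 n t / (real n)\<^sup>2 \<le> (CARD('v))\<^sup>2 * Wsum B n t / (real n)\<^sup>2"
        using q2_le_Wsum[OF elim(2)] by (simp add: divide_right_mono)
      then show ?case using elim by simp
    qed
    have "(\<lambda>n. (CARD('v))\<^sup>2 * (Wsum B n t / b n * (b n / (real n)\<^sup>2))) \<longlonglongrightarrow> (CARD('v))\<^sup>2 * ((t \<bullet> (\<Sigma> *v t)) * 0)"
      by (intro tendsto_mult tendsto_const Wlim b(3))
    then show "(\<lambda>n. (CARD('v))\<^sup>2 * (Wsum B n t / b n * (b n / (real n)\<^sup>2))) \<longlonglongrightarrow> 0" by simp
  qed simp
  then have "(\<lambda>n. \<Sum>v\<in>UNIV. q2 n (column v B) / (real n)\<^sup>2) \<longlonglongrightarrow> (\<Sum>v\<in>(UNIV::'v set). 0)"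
    by (intro tendsto_sum)
  then show ?thesis by (simp add: drift_var_def[abs_def])
qed

lemma \<phi>_tendsto: "(\<lambda>n. \<phi> n ((1 / sqrt (b n)) *\<^sub>R t)) \<longlonglongrightarrow> exp (- of_real ((t \<bullet> (\<Sigma> *v t)) / 2))"
proof -
  define \<tau> where "\<tau> n = (1 / sqrt (b n)) *\<^sub>R t" for n
  obtain \<epsilon> where \<epsilon>: "\<epsilon> \<longlonglongrightarrow> 0" "\<And>n k. k \<in> {1..n} \<Longrightarrow> (norm (tback B n k t))\<^sup>2 / b n \<le> \<epsilon> n"
    using small[of t] by blast
  define x where "x n k = norm (tback B n k (\<tau> n))" for n k
  have x0: "0 \<le> x n k" for n k by (simp add: x_def)
  have xx: "(x n k)\<^sup>2 = (norm (tback B n k t))\<^sup>2 / b n" for n k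
    using b(1)[of n] by (simp add: x_def \<tau>_def tback_scaleR power_divide)
  have xe: "(x n k)\<^sup>2 \<le> \<epsilon> n" if "k \<in> {1..n}" for n k using \<epsilon>(2)[OF that] by (simp add: xx)
  have xs: "x n k \<le> sqrt (\<epsilon> n)" if "k \<in> {1..n}" for n k
    using xe[OF that] by (simp add: real_le_rsqrt)
  have W\<tau>: "Wsum B n (\<tau> n) = Wsum B n t / b n" for n
    using b(1)[of n] by (simp add: \<tau>_def Wsum_scaleR power_divide)
  have sumx: "(\<Sum>k=1..n. (x n k)\<^sup>2) = Wsum B n t / b n" for n
    unfolding W\<tau>[symmetric] by (simp add: x_def Wsum_def)
  obtain V where V: "\<And>n. Wsum B n t / b n \<le> V"
    using tendsto_imp_bounded_above[OF Wlim[of t]] by blast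
  have V0: "0 \<le> V" using V[of 0] by simp
  define c where "c = real CARD('v)"
  have c: "0 \<le> c" by (simp add: c_def)
  have se: "(\<lambda>n. sqrt (\<epsilon> n)) \<longlonglongrightarrow> 0" using tendsto_real_sqrt[OF \<epsilon>(1)] by simp
  \<comment> \<open>The three summands bound the initial step, the cubic terms (one factor bounded
    by its maximum \<open>sqrt (\<epsilon> n)\<close>, the squares summing to at most
    \<open>V\<close>), and the drift terms handled by the weighted-sum lemma.\<close>
  let ?e = "\<lambda>n. 2 * c * sqrt (\<epsilon> n) + 3 * c * sqrt (\<epsilon> n) * V + 3 * (\<Sum>k=1..n. (x n k)\<^sup>2 * drift_var (k - 1))"
  let ?g = "\<lambda>n. exp (- complex_of_real (Wsum B n (\<tau> n) / 2))"
  have lim_err: "?e \<longlonglongrightarrow> 0"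
  proof -
    have "(\<lambda>n. \<Sum>k=1..n. (x n k)\<^sup>2 * drift_var (k - 1)) \<longlonglongrightarrow> 0"
    proof (rule weighted_sum_tendsto_0[OF _ xe _ \<epsilon>(1)])
      show "(\<Sum>k=1..n. (x n k)\<^sup>2) \<le> V" for n unfolding sumx by (rule V)
      show "(\<lambda>k. drift_var (k - 1)) \<longlonglongrightarrow> 0"
        using LIMSEQ_imp_Suc[of "\<lambda>k. drift_var (k - 1)"] drift_var_tendsto by simp
    qed (auto simp: drift_var_nonneg)
    then have "?e
        \<longlonglongrightarrow> 2 * c * 0 + 3 * c * 0 * V + 3 * 0"
      by (intro tendsto_intros se)
    then show ?thesis by simp
  qed
  have "(\<lambda>n. \<phi> n (\<tau> n) - ?g n) \<longlonglongrightarrow> 0"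
  proof (rule Lim_null_comparison[OF _ lim_err])
    have "\<forall>\<^sub>F n in sequentially. \<epsilon> n < 1" using order_tendstoD(2)[OF \<epsilon>(1)] by simp
    then show "\<forall>\<^sub>F n in sequentially. cmod (\<phi> n (\<tau> n) - ?g n)
        \<le> ?e n"
      using eventually_ge_at_top[of 1]
    proof eventually_elim
      case (elim n)
      have e0: "0 \<le> sqrt (\<epsilon> n)" using order_trans[OF x0 xs[of 1 n]] elim(2) by simp
      have x1: "x n k \<le> 1" if "k \<in> {1..n}" for k
        using xs[OF that] elim(1) by (meson less_eq_real_def order_trans real_sqrt_le_1_iff)
      have "cmod (\<phi> n (\<tau> n) - ?g n) \<le> (\<Sum>k=1..n. err k (x n k))"
        unfolding x_def by (rule \<phi>_approx) (use elim x1 in \<open>auto simp: x_def\<close>)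
      also have "\<dots> \<le> (\<Sum>k=1..n. (if k = 1 then 2 * c * sqrt (\<epsilon> n) else 0)
          + 3 * c * sqrt (\<epsilon> n) * (x n k)\<^sup>2 + 3 * ((x n k)\<^sup>2 * drift_var (k - 1)))"
      proof (rule sum_mono)
        fix k assume k: "k \<in> {1..n}"
        have p1: "0 \<le> 3 * c * sqrt (\<epsilon> n) * (x n k)\<^sup>2" "0 \<le> 3 * ((x n k)\<^sup>2 * drift_var (k - 1))"
          using e0 c drift_var_nonneg by (auto intro!: mult_nonneg_nonneg)
        show "err k (x n k) \<le> (if k = 1 then 2 * c * sqrt (\<epsilon> n) else 0)
          + 3 * c * sqrt (\<epsilon> n) * (x n k)\<^sup>2 + 3 * ((x n k)\<^sup>2 * drift_var (k - 1))"
        proof (cases "k = 1")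
          case True
          have "err k (x n k) \<le> 2 * c * sqrt (\<epsilon> n)"
            using True xs[OF k] c by (simp add: err_def c_def mult_left_mono)
          then show ?thesis using p1 True by simp
        next
          case False
          have "x n k ^ 3 = x n k * (x n k)\<^sup>2" by (simp add: eval_nat_numeral)
          also have "\<dots> \<le> sqrt (\<epsilon> n) * (x n k)\<^sup>2" using xs[OF k] by (intro mult_right_mono) auto
          finally have "c * x n k ^ 3 \<le> c * (sqrt (\<epsilon> n) * (x n k)\<^sup>2)" using c by (rule mult_left_mono)
          then show ?thesis using False by (simp add: err_def c_def)
        qed
      qed
      also have "\<dots> = (\<Sum>k=1..n. if k = 1 then 2 * c * sqrt (\<epsilon> n) else 0)
          + 3 * c * sqrt (\<epsilon> n) * (\<Sum>k=1..n. (x n k)\<^sup>2) + 3 * (\<Sum>k=1..n. (x n k)\<^sup>2 * drift_var (k - 1))"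
        by (simp only: sum.distrib sum_distrib_left)
      also have "(\<Sum>k=1..n. if k = 1 then 2 * c * sqrt (\<epsilon> n) else 0) = 2 * c * sqrt (\<epsilon> n)"
        using elim(2) by simp
      also have "3 * c * sqrt (\<epsilon> n) * (\<Sum>k=1..n. (x n k)\<^sup>2) \<le> 3 * c * sqrt (\<epsilon> n) * V"
        unfolding sumx using V e0 c by (intro mult_left_mono) auto
      finally show ?case by simp
    qed
  qed
  moreover have "?g \<longlonglongrightarrow> exp (- complex_of_real ((t \<bullet> (\<Sigma> *v t)) / 2))"
    unfolding W\<tau> by (intro tendsto_intros Wlim) simp
  ultimately have "(\<lambda>n. (\<phi> n (\<tau> n) - ?g n) + ?g n)
      \<longlonglongrightarrow> 0 + exp (- of_real ((t \<bullet> (\<Sigma> *v t)) / 2))"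
    by (rule tendsto_add)
  then show ?thesis by (simp add: \<tau>_def)
qed

lemma norm_sq_eq: "(norm (c *\<^sub>R s))\<^sup>2 = (\<Sum>v\<in>UNIV. ((c *\<^sub>R axis v 1) \<bullet> (s :: real^'v))\<^sup>2)"
proof -
  have "(c *\<^sub>R axis v 1) \<bullet> s = (c *\<^sub>R s) $ v" for v
    by (simp add: inner_axis')
  then show ?thesis by (simp only: norm_vec_def L2_set_def real_sqrt_pow2 sum_nonneg real_norm_def power2_abs zero_le_power2)
qed

text \<open>Supplies the tightness of the normalised sums through the Markov inequality.\<close>

lemma second_moment_bounded:
  "\<exists>C\<ge>0. \<forall>n. (\<integral>w. (norm (Y n w))\<^sup>2 \<partial>M) \<le> C"
proof -
  have "\<exists>C\<ge>0. \<forall>n. q2 n ((1 / sqrt (b n)) *\<^sub>R t) \<le> C" for t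
  proof -
    obtain V where V: "\<And>n. Wsum B n t / b n \<le> V"
      using tendsto_imp_bounded_above[OF Wlim[of t]] by blast
    have V0: "0 \<le> V" using V[of 0] by simp
    have "q2 n ((1 / sqrt (b n)) *\<^sub>R t) \<le> (CARD('v))\<^sup>2 * V" for n
    proof (cases "n = 0")
      case True
      then show ?thesis using V0 by (simp add: q2_def erwg_S_def)
    next
      case False
      have "q2 n ((1 / sqrt (b n)) *\<^sub>R t) = q2 n t / b n"
        using b(1)[of n] by (simp add: q2_scaleR power_divide)
      also have "\<dots> \<le> (CARD('v))\<^sup>2 * Wsum B n t / b n"
        using q2_le_Wsum[of n t] False b(1)[of n] by (intro divide_right_mono) auto
      also have "\<dots> = (CARD('v))\<^sup>2 * (Wsum B n t / b n)" by simp
      also have "\<dots> \<le> (CARD('v))\<^sup>2 * V" by (intro mult_left_mono V) auto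
      finally show ?thesis .
    qed
    then show ?thesis using V0 by (intro exI[of _ "(CARD('v))\<^sup>2 * V"]) auto
  qed
  then obtain C where C: "\<And>t. 0 \<le> C t" "\<And>t n. q2 n ((1 / sqrt (b n)) *\<^sub>R t) \<le> C t" by metis
  have "(\<integral>w. (norm (Y n w))\<^sup>2 \<partial>M) \<le> (\<Sum>v\<in>UNIV. C (axis v 1))" for n
  proof -
    have "(\<integral>w. (norm (Y n w))\<^sup>2 \<partial>M) = (\<Sum>v\<in>UNIV. q2 n ((1 / sqrt (b n)) *\<^sub>R axis v 1))"
      unfolding q2_def norm_sq_eq by (rule Bochner_Integration.integral_sum) (rule integrable_inner_S_sq)
    also have "\<dots> \<le> (\<Sum>v\<in>UNIV. C (axis v 1))" by (intro sum_mono C(2))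
    finally show ?thesis .
  qed
  then show ?thesis using C(1) by (intro exI[of _ "\<Sum>v\<in>UNIV. C (axis v 1)"]) (auto intro: sum_nonneg)
qed

lemma weakly_converges_normal:
  fixes A :: "real^'v^'v"
  assumes A: "A ** transpose A = \<Sigma>"
  shows "weakly_converges (\<lambda>n. distr M borel (Y n))
    (normal_law A)"
proof (rule weakly_converges_of_chf)
  show "prob_space (distr M borel (Y n))" for n
    by (rule prob_space_distr) measurable
  show "prob_space (normal_law A)" by (rule prob_space_normal_vec)
  show "(\<lambda>n. chf (distr M borel (Y n)) t) \<longlonglongrightarrow>
      chf (normal_law A) t" for t
  proof -
    have "chf (distr M borel (Y n)) t = \<phi> n ((1 / sqrt (b n)) *\<^sub>R t)" for n
      unfolding chf_def \<phi>_def
      by (subst integral_distr) simp_all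
    then show ?thesis using \<phi>_tendsto[of t] by (simp only: chf_normal_vec A)
  qed
  fix e :: real assume e: "0 < e"
  obtain C where C: "0 \<le> C" "\<And>n. (\<integral>w. (norm (Y n w))\<^sup>2 \<partial>M) \<le> C"
    using second_moment_bounded by blast
  \<comment> \<open>The summand 1 makes \<open>C < e * R^2\<close> strict, also when
    \<open>C\<close> is 0.\<close>
  define R where "R = sqrt (C / e) + 1"
  have R: "0 < R" "C < e * R\<^sup>2"
  proof -
    have s: "0 \<le> sqrt (C / e)" using C(1) e by simp
    then show "0 < R" unfolding R_def by linarith
    have "C / e = (sqrt (C / e))\<^sup>2" using C(1) e by simp
    also have "\<dots> < R\<^sup>2" unfolding R_def using s by (intro power_strict_mono) auto
    finally show "C < e * R\<^sup>2" using e by (simp add: field_simps)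
  qed
  show "\<exists>R. \<forall>n. measure (distr M borel (Y n)) (- cball 0 R) < e"
  proof (intro exI allI)
    fix n
        have int: "integrable M (\<lambda>w. (norm (Y n w))\<^sup>2)"
      unfolding norm_sq_eq by (intro Bochner_Integration.integrable_sum integrable_inner_S_sq)
    have "measure (distr M borel (Y n)) (- cball 0 R) = measure M {w \<in> space M. R < norm (Y n w)}"
      by (subst measure_distr) (auto intro!: arg_cong[where f = "measure M"] simp: not_le)
    also have "\<dots> \<le> measure M {w \<in> space M. R\<^sup>2 \<le> (norm (Y n w))\<^sup>2}"
      using R(1) by (intro finite_measure_mono) (auto intro: power_mono)
    also have "\<dots> \<le> (\<integral>w. (norm (Y n w))\<^sup>2 \<partial>M) / R\<^sup>2"
      using integral_Markov_inequality_measure[OF int, of "{}" "R\<^sup>2"] R(1) by simp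
    also have "\<dots> \<le> C / R\<^sup>2" using C(2) by (intro divide_right_mono) auto
    also have "\<dots> < e" using R by (simp add: field_simps)
    finally show "measure (distr M borel (Y n)) (- cball 0 R) < e" .
  qed
qed simp_all

lemma weak_limit_normal:
  assumes sym: "transpose \<Sigma> = \<Sigma>"
  shows "\<exists>N. is_normal_vec N 0 \<Sigma> \<and> weakly_converges (\<lambda>n. distr M borel (Y n)) N"
proof -
  \<comment> \<open>Positive semidefiniteness is inherited from the nonnegative quantities
    \<open>Wsum B n t / b n\<close>, whatever formula defines \<Sigma>.\<close>
  have psd: "0 \<le> x \<bullet> (\<Sigma> *v x)" for x
    by (rule LIMSEQ_le_const[OF Wlim]) (use b(1) in \<open>auto simp: Wsum_nonneg\<close>)
  obtain A :: "real^'v^'v" where "A ** transpose A = \<Sigma>" "is_normal_vec (normal_law A) 0 \<Sigma>"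
    using normal_vec_exists[OF sym psd] by blast
  with weakly_converges_normal show ?thesis by blast
qed

end

end

subsection \<open>The limiting covariance matrices\<close>

lemma matrix_inv_mult:
  fixes A :: "'a::field^'n^'n"
  assumes "invertible A"
  shows "A ** matrix_inv A = mat 1" "matrix_inv A ** A = mat 1"
  using someI_ex[OF assms[unfolded invertible_def]] unfolding matrix_inv_def by blast+

lemma matrix_inv_eqI:
  fixes A :: "'a::field^'n^'n"
  assumes "A ** C = mat 1" "C ** A = mat 1"
  shows "matrix_inv A = C"
proof -
  have inv: "invertible A" using assms by (auto simp: invertible_def)
  have "matrix_inv A = matrix_inv A ** (A ** C)" by (simp add: assms)
  also have "\<dots> = C" by (simp add: matrix_mul_assoc matrix_inv_mult[OF inv])
  finally show ?thesis .
qed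

lemma diagonal_mult:
  fixes D A :: "'a::semiring_1^'n^'n"
  assumes "\<And>i j. i \<noteq> j \<Longrightarrow> D $ i $ j = 0"
  shows "(D ** A) $ i $ j = D $ i $ i * A $ i $ j"
proof -
  have "(D ** A) $ i $ j = (\<Sum>l\<in>UNIV. if l = i then D $ i $ i * A $ i $ j else 0)"
    unfolding matrix_matrix_mult_def vec_lambda_beta by (intro sum.cong refl) (auto simp: assms)
  then show ?thesis by simp
qed

lemma diagonalisable_eigenbasis:
  assumes "diagonalisable (complex_matrix B)"
  obtains P Q d where "eigenbasis B P Q d"
proof -
  obtain P D :: "complex^'a^'a" where P: "invertible P" and D: "\<And>i j. i \<noteq> j \<Longrightarrow> D $ i $ j = 0"
    and eq: "complex_matrix B = P ** D ** matrix_inv P"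
    using assms unfolding diagonalisable_def by blast
  have "eigenbasis B P (matrix_inv P) (\<lambda>a. D $ a $ a)"
  proof
    show "P ** matrix_inv P = mat 1" "matrix_inv P ** P = mat 1" by (rule matrix_inv_mult[OF P])+
    fix a j
    have "matrix_inv P ** complex_matrix B = D ** matrix_inv P"
      unfolding eq by (simp add: matrix_mul_assoc matrix_inv_mult[OF P])
    then show "(matrix_inv P ** complex_matrix B) $ a $ j = D $ a $ a * matrix_inv P $ a $ j"
      by (simp add: diagonal_mult D)
  qed
  then show ?thesis by (rule that)
qed

context eigenbasis
begin

lemma complex_matrix_mult_P: "(complex_matrix B ** P) $ i $ a = d a * P $ i $ a"
proof -
  have "complex_matrix B ** P = P ** (Q ** complex_matrix B ** P)"
    by (simp add: matrix_mul_assoc PQ)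
  also have "Q ** complex_matrix B ** P = (\<chi> a b. d a * (Q ** P) $ a $ b)"
    by (simp add: vec_eq_iff matrix_matrix_mult_def[of "Q ** complex_matrix B"] QB sum_distrib_left mult.assoc)
      (simp add: matrix_matrix_mult_def sum_distrib_left)
  also have "(P ** (\<chi> a b. d a * (Q ** P) $ a $ b)) $ i $ a = (\<Sum>b\<in>UNIV. if b = a then d a * P $ i $ a else 0)"
    unfolding matrix_matrix_mult_def[of P] vec_lambda_beta
    by (intro sum.cong refl) (simp add: QP mat_def)
  finally show ?thesis by simp
qed

text \<open>The diagonalisation and the list \<open>lam\<close> are chosen independently of each
  other; membership transfers the bound \<eta> on real parts from \<open>lam\<close> to
  \<open>d\<close>. Column \<open>a\<close> of \<open>P\<close> is a nonzero vector in the kernel of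
  \<open>mat (d a) - B\<close>, so the characteristic polynomial vanishes at
  \<open>d a\<close>.\<close>

lemma eigenvalue_listed:
  assumes "lists_eigenvalues (complex_matrix B) lam"
  shows "d a \<in> range lam"
proof -
  define N where "N = mat (d a) - complex_matrix B"
  have "\<not> invertible N"
  proof
    assume "invertible N"
    then obtain C where C: "C ** N = mat 1" by (auto simp: invertible_def)
    have N0: "(N ** P) $ i $ a = 0" for i
    proof -
      have "(N ** P) $ i $ a = (mat (d a) ** P) $ i $ a - (complex_matrix B ** P) $ i $ a"
        by (simp add: N_def matrix_matrix_mult_def left_diff_distrib sum_subtractf)
      then show ?thesis by (simp add: complex_matrix_mult_P diagonal_mult mat_def)
    qed
    have "P $ i $ a = 0" for i
    proof -
      have "P = C ** (N ** P)" by (simp add: matrix_mul_assoc C)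
      then have "P $ i $ a = (\<Sum>l\<in>UNIV. C $ i $ l * (N ** P) $ l $ a)"
        by (metis (no_types, lifting) matrix_matrix_mult_def vec_lambda_beta sum.cong)
      then show ?thesis by (simp add: N0)
    qed
    then have "(Q ** P) $ a $ a = 0" by (simp add: matrix_matrix_mult_def)
    then show False by (simp add: QP mat_def)
  qed
  then have "det N = 0" by (simp add: invertible_det_nz)
  then have "(\<Prod>j\<in>UNIV. d a - lam j) = 0"
    using assms by (simp add: lists_eigenvalues_def N_def)
  then show ?thesis by auto
qed

section \<open>Negligibility of single times, and entries of the two covariance matrices\<close>

lemma tback_mean_small:
  assumes "\<And>a. Re (d a) < 1/2"
  shows "tback_negligible B real t"
proof -
  \<comment> \<open>A maximum over finitely many numbers below 1 is below 1, which leaves the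
    decaying power \<open>\<rho> - 1\<close>; \<open>max 0\<close> secures the sign required by the
    growth bound.\<close>
  define \<rho> where "\<rho> = max 0 (Max (range (\<lambda>a. 2 * Re (d a))))"
  have "Max (range (\<lambda>a. 2 * Re (d a))) \<in> range (\<lambda>a. 2 * Re (d a))" by (rule Max_in) auto
  moreover have "2 * Re (d a) < 1" for a using assms[of a] by simp
  ultimately have \<rho>: "0 \<le> \<rho>" "\<rho> < 1" by (auto simp: \<rho>_def)
  have "2 * Re (d a) \<le> Max (range (\<lambda>a. 2 * Re (d a)))" for a by (rule Max_ge) auto
  then have "2 * Re (d a) \<le> \<rho>" for a unfolding \<rho>_def by (rule max.coboundedI2)
  then obtain C where C: "\<And>n k t. 1 \<le> n \<Longrightarrow> (norm (tback B n k t))\<^sup>2 \<le> C * real n powr \<rho> * coord_norm t"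
    using tback_bound[OF \<rho>(1)] by blast
  have "(norm (tback B n k t))\<^sup>2 / real n \<le> C * coord_norm t * real n powr (\<rho> - 1)" if "k \<in> {1..n}" for n k
  proof -
    have n: "1 \<le> n" using that by simp
    have "(norm (tback B n k t))\<^sup>2 / real n \<le> C * real n powr \<rho> * coord_norm t / real n"
      by (intro divide_right_mono C n) simp
    also have "\<dots> = C * coord_norm t * real n powr (\<rho> - 1)" using n by (simp add: powr_diff)
    finally show ?thesis .
  qed
  moreover have "(\<lambda>n. C * coord_norm t * real n powr (\<rho> - 1)) \<longlonglongrightarrow> 0"
    using \<rho> by real_asymp
  ultimately show ?thesis by blast
qed

text \<open>At the critical rate the growth bound is of order \<open>n\<close> itself, and the decay
  comes from the logarithm in the normalisation.\<close>

lemma tback_log_small: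
  assumes "\<And>a. Re (d a) \<le> 1/2"
  shows "tback_negligible B (\<lambda>n. real n * ln (real n)) t"
proof -
  have "2 * Re (d a) \<le> 1" for a using assms[of a] by simp
  then obtain C where C: "\<And>n k t. 1 \<le> n \<Longrightarrow> (norm (tback B n k t))\<^sup>2 \<le> C * real n powr 1 * coord_norm t"
    using tback_bound[of 1] by auto
  have "(norm (tback B n k t))\<^sup>2 / (real n * ln (real n)) \<le> C * coord_norm t / ln (real n)" if "k \<in> {1..n}" for n k
  proof -
    have n: "1 \<le> n" using that by simp
    have "(norm (tback B n k t))\<^sup>2 / (real n * ln (real n)) \<le> C * real n powr 1 * coord_norm t / (real n * ln (real n))"
      using n by (intro divide_right_mono C) auto
    also have "\<dots> = C * coord_norm t / ln (real n)" using n by simp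
    finally show ?thesis .
  qed
  moreover have "(\<lambda>n. C * coord_norm t / ln (real n)) \<longlonglongrightarrow> 0"
    by real_asymp
  ultimately show ?thesis by blast
qed

lemma sum_pairs: "(\<Sum>r\<in>UNIV. f (fst r) (snd r)) = (\<Sum>a\<in>UNIV. \<Sum>b\<in>UNIV. f a b)"
  for f :: "'n \<Rightarrow> 'n \<Rightarrow> complex"
  by (simp add: sum.cartesian_product case_prod_unfold)

lemma Sigma1_entries:
  assumes d: "\<And>a. Re (d a) < 1/2"
  shows "cov_integrand B integrable_on {0..}"
    and "of_real (Sigma1 B $ i $ j) =
      form (\<lambda>a. Q $ a $ i) (\<lambda>a b. gram a b / (1 - (cnj (d a) + d b))) (\<lambda>b. Q $ b $ j)" (is "?l = ?r")
proof -
  have re: "Re (cnj (d (fst r)) + d (snd r) - 1) < 0" for r :: "'n \<times> 'n"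
    using d[of "fst r"] d[of "snd r"] by simp
  show "cov_integrand B integrable_on {0..}"
    by (rule exp_sum_integral_infinity(1)[OF finite of_real_cov_integrand re])
  have neg: "x * (- 1 / (c - 1)) = x / (1 - c)" for x c :: complex
    using minus_divide_divide[of x "1 - c"] by simp
  have "of_real (Sigma1 B $ i $ j) = (\<Sum>r\<in>UNIV. (cnj (Q $ fst r $ i) * gram (fst r) (snd r) * Q $ snd r $ j) *
      (- 1 / (cnj (d (fst r)) + d (snd r) - 1)))"
    unfolding Sigma1_def by (rule exp_sum_integral_infinity(2)[OF finite of_real_cov_integrand re])
  also have "\<dots> = (\<Sum>a\<in>UNIV. \<Sum>b\<in>UNIV. (cnj (Q $ a $ i) * gram a b * Q $ b $ j) * (- 1 / (cnj (d a) + d b - 1)))"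
    by (rule sum_pairs)
  also have "\<dots> = ?r"
    unfolding neg by simp
  finally show "?l = ?r" .
qed

lemma Sigma2_entries:
  assumes d: "\<And>a. Re (d a) \<le> 1/2"
  shows "cov_integrand B integrable_on {0..L}" and "convergent (Sigma2_seq B)"
    and "of_real (Sigma2 B $ i $ j) =
      form (\<lambda>a. Q $ a $ i) (\<lambda>a b. if cnj (d a) + d b = 1 then gram a b else 0) (\<lambda>b. Q $ b $ j)" (is "?l = ?r")
proof -
  have re: "Re (cnj (d (fst r)) + d (snd r) - 1) \<le> 0" for r :: "'n \<times> 'n"
    using d[of "fst r"] d[of "snd r"] by simp
  show "cov_integrand B integrable_on {0..L}"
    by (rule exp_sum_integral(1)[OF finite of_real_cov_integrand])
  obtain J where J: "(\<lambda>n. (1 / ln (real n)) *\<^sub>R integral {0..ln (real n)} (cov_integrand B)) \<longlonglongrightarrow> J"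
    "\<And>i j. of_real (J $ i $ j) = (\<Sum>r\<in>UNIV. (cnj (Q $ fst r $ i) * gram (fst r) (snd r) * Q $ snd r $ j) *
      (if cnj (d (fst r)) + d (snd r) - 1 = 0 then 1 else 0))"
    by (rule exp_sum_log_mean[OF finite of_real_cov_integrand re]) blast
  have lim: "Sigma2_seq B \<longlonglongrightarrow> J" using J(1) by (simp add: Sigma2_seq_def[abs_def])
  then show "convergent (Sigma2_seq B)" by (rule convergentI)
  have "Sigma2 B = J" using limI[OF lim] by (simp add: Sigma2_def)
  then have "of_real (Sigma2 B $ i $ j) = (\<Sum>a\<in>UNIV. \<Sum>b\<in>UNIV. (cnj (Q $ a $ i) * gram a b * Q $ b $ j) *
      (if cnj (d a) + d b - 1 = 0 then 1 else 0))"
    by (simp only: J(2)) (rule sum_pairs)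
  then show "?l = ?r"
    by (simp add: if_distrib[of "\<lambda>x. x * _"] if_distrib[of "\<lambda>x. _ * x"] cong: if_cong)
qed

text \<open>For symmetric \<open>B\<close> the integrand is the exponential of
  \<open>t (2 B - I)\<close>, diagonal in any eigenvector coordinates, so no orthogonal basis is
  chosen. Its integral has the eigenvalues \<open>1 / (1 - 2 d a)\<close>, and multiplication by
  \<open>I - 2 B\<close> confirms that it is the inverse.\<close>

lemma symmetric_Sigma1:
  assumes sym: "transpose B = B" and d: "\<And>a. Re (d a) < 1/2"
  shows "invertible (mat 1 - 2 *\<^sub>R B)" "Sigma1 B = matrix_inv (mat 1 - 2 *\<^sub>R B)"
proof -
  let ?N = "mat 1 - 2 *\<^sub>R B"
  have re: "Re (2 * d a - 1) < 0" for a using d[of a] by simp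
  have "transpose (B - mat (1/2)) = B - mat (1/2)"
    using sym by (simp add: vec_eq_iff transpose_def mat_def eq_commute)
  then have symE: "transpose (expB t) = expB t" for t
    using matrix_exp_transpose_eq[of t] by (simp add: matrix_exp_eq)
  have cov: "of_real (cov_integrand B t $ i $ j) = (\<Sum>a\<in>UNIV. P $ i $ a * Q $ a $ j * exp (of_real t * (2 * d a - 1)))" for t i j
  proof -
    define e where "e a = exp (of_real t * (d a - 1/2))" for a
    have cE: "coord (expB t *v x) a = e a * coord x a" for x a
    proof -
      have "of_real ((expB t *v x) $ i) = (\<Sum>b\<in>UNIV. P $ i $ b * (e b * coord x b))" for i
      proof -
        have "of_real ((expB t *v x) $ i) = (\<Sum>l\<in>UNIV. \<Sum>b\<in>UNIV. P $ i $ b * (e b * (Q $ b $ l * of_real (x $ l))))"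
          by (simp add: matrix_vector_mult_def of_real_expB e_def sum_distrib_right mult.assoc)
        also have "\<dots> = (\<Sum>b\<in>UNIV. \<Sum>l\<in>UNIV. P $ i $ b * (e b * (Q $ b $ l * of_real (x $ l))))"
          by (rule sum.swap)
        finally show ?thesis by (simp add: coord_def sum_distrib_left)
      qed
      then have "coord (expB t *v x) a = (\<Sum>i\<in>UNIV. \<Sum>b\<in>UNIV. Q $ a $ i * P $ i $ b * (e b * coord x b))"
        unfolding coord_def[of "expB t *v x"] by (simp add: sum_distrib_left mult.assoc)
      also have "\<dots> = (\<Sum>b\<in>UNIV. \<Sum>i\<in>UNIV. Q $ a $ i * P $ i $ b * (e b * coord x b))"
        by (rule sum.swap)
      also have "\<dots> = (\<Sum>b\<in>UNIV. (Q ** P) $ a $ b * (e b * coord x b))"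
        by (simp add: matrix_matrix_mult_def sum_distrib_right)
      also have "\<dots> = (\<Sum>b\<in>UNIV. if b = a then e a * coord x a else 0)"
        by (intro sum.cong refl) (simp add: QP mat_def)
      finally show ?thesis by simp
    qed
    have "cov_integrand B t $ i $ j = ((expB t ** expB t) *v axis j 1) $ i"
      by (simp add: cov_integrand_eq symE matrix_vector_mult_basis column_def)
    also have "\<dots> = (expB t *v (expB t *v axis j 1)) $ i"
      by (simp only: matrix_vector_mul_assoc)
    finally have "of_real (cov_integrand B t $ i $ j) = (\<Sum>a\<in>UNIV. P $ i $ a * (e a * (e a * Q $ a $ j)))"
      by (simp add: of_real_component cE)
    moreover have "e a * (e a * x) = x * exp (of_real t * (2 * d a - 1))" for a x
    proof -
      have "e a * e a = exp (of_real t * (2 * d a - 1))"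
        unfolding e_def exp_add[symmetric] by (rule arg_cong[where f = exp]) (simp add: algebra_simps)
      then show ?thesis by (simp only: mult.assoc[symmetric] mult.commute[of x])
    qed
    ultimately show ?thesis by (simp add: mult.assoc)
  qed
  have S1: "of_real (Sigma1 B $ i $ j) = (\<Sum>a\<in>UNIV. P $ i $ a * Q $ a $ j * (- 1 / (2 * d a - 1)))" for i j
    unfolding Sigma1_def by (rule exp_sum_integral_infinity(2)[OF finite cov re])
  have "complex_of_real ((Sigma1 B ** ?N) $ i $ j) = complex_of_real ((mat 1 :: real^'n^'n) $ i $ j)" for i j
  proof -
    have QN: "(\<Sum>l\<in>UNIV. Q $ a $ l * of_real (?N $ l $ j)) = (1 - 2 * d a) * Q $ a $ j" for a
    proof -
      have "(\<Sum>l\<in>UNIV. Q $ a $ l * of_real (?N $ l $ j))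
          = (\<Sum>l\<in>UNIV. (if l = j then Q $ a $ j else 0) - 2 * (Q $ a $ l * complex_matrix B $ l $ j))"
        by (intro sum.cong refl) (simp add: mat_def algebra_simps)
      also have "\<dots> = Q $ a $ j - 2 * (Q ** complex_matrix B) $ a $ j"
        by (simp add: sum_subtractf matrix_matrix_mult_def flip: sum_distrib_left)
      finally show ?thesis by (simp add: QB algebra_simps)
    qed
    have "of_real ((Sigma1 B ** ?N) $ i $ j) = (\<Sum>l\<in>UNIV. of_real (Sigma1 B $ i $ l) * of_real (?N $ l $ j))"
      by (simp only: matrix_matrix_mult_def vec_lambda_beta of_real_sum of_real_mult)
    also have "\<dots> = (\<Sum>l\<in>UNIV. \<Sum>a\<in>UNIV. P $ i $ a * (- 1 / (2 * d a - 1)) * (Q $ a $ l * of_real (?N $ l $ j)))"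
      unfolding S1 sum_distrib_right by (intro sum.cong refl) (simp only: mult_ac)
    also have "\<dots> = (\<Sum>a\<in>UNIV. \<Sum>l\<in>UNIV. P $ i $ a * (- 1 / (2 * d a - 1)) * (Q $ a $ l * of_real (?N $ l $ j)))"
      by (rule sum.swap)
    also have "\<dots> = (\<Sum>a\<in>UNIV. P $ i $ a * Q $ a $ j)"
    proof (intro sum.cong refl)
      fix a
      have nz: "2 * d a - 1 \<noteq> 0" using re[of a] by (metis less_irrefl zero_complex.sel(1))
      have "(\<Sum>l\<in>UNIV. P $ i $ a * (- 1 / (2 * d a - 1)) * (Q $ a $ l * of_real (?N $ l $ j)))
          = P $ i $ a * (- 1 / (2 * d a - 1)) * ((1 - 2 * d a) * Q $ a $ j)"
        by (simp only: sum_distrib_left[symmetric] QN)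
      also have "\<dots> = P $ i $ a * Q $ a $ j"
      proof -
        have "x * (- 1 / c) * (- c * y) = x * y" if "c \<noteq> 0" for x y c :: complex using that by simp
        from this[OF nz] show ?thesis by simp
      qed
      finally show "(\<Sum>l\<in>UNIV. P $ i $ a * (- 1 / (2 * d a - 1)) * (Q $ a $ l * of_real (?N $ l $ j))) = P $ i $ a * Q $ a $ j" .
    qed
    also have "\<dots> = (P ** Q) $ i $ j" by (simp add: matrix_matrix_mult_def)
    finally show ?thesis by (simp add: PQ mat_def)
  qed
  then have left: "Sigma1 B ** ?N = mat 1" by (simp only: of_real_eq_iff vec_eq_iff) simp
  then have right: "?N ** Sigma1 B = mat 1" by (simp only: matrix_left_right_inverse)
  show "invertible ?N" using left right by (auto simp: invertible_def)
  show "Sigma1 B = matrix_inv ?N" using matrix_inv_eqI[OF right left] by simp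
qed

end

lemma LIMSEQ_of_complex:
  assumes "(\<lambda>n. complex_of_real (f n)) \<longlonglongrightarrow> s" "complex_of_real x = s"
  shows "f \<longlonglongrightarrow> x"
  using complex_tendsto_of_real(1)[OF assms(1)] assms(2) by auto

text \<open>Takes \<open>lam\<close> itself as the eigenvalue family, so that the formula for the
  critical covariance refers to the listed order and to the given \<open>T\<close>.\<close>

lemma orthogonal_eigenbasis:
  fixes T B :: "real^'n^'n"
  assumes T: "orthogonal_matrix T"
    and diag: "complex_matrix (transpose T ** B ** T) = (\<chi> i j. if i = j then lam i else 0)"
  shows "eigenbasis B (complex_matrix T) (complex_matrix (transpose T)) lam"
proof
  have mult: "complex_matrix A ** complex_matrix C = complex_matrix (A ** C)" for A C :: "real^'n^'n"
    by (simp add: vec_eq_iff matrix_matrix_mult_def)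
  have one: "complex_matrix (mat 1 :: real^'n^'n) = mat 1"
    by (simp add: vec_eq_iff mat_def)
  have TT: "T ** transpose T = mat 1" "transpose T ** T = mat 1"
    using T by (auto simp: orthogonal_matrix_def)
  show "complex_matrix T ** complex_matrix (transpose T) = mat 1"
    "complex_matrix (transpose T) ** complex_matrix T = mat 1"
    by (simp_all add: mult TT one)
  fix a j
  have "transpose T ** B = transpose T ** B ** T ** transpose T"
    by (simp add: matrix_mul_assoc[symmetric] TT)
  then have "complex_matrix (transpose T) ** complex_matrix B = (\<chi> i j. if i = j then lam i else 0) ** complex_matrix (transpose T)"
    by (metis mult diag)
  then show "(complex_matrix (transpose T) ** complex_matrix B) $ a $ j = lam a * complex_matrix (transpose T) $ a $ j"
    by (simp add: diagonal_mult)
qed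

text \<open>For an orthonormal basis the Gram matrix is the identity and kills the off-diagonal
  pairs; since the \<open>lam a\<close> are real, the diagonal condition
  \<open>cnj (lam a) + lam a = 1\<close> says that \<open>lam a\<close> is 1/2. What is left is a
  sum of projections onto columns of \<open>T\<close>.\<close>

lemma orthogonal_Sigma2:
  fixes T B :: "real^'n^'n"
  assumes T: "orthogonal_matrix T"
    and diag: "complex_matrix (transpose T ** B ** T) = (\<chi> i j. if i = j then lam i else 0)"
    and lam: "\<And>a. Re (lam a) \<le> 1/2"
  shows "Sigma2 B = (\<Sum>j\<in>UNIV. (if lam j = 1/2 then 1 else 0) *\<^sub>R
    (T ** (columnvector (axis j 1) :: real^1^'n) ** (rowvector (axis j 1) :: real^'n^1) ** transpose T))"
proof -
  interpret eigenbasis B "complex_matrix T" "complex_matrix (transpose T)" lam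
    by (rule orthogonal_eigenbasis[OF T diag])
  have real: "cnj (lam a) = lam a" for a
  proof -
    have "lam a = of_real ((transpose T ** B ** T) $ a $ a)"
      using arg_cong[OF diag, of "\<lambda>M. M $ a $ a"] by simp
    then show ?thesis by (metis complex_cnj_complex_of_real)
  qed
  have gram: "gram a b = (if a = b then 1 else 0)" for a b
  proof -
    have "gram a b = of_real ((transpose T ** T) $ a $ b)"
      by (simp add: gram_def matrix_matrix_mult_def transpose_def)
    then show ?thesis using T by (simp add: orthogonal_matrix_def mat_def)
  qed
  define c where "c a \<longleftrightarrow> lam a = 1/2" for a
  have half: "2 * lam a = 1 \<longleftrightarrow> c a" "lam a + lam a = 1 \<longleftrightarrow> c a" for a
    by (auto simp: c_def complex_eq_iff)
  have entry: "Sigma2 B $ i $ l = (\<Sum>a\<in>UNIV. if c a then T $ i $ a * T $ l $ a else 0)" for i l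
  proof -
    have "complex_of_real (Sigma2 B $ i $ l) = (\<Sum>a\<in>UNIV. \<Sum>b\<in>UNIV.
        if b = a then (if c a then of_real (T $ i $ a * T $ l $ a) else 0) else 0)"
      unfolding Sigma2_entries(3)[OF lam]
      by (intro sum.cong refl) (auto simp: gram real half transpose_def)
    also have "\<dots> = of_real (\<Sum>a\<in>UNIV. if c a then T $ i $ a * T $ l $ a else 0)"
      by (simp add: if_distrib[of complex_of_real] cong: if_cong)
    finally show ?thesis by (simp only: of_real_eq_iff)
  qed
  have rank1: "(T ** (columnvector (axis j 1) :: real^1^'n) ** (rowvector (axis j 1) :: real^'n^1) ** transpose T) $ i $ l
      = T $ i $ j * T $ l $ j" for i j l
  proof -
    have mult1: "(A ** C) $ i $ m = A $ i $ 1 * C $ 1 $ m" for A :: "real^1^'n" and C :: "real^'n^1" and i m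
      by (simp add: matrix_matrix_mult_def)
    have col: "(T ** (columnvector (axis j 1) :: real^1^'n)) $ i $ 1 = T $ i $ j" for i
    proof -
      have "(T ** (columnvector (axis j 1) :: real^1^'n)) $ i $ 1 = (\<Sum>l\<in>UNIV. if l = j then T $ i $ j else 0)"
        unfolding matrix_matrix_mult_def vec_lambda_beta
        by (intro sum.cong refl) (simp add: columnvector_def axis_def)
      then show ?thesis by simp
    qed
    have "(T ** (columnvector (axis j 1) :: real^1^'n) ** (rowvector (axis j 1) :: real^'n^1) ** transpose T) $ i $ l
        = (\<Sum>m\<in>UNIV. if m = j then T $ i $ j * T $ l $ j else 0)"
      unfolding matrix_matrix_mult_def[of _ "transpose T"] vec_lambda_beta mult1 col
      by (intro sum.cong refl) (simp add: rowvector_def axis_def transpose_def)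
    then show ?thesis by simp
  qed
  show ?thesis
    unfolding vec_eq_iff entry sum_component vector_scaleR_component rank1 c_def
    by (intro allI sum.cong refl) (simp only: real_scaleR_def if_distrib[of "\<lambda>x. x * _"] mult_1 mult_zero_left)
qed

theorem theorem4:
  fixes M :: "'w measure"
    and E :: "('k::finite \<times> 'k) set"
    and p q :: "'k \<Rightarrow> real"
    and \<sigma> :: "'k \<Rightarrow> 'w \<Rightarrow> int"
    and \<xi> :: "nat \<Rightarrow> 'k \<Rightarrow> 'w \<Rightarrow> int"
    and D :: "nat \<Rightarrow> 'k \<Rightarrow> 'w \<Rightarrow> nat"
    and u :: "nat \<Rightarrow> 'k \<Rightarrow> 'w \<Rightarrow> 'k"
    and S :: "nat \<Rightarrow> 'w \<Rightarrow> real^'k"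
    and B :: "real^'k^'k"
    and lam :: "'k \<Rightarrow> complex"
    and \<eta> :: real
  assumes erwg: "ERWG M E p q \<sigma> \<xi> D u"
    and S: "S = erwg_S \<sigma> \<xi> D u"
    and B: "B = memory_matrix E p"
    and lam: "lists_eigenvalues (complex_matrix B) lam"
    and eta: "\<eta> = Max (range (\<lambda>j. Re (lam j)))"
    and diag: "diagonalisable (complex_matrix B)"
  shows
    "(\<eta> < 1/2 \<longrightarrow>
        cov_integrand B integrable_on {0..} \<and>
        (\<exists>N. is_normal_vec N 0 (Sigma1 B) \<and>
          weakly_converges (\<lambda>n. distr M borel (\<lambda>w. (1 / sqrt (real n)) *\<^sub>R S n w)) N)) \<and>
     (\<eta> = 1/2 \<longrightarrow>
        (\<forall>L. cov_integrand B integrable_on {0..L}) \<and> convergent (Sigma2_seq B) \<and>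
        (\<exists>N. is_normal_vec N 0 (Sigma2 B) \<and>
          weakly_converges
            (\<lambda>n. distr M borel (\<lambda>w. (1 / sqrt (real n * ln (real n))) *\<^sub>R S n w)) N)) \<and>
     (transpose B = B \<longrightarrow>
        (\<eta> < 1/2 \<longrightarrow>
           invertible (mat 1 - 2 *\<^sub>R B) \<and> Sigma1 B = matrix_inv (mat 1 - 2 *\<^sub>R B)) \<and>
        (\<forall>T :: real^'k^'k.
           orthogonal_matrix T \<and>
           complex_matrix (transpose T ** B ** T) = (\<chi> i j. if i = j then lam i else 0) \<and>
           \<eta> = 1/2 \<longrightarrow>
           Sigma2 B =
             (\<Sum>j\<in>UNIV. (if lam j = 1/2 then 1 else 0) *\<^sub>R
                (T ** (columnvector (axis j 1) :: real^1^'k)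
                   ** (rowvector (axis j 1) :: real^'k^1) ** transpose T))))"
proof -
  obtain P Q d where "eigenbasis B P Q d"
    using diagonalisable_eigenbasis[OF diag] by blast
  then interpret eigenbasis B P Q d .
  interpret ERWG M E p q \<sigma> \<xi> D u by (rule erwg)
  have lam_le: "Re (lam j) \<le> \<eta>" for j unfolding eta by (rule Max_ge) auto
  have d_le: "Re (d a) \<le> \<eta>" for a
    using eigenvalue_listed[OF lam, of a] lam_le by auto
  show ?thesis
  proof (intro conjI impI allI)
    assume "\<eta> < 1/2"
    then have d: "Re (d a) < 1/2" for a using d_le[of a] by simp
    show "cov_integrand B integrable_on {0..}" by (rule Sigma1_entries(1)[OF d])
    show "\<exists>N. is_normal_vec N 0 (Sigma1 B) \<and>
        weakly_converges (\<lambda>n. distr M borel (\<lambda>w. (1 / sqrt (real n)) *\<^sub>R S n w)) N"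
      unfolding S
    proof (rule weak_limit_normal)
      show "\<forall>\<^sub>F n in sequentially. 0 < real n" using eventually_gt_at_top[of 0] by eventually_elim simp
      show "(\<lambda>n. real n / (real n)\<^sup>2) \<longlonglongrightarrow> 0" by real_asymp
      show "(\<lambda>n. Wsum (memory_matrix E p) n t / real n) \<longlonglongrightarrow> t \<bullet> (Sigma1 B *v t)" for t
        using LIMSEQ_of_complex[OF Wsum_mean_tendsto[OF d] of_real_quadratic[OF Sigma1_entries(2)[OF d]]]
        by (simp add: B)
      show "tback_negligible (memory_matrix E p) real t" for t
        using tback_mean_small[OF d, of t] by (simp only: B)
      show "transpose (Sigma1 B) = Sigma1 B"
        by (rule transpose_of_hermitian[OF Sigma1_entries(2)[OF d]]) (simp add: gram_hermitian add.commute)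
    qed simp
  next
    assume "\<eta> = 1/2"
    then have d: "Re (d a) \<le> 1/2" for a using d_le[of a] by simp
    show "cov_integrand B integrable_on {0..L}" for L by (rule Sigma2_entries(1)[OF d])
    show "convergent (Sigma2_seq B)" by (rule Sigma2_entries(2)[OF d])
    show "\<exists>N. is_normal_vec N 0 (Sigma2 B) \<and>
        weakly_converges (\<lambda>n. distr M borel (\<lambda>w. (1 / sqrt (real n * ln (real n))) *\<^sub>R S n w)) N"
      unfolding S
    proof (rule weak_limit_normal)
      \<comment> \<open>The normalisation is 0 at \<open>n = 0\<close> and \<open>n = 1\<close>,
        where the scaling factor \<open>1 / sqrt 0\<close> is 0; positivity is asked only
        eventually.\<close>
      show "0 \<le> real n * ln (real n)" for n by (cases "n = 0") auto
      show "\<forall>\<^sub>F n in sequentially. 0 < real n * ln (real n)"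
        using eventually_gt_at_top[of 1] by eventually_elim simp
      show "(\<lambda>n. real n * ln (real n) / (real n)\<^sup>2) \<longlonglongrightarrow> 0" by real_asymp
      show "(\<lambda>n. Wsum (memory_matrix E p) n t / (real n * ln (real n))) \<longlonglongrightarrow> t \<bullet> (Sigma2 B *v t)" for t
        using LIMSEQ_of_complex[OF Wsum_log_tendsto[OF d] of_real_quadratic[OF Sigma2_entries(3)[OF d]]]
        by (simp add: B)
      show "tback_negligible (memory_matrix E p) (\<lambda>n. real n * ln (real n)) t" for t
        using tback_log_small[OF d, of t] by (simp only: B)
      show "transpose (Sigma2 B) = Sigma2 B"
      proof (rule transpose_of_hermitian[OF Sigma2_entries(3)[OF d]])
        fix a b
        have "cnj (d a) + d b = 1 \<longleftrightarrow> cnj (d b) + d a = 1"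
          by (auto simp: complex_eq_iff)
        then show "cnj (if cnj (d a) + d b = 1 then gram a b else 0) = (if cnj (d b) + d a = 1 then gram b a else 0)"
          by (simp add: gram_hermitian)
      qed
    qed
  next
    assume sym: "transpose B = B" and "\<eta> < 1/2"
    then have d: "Re (d a) < 1/2" for a using d_le[of a] by simp
    show "invertible (mat 1 - 2 *\<^sub>R B)" "Sigma1 B = matrix_inv (mat 1 - 2 *\<^sub>R B)"
      by (rule symmetric_Sigma1[OF sym d])+
  next
    fix T :: "real^'k^'k"
    assume T: "orthogonal_matrix T \<and>
      complex_matrix (transpose T ** B ** T) = (\<chi> i j. if i = j then lam i else 0) \<and> \<eta> = 1/2"
    then have "Re (lam a) \<le> 1/2" for a using lam_le[of a] by simp
    with T show "Sigma2 B = (\<Sum>j\<in>UNIV. (if lam j = 1/2 then 1 else 0) *\<^sub>R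
        (T ** (columnvector (axis j 1) :: real^1^'k) ** (rowvector (axis j 1) :: real^'k^1) ** transpose T))"
      using orthogonal_Sigma2 by blast
  qed
qed

end
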